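(* Assume the setting, hypotheses on the coefficients $c$, and notation ($a_{\alpha,\beta}$, $K$, $K^{(m)}$, $\Phi$, $Z$, $\overline c$, $\ast$) of the context. For $t\in[0,\infty)$ the variable-coefficient semi-discrete parabolic problem $$\frac{d}{dt}u_\alpha-\sum_{j=1}^d c^j_\alpha\nabla_+^j\nabla_-^j u_\alpha=f_\alpha\quad(\alpha\in\mathbb Z^d,\ t>0),\qquad u_\alpha(0)=\psi_\alpha,$$ has a fundamental solution $\Gamma$ (in the sense defined in the context) of the form $$\Gamma_{\alpha,\beta}(t)=a_{\alpha-\beta,\beta}(t)+\int_0^t\sum_{\eta\in\mathbb Z^d}a_{\alpha-\eta,\eta}(t-s)\,\Phi_{\eta,\beta}(s)\,\Delta x^d\,ds .$$ Moreover, $\Gamma$ has the following properties. (i) For all $\alpha,\beta\in\mathbb Z^d$, $t\in[0,\infty)$ and $0\le s\le t$, $$\Gamma_{\alpha,\beta}(t)=\bigl(\Gamma(s)\ast\Gamma(t-s)\bigr)_{\alpha,\beta}.$$ (ii) For every $T>0$ there is a constant $C_T$, independent of $\alpha,\beta,t$ and $\Delta x$, such that for all $\alpha,\beta\in\mathbb Z^d$ and $t\in(0,T]$, $$|\Gamma_{\alpha,\beta}(t)|\le C_T\left(\frac{1}{\sqrt{2\overline c}}\wedge\frac{t^{1/2}}{\Delta x}\right)^{Z(\alpha-\beta)}t^{-d/2}\prod_{j=1}^d\left(1+\frac{|x^j_\alpha-x^j_\beta|^2}{2\overline c\,t}\right)^{-1}.$$ (iii) For every $T>0$ and $p\in[1,\infty]$,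 with dual exponent $p'=p/(p-1)$, there is a constant $C_{T,p}$, independent of $\alpha,\beta,t$ and $\Delta x$, such that for all $t\in(0,T]$ and $\alpha,\beta\in\mathbb Z^d$, $$\|\Gamma_{\cdot,\beta}(t)\|_{L^{p'}(\mathbb R^d)}+\|\Gamma_{\alpha,\cdot}(t)\|_{L^{p'}(\mathbb R^d)}\le C_{T,p}\,t^{-d/(2p)}.$$
   Context: Grid and norms. Let $d\ge1$, $\Delta x>0$, $x_\alpha=\alpha\,\Delta x$ for $\alpha\in\mathbb Z^d$, with $j$-th component $x_\alpha^j=\alpha^j\Delta x$. A sequence $f=\{f_\alpha\}_{\alpha\in\mathbb Z^d}$ is identified with the function on $\mathbb R^d$ equal to $f_\alpha$ on the cell $x_\alpha+[-\Delta x/2,\Delta x/2)^d$; so $\|f\|_{L^p(\mathbb R^d)}=(\sum_\alpha|f_\alpha|^p\Delta x^d)^{1/p}$ for $p<\infty$ and $\sup_\alpha|f_\alpha|$ for $p=\infty$. $L^p_{\Delta x}(\mathbb R^d)$ is the set of such (bounded) functions lying in $L^p(\mathbb R^d)$; $L^\infty_{\Delta x}(\mathbb R^d\times\mathbb R^d)$ is the analogous space of bounded doubly indexed sequences. Differences. $\nabla_+^jf_\alpha=(f_{\alpha+e_j}-f_\alpha)/\Delta x$, $\nabla_-^jf_\alpha=(f_\alpha-f_{\alpha-e_j})/\Delta x$, with $e_j$ the canonical basis. For doubly indexed $F_{\alpha,\beta}$ the differences act only on $\alpha$. Discrete convolution: $(F\ast G)_{\alpha,\beta}=\sum_{\eta\in\mathbb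 Z^d}F_{\alpha,\eta}G_{\eta,\beta}\Delta x^d$. Discrete Dirac: $\delta_\alpha=\Delta x^{-d}$ if $\alpha=0$ and $0$ otherwise. $Z(\alpha)$ is the number of zero entries of $\alpha\in\mathbb Z^d$; $a\wedge b=\min(a,b)$. Coefficients (standing assumptions). $c^1,\dots,c^d\in L^\infty_{\Delta x}(\mathbb R^d)$ satisfy $\inf_{\alpha,j}c^j_\alpha>0$ and $|c^j_\alpha-c^j_\beta|\le C|x_\alpha-x_\beta|$ for all $\alpha,\beta,j$, with $C$ independent of $\alpha,\beta,j$. Set $\overline c=\sup_{j,\alpha}c^j_\alpha$. "Independent of $\Delta x$" means that, besides the parameters indicated, a constant depends only on $d$, the lower and upper bounds of the coefficients, and the Lipschitz constant $C$. Frozen-coefficient kernel. For fixed $\beta\in\mathbb Z^d$, $(\alpha,t)\mapsto a_{\alpha,\beta}(t)$ is the fundamental solution of the constant-coefficient equation with coefficients $c^1_\beta,\dots,c^d_\beta$: $\frac{d}{dt}a_{\alpha,\beta}=\sum_jc^j_\beta\nabla_+^j\nabla_-^ja_{\alpha,\beta}$, $a_{\alpha,\beta}(0)=\delta_\alpha$. Explicitly $a_{\alpha,\beta}(t)=\Delta x^{-d}\prod_{j=1}^de^{-r^j}I_{\alpha^j}(r^j)$, $r^j=2c^j_\beta t/\Delta x^2$, with $I_n$ the modified Bessel function of the first kind. Kernels. $K_{\alpha,\beta}(t)=\sum_{j=1}^d(c^j_\alpha-c^j_\beta)\nabla_+^j\nabla_-^ja_{\alpha-\beta,\beta}(t)$,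 differences in $\alpha$; $K^{(1)}=K$ and, for $m\ge2$, $K^{(m)}_{\alpha,\beta}(t)=\int_0^t(K(t-s)\ast K^{(m-1)}(s))_{\alpha,\beta}\,ds$; $\Phi_{\alpha,\beta}(t)=\sum_{m=1}^\infty K^{(m)}_{\alpha,\beta}(t)$. Fundamental solution. A fundamental solution of the variable-coefficient problem is a function $\Gamma\in C^1([0,T];L^\infty_{\Delta x}(\mathbb R^d\times\mathbb R^d))$ (for every $T>0$) with $\frac{d}{dt}\Gamma_{\alpha,\beta}(t)=\sum_{j=1}^dc^j_\alpha\nabla_+^j\nabla_-^j\Gamma_{\alpha,\beta}(t)$ for $\alpha,\beta\in\mathbb Z^d$, $t>0$, and $\Gamma_{\alpha,\beta}(0)=\delta_{\alpha-\beta}$. In the claim, $\ast$ denotes the discrete convolution above. *)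

theory Defs
  imports "HOL-Analysis.Analysis"
begin

text \<open>
  The dimension is \<^term>\<open>CARD('d)\<close> and multi-indices have type \<^typ>\<open>int ^ 'd\<close>. A sequence is a
  function on this type. A doubly indexed sequence is curried, and a time-dependent one takes the
  time first. The mesh size \<open>\<Delta>x\<close> is the argument \<open>dx\<close>.
\<close>

section \<open>Grid, norms, differences and convolution\<close>

definition gridpt :: "real \<Rightarrow> int ^ 'd \<Rightarrow> real ^ 'd" where
  "gridpt dx \<alpha> = (\<chi> j. of_int (\<alpha> $ j) * dx)"

text \<open>
  Membership and norm are kept apart because \<^term>\<open>infsum\<close> and the real supremum have arbitrary
  values on divergent or unbounded arguments; the norm is meaningful only for members.
\<close>

definition in_Lp :: "real \<Rightarrow> ereal \<Rightarrow> (int ^ 'd::finite \<Rightarrow> real) \<Rightarrow> bool" where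
  "in_Lp dx q f \<longleftrightarrow> bounded (range f) \<and>
     (q \<noteq> \<infinity> \<longrightarrow> (\<lambda>\<alpha>. \<bar>f \<alpha>\<bar> powr real_of_ereal q * dx ^ CARD('d)) summable_on UNIV)"

definition Lp_norm :: "real \<Rightarrow> ereal \<Rightarrow> (int ^ 'd::finite \<Rightarrow> real) \<Rightarrow> real" where
  "Lp_norm dx q f =
     (if q = \<infinity> then (SUP \<alpha>. \<bar>f \<alpha>\<bar>)
      else (\<Sum>\<^sub>\<infinity>\<alpha>. \<bar>f \<alpha>\<bar> powr real_of_ereal q * dx ^ CARD('d)) powr (1 / real_of_ereal q))"

text \<open>For \<open>p = 1\<close> the division in \<^typ>\<open>ereal\<close> gives \<open>1 / 0 = \<infinity>\<close>, as required.\<close>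

definition dual_exponent :: "ereal \<Rightarrow> ereal" where
  "dual_exponent p = (if p = \<infinity> then 1 else p / (p - 1))"

definition Dplus :: "real \<Rightarrow> 'd::finite \<Rightarrow> (int ^ 'd \<Rightarrow> real) \<Rightarrow> int ^ 'd \<Rightarrow> real" where
  "Dplus dx j f \<alpha> = (f (\<alpha> + axis j 1) - f \<alpha>) / dx"

definition Dminus :: "real \<Rightarrow> 'd::finite \<Rightarrow> (int ^ 'd \<Rightarrow> real) \<Rightarrow> int ^ 'd \<Rightarrow> real" where
  "Dminus dx j f \<alpha> = (f \<alpha> - f (\<alpha> - axis j 1)) / dx"

definition conv_summable ::
  "(int ^ 'd::finite \<Rightarrow> int ^ 'd \<Rightarrow> real) \<Rightarrow> (int ^ 'd \<Rightarrow> int ^ 'd \<Rightarrow> real) \<Rightarrow> bool" where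
  "conv_summable F G \<longleftrightarrow> (\<forall>\<alpha> \<beta>. (\<lambda>\<eta>. F \<alpha> \<eta> * G \<eta> \<beta>) summable_on UNIV)"

definition conv ::
  "real \<Rightarrow> (int ^ 'd::finite \<Rightarrow> int ^ 'd \<Rightarrow> real) \<Rightarrow> (int ^ 'd \<Rightarrow> int ^ 'd \<Rightarrow> real)
     \<Rightarrow> int ^ 'd \<Rightarrow> int ^ 'd \<Rightarrow> real" where
  "conv dx F G \<alpha> \<beta> = (\<Sum>\<^sub>\<infinity>\<eta>. F \<alpha> \<eta> * G \<eta> \<beta> * dx ^ CARD('d))"

definition dirac :: "real \<Rightarrow> int ^ 'd::finite \<Rightarrow> real" where
  "dirac dx \<alpha> = (if \<alpha> = 0 then 1 / dx ^ CARD('d) else 0)"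

definition num_zeros :: "int ^ 'd::finite \<Rightarrow> nat" where
  "num_zeros \<alpha> = card {j. \<alpha> $ j = 0}"

section \<open>Coefficients\<close>

text \<open>
  The coefficient \<open>c\<^sup>j\<^sub>\<alpha>\<close> is \<open>c j \<alpha>\<close>. The bounds and the Lipschitz constant are parameters, so that a
  constant chosen after them but before \<open>dx\<close> and \<open>c\<close> depends on nothing else. The coefficients are
  positive as soon as \<open>0 < lo\<close>.
\<close>

definition coefficients ::
  "real \<Rightarrow> real \<Rightarrow> real \<Rightarrow> real \<Rightarrow> ('d::finite \<Rightarrow> int ^ 'd \<Rightarrow> real) \<Rightarrow> bool" where
  "coefficients dx lo hi L c \<longleftrightarrow>
     (\<forall>j \<alpha>. lo \<le> c j \<alpha> \<and> c j \<alpha> \<le> hi) \<and>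
     (\<forall>j \<alpha> \<beta>. \<bar>c j \<alpha> - c j \<beta>\<bar> \<le> L * norm (gridpt dx \<alpha> - gridpt dx \<beta>))"

definition cbar :: "('d::finite \<Rightarrow> int ^ 'd \<Rightarrow> real) \<Rightarrow> real" where
  "cbar c = (SUP (j, \<alpha>)\<in>UNIV. c j \<alpha>)"

section \<open>Kernels\<close>

text \<open>The power series of the modified Bessel function of integer order, using \<open>I\<^bsub>-n\<^esub> = I\<^sub>n\<close>.\<close>

definition besselI :: "int \<Rightarrow> real \<Rightarrow> real" where
  "besselI n x =
     (\<Sum>k. (x / 2) ^ (2 * k + nat \<bar>n\<bar>) / (fact k * fact (k + nat \<bar>n\<bar>)))"

text \<open>
  The explicit formula for the fundamental solution of the equation with the constant coefficients
  \<open>c\<^sup>j\<^sub>\<beta>\<close>. The index \<open>\<alpha>\<close> is a displacement, and \<open>\<beta>\<close> is the point at which the coefficients are frozen.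
\<close>

definition frozen ::
  "real \<Rightarrow> ('d::finite \<Rightarrow> int ^ 'd \<Rightarrow> real) \<Rightarrow> real \<Rightarrow> int ^ 'd \<Rightarrow> int ^ 'd \<Rightarrow> real" where
  "frozen dx c t \<alpha> \<beta> =
     (\<Prod>j\<in>UNIV. let r = 2 * c j \<beta> * t / dx\<^sup>2 in exp (- r) * besselI (\<alpha> $ j) r) / dx ^ CARD('d)"

definition Kker ::
  "real \<Rightarrow> ('d::finite \<Rightarrow> int ^ 'd \<Rightarrow> real) \<Rightarrow> real \<Rightarrow> int ^ 'd \<Rightarrow> int ^ 'd \<Rightarrow> real" where
  "Kker dx c t \<alpha> \<beta> =
     (\<Sum>j\<in>UNIV. (c j \<alpha> - c j \<beta>) * Dplus dx j (Dminus dx j (\<lambda>\<gamma>. frozen dx c t (\<gamma> - \<beta>) \<beta>)) \<alpha>)"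

text \<open>\<open>Kiter dx c m\<close> is \<open>K\<^sup>(\<^sup>m\<^sup>)\<close> for \<open>m \<ge> 1\<close>; the value at \<open>m = 0\<close> is never used.\<close>

fun Kiter ::
  "real \<Rightarrow> ('d::finite \<Rightarrow> int ^ 'd \<Rightarrow> real) \<Rightarrow> nat \<Rightarrow> real \<Rightarrow> int ^ 'd \<Rightarrow> int ^ 'd \<Rightarrow> real" where
  "Kiter dx c 0 = (\<lambda>t \<alpha> \<beta>. 0)"
| "Kiter dx c (Suc 0) = Kker dx c"
| "Kiter dx c (Suc (Suc m)) =
     (\<lambda>t \<alpha> \<beta>. integral {0..t} (\<lambda>s. conv dx (Kker dx c (t - s)) (Kiter dx c (Suc m) s) \<alpha> \<beta>))"

definition Phi ::
  "real \<Rightarrow> ('d::finite \<Rightarrow> int ^ 'd \<Rightarrow> real) \<Rightarrow> real \<Rightarrow> int ^ 'd \<Rightarrow> int ^ 'd \<Rightarrow> real" where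
  "Phi dx c t \<alpha> \<beta> = (\<Sum>m. Kiter dx c (Suc m) t \<alpha> \<beta>)"

definition Gamma_kernel ::
  "real \<Rightarrow> ('d::finite \<Rightarrow> int ^ 'd \<Rightarrow> real) \<Rightarrow> real \<Rightarrow> int ^ 'd \<Rightarrow> int ^ 'd \<Rightarrow> real" where
  "Gamma_kernel dx c t \<alpha> \<beta> = frozen dx c t (\<alpha> - \<beta>) \<beta> +
     integral {0..t} (\<lambda>s. \<Sum>\<^sub>\<infinity>\<eta>. frozen dx c (t - s) (\<alpha> - \<eta>) \<eta> * Phi dx c s \<eta> \<beta> * dx ^ CARD('d))"

text \<open>
  The claim that every infinite sum and every integral in the definitions of \<open>K\<^sup>(\<^sup>m\<^sup>)\<close>, \<open>\<Phi>\<close> and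
  \<^const>\<open>Gamma_kernel\<close> converges, so that none of them takes a default value. It is part of the
  conclusion of the theorem.
\<close>

definition kernels_well_defined ::
  "real \<Rightarrow> ('d::finite \<Rightarrow> int ^ 'd \<Rightarrow> real) \<Rightarrow> bool" where
  "kernels_well_defined dx c \<longleftrightarrow>
     (\<forall>t\<ge>0.
        (\<forall>m\<ge>1. (\<forall>s\<in>{0..t}. conv_summable (Kker dx c (t - s)) (Kiter dx c m s)) \<and>
           (\<forall>\<alpha> \<beta>. (\<lambda>s. conv dx (Kker dx c (t - s)) (Kiter dx c m s) \<alpha> \<beta>) integrable_on {0..t})) \<and>
        (\<forall>\<alpha> \<beta>. summable (\<lambda>m. Kiter dx c (Suc m) t \<alpha> \<beta>)) \<and>
        (\<forall>s\<in>{0..t}. conv_summable (\<lambda>\<alpha> \<eta>. frozen dx c (t - s) (\<alpha> - \<eta>) \<eta>) (Phi dx c s)) \<and>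
        (\<forall>\<alpha> \<beta>. (\<lambda>s. \<Sum>\<^sub>\<infinity>\<eta>. frozen dx c (t - s) (\<alpha> - \<eta>) \<eta> * Phi dx c s \<eta> \<beta> * dx ^ CARD('d))
           integrable_on {0..t}))"

section \<open>Fundamental solutions\<close>

text \<open>
  The index type is discrete, so the bounded continuous functions on pairs of indices are exactly
  the bounded doubly indexed sequences, with the supremum norm.
\<close>

lemma bounded_sequence_in_bcontfun:
  fixes f :: "(int ^ 'd) \<times> (int ^ 'd) \<Rightarrow> real"
  shows "f \<in> bcontfun \<longleftrightarrow> bounded (range f)"
proof -
  have "open {v}" for v :: "int ^ 'd"
  proof -
    have "open {w :: int ^ 'd. \<forall>j. w $ j \<in> {v $ j}}"
      by (rule open_vector_box) (simp add: open_discrete)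
    moreover have "{w :: int ^ 'd. \<forall>j. w $ j \<in> {v $ j}} = {v}"
      by (auto simp: vec_eq_iff)
    ultimately show ?thesis by simp
  qed
  then have "open ({fst p} \<times> {snd p})" for p :: "(int ^ 'd) \<times> (int ^ 'd)"
    by (intro open_Times)
  then have "open {p}" for p :: "(int ^ 'd) \<times> (int ^ 'd)"
    by (metis insert_Times_insert Sigma_empty1 Times_empty prod.collapse sup_bot.right_neutral
        image_empty)
  then have "open S" for S :: "((int ^ 'd) \<times> (int ^ 'd)) set"
    by (metis (no_types, lifting) open_subopen empty_subsetI insert_subset singletonI)
  then have "continuous_on UNIV f"
    by (simp add: continuous_on_open_vimage)
  then show ?thesis
    by (simp add: bcontfun_def)
qed

definition C1_Linfty :: "real \<Rightarrow> (real \<Rightarrow> int ^ 'd::finite \<Rightarrow> int ^ 'd \<Rightarrow> real) \<Rightarrow> bool" where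
  "C1_Linfty T \<Gamma> \<longleftrightarrow>
     (\<exists>G G' :: real \<Rightarrow> ((int ^ 'd) \<times> (int ^ 'd)) \<Rightarrow>\<^sub>C real.
        (\<forall>t\<in>{0..T}. \<forall>\<alpha> \<beta>. apply_bcontfun (G t) (\<alpha>, \<beta>) = \<Gamma> t \<alpha> \<beta>) \<and>
        (\<forall>t\<in>{0..T}. (G has_vector_derivative G' t) (at t within {0..T})) \<and>
        continuous_on {0..T} G')"

definition fundamental_solution ::
  "real \<Rightarrow> ('d::finite \<Rightarrow> int ^ 'd \<Rightarrow> real) \<Rightarrow> (real \<Rightarrow> int ^ 'd \<Rightarrow> int ^ 'd \<Rightarrow> real) \<Rightarrow> bool" where
  "fundamental_solution dx c \<Gamma> \<longleftrightarrow>
     (\<forall>T>0. C1_Linfty T \<Gamma>) \<and>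
     (\<forall>\<alpha> \<beta>. \<forall>t>0. ((\<lambda>\<tau>. \<Gamma> \<tau> \<alpha> \<beta>) has_real_derivative
        (\<Sum>j\<in>UNIV. c j \<alpha> * Dplus dx j (Dminus dx j (\<lambda>\<gamma>. \<Gamma> t \<gamma> \<beta>)) \<alpha>)) (at t)) \<and>
     (\<forall>\<alpha> \<beta>. \<Gamma> 0 \<alpha> \<beta> = dirac dx (\<alpha> - \<beta>))"

end

theory Submission
  imports Defs
begin

text \<open>
  The proof is Levi's parametrix method. Freezing the coefficients at the source point \<open>\<beta>\<close> gives the
  explicit kernel \<open>a\<close> (\<open>parametrix\<close> below). It fails to solve the equation by exactly \<open>K\<close>: if \<open>A\<close> is the
  variable-coefficient operator, then \<open>A a = a' + K\<close> and \<open>a(0) = \<delta>\<close>. Writing \<open>F \<circledast> H\<close> for the convolution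
  in space and time, \<open>\<Phi>\<close> is the Neumann series of the Volterra equation \<open>\<Phi> = K + K \<circledast> \<Phi>\<close>
  (\<open>Phi_Volterra\<close>), and for \<open>\<Gamma> = a + a \<circledast> \<Phi>\<close> Leibniz' rule gives
  \<open>\<Gamma>' = a' + \<Phi> + a' \<circledast> \<Phi> = (A a - K) + \<Phi> + (A a - K) \<circledast> \<Phi> = A \<Gamma>\<close> (\<open>Gamma_has_derivative\<close>).

  On a fixed mesh nothing is singular: \<open>A\<close> is a bounded operator on bounded sequences, and all kernels
  are continuous in time, down to \<open>t = 0\<close>, and dominated by a fixed summable function of \<open>\<alpha> - \<beta>\<close>. Such
  kernels (\<open>kernel_on\<close>) form a class closed under convolution in space and in time, in which sums and
  integrals may be exchanged freely. The semigroup law (i) then is uniqueness for the bounded linear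
  equation \<open>u' = A u\<close>: both sides solve it in \<open>s\<close> with the same initial value.

  The content of (ii) and (iii) is uniformity in the mesh size \<open>h\<close>. All kernels are compared with one
  envelope, the product over the coordinates of \<open>cell (t / h\<^sup>2) n / h\<close>, where \<open>cell \<tau> n\<close> is
  \<open>\<surd>\<tau> / (\<tau> + n\<^sup>2)\<close> for \<open>n \<noteq> 0\<close> and \<open>min 1 (1 / \<surd>\<tau>)\<close> for \<open>n = 0\<close>. Up to constants this is the right-hand side
  of (ii) (\<open>env_le_profile\<close>). Three facts about the envelope \<open>E\<close> carry the proof.

  \<^item> The envelopes form a semigroup up to a constant, \<open>E(s) * E(t) \<le> C E(s + t)\<close> (\<open>conv_env_bound\<close>). In one
    dimension a cell is a discrete Poisson kernel of width \<open>\<surd>\<tau>\<close>, and for \<open>n = (n - k) + k\<close> one of the two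
    cells is always small enough to be taken out of the sum (\<open>cell_mult_le\<close>).

  \<^item> The parametrix is bounded by \<open>E\<close>, its second differences by \<open>E / t\<close>, and in both bounds a factor
    \<open>\<bar>x\<^sub>\<alpha> - x\<^sub>\<beta>\<bar> / \<surd>t\<close> is affordable (\<open>walk_bounded_uniform\<close>). The bounds are read off the Fourier
    representation of \<open>e\<^sup>-\<^sup>r I\<^sub>n(r)\<close>, by integrating by parts three times.

  \<^item> The Lipschitz factor \<open>c\<^sub>\<alpha> - c\<^sub>\<beta>\<close> in \<open>K\<close> therefore gains a factor \<open>\<surd>t\<close>: one has \<open>\<bar>K(t)\<bar> \<le> C E(t) / \<surd>t\<close>
    (\<open>Kker_scaled_bound\<close>), a singularity that is integrable in time.

  Hence the Volterra series converges with \<open>\<bar>\<Phi>(t)\<bar> \<le> C E(t) / \<surd>t\<close>, and \<open>\<bar>\<Gamma>(t)\<bar> \<le> C E(t)\<close> up to any fixed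
  time \<open>T\<close> (\<open>Gamma_uniform_bound\<close>), which is (ii). Since \<open>E(t)\<close> has supremum at most \<open>t\<^sup>-\<^sup>d\<^sup>/\<^sup>2\<close> and bounded
  mass, (iii) follows by interpolation between the two.
\<close>

section \<open>Dominated infinite sums\<close>

lemma continuous_on_infsum_dominated:
  fixes f :: "'i \<Rightarrow> 'a::topological_space \<Rightarrow> 'b::banach"
  assumes "\<And>i. i \<in> A \<Longrightarrow> continuous_on S (f i)"
    and "\<And>i x. i \<in> A \<Longrightarrow> x \<in> S \<Longrightarrow> norm (f i x) \<le> M i"
    and "M summable_on A"
  shows "continuous_on S (\<lambda>x. \<Sum>\<^sub>\<infinity>i\<in>A. f i x)"
proof (rule uniform_limit_theorem)
  show "uniform_limit S (\<lambda>X y. \<Sum>x\<in>X. f x y) (\<lambda>y. \<Sum>\<^sub>\<infinity>x\<in>A. f x y) (finite_subsets_at_top A)"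
    using assms by (intro Weierstrass_m_test_general) auto
  show "\<forall>\<^sub>F X in finite_subsets_at_top A. continuous_on S (\<lambda>y. \<Sum>x\<in>X. f x y)"
    using assms(1) by (intro eventually_finite_subsets_at_top_weakI continuous_on_sum) auto
qed auto

lemma has_sum_integral_dominated:
  fixes f :: "'i \<Rightarrow> real \<Rightarrow> 'b::banach"
  assumes cont: "\<And>i. continuous_on {a..b} (f i)"
    and le: "\<And>i x. x \<in> {a..b} \<Longrightarrow> norm (f i x) \<le> M i"
    and "M summable_on UNIV"
  shows "((\<lambda>i. integral {a..b} (f i)) has_sum integral {a..b} (\<lambda>x. \<Sum>\<^sub>\<infinity>i. f i x)) UNIV"
proof -
  have "uniform_limit {a..b} (\<lambda>X y. \<Sum>x\<in>X. f x y) (\<lambda>y. \<Sum>\<^sub>\<infinity>x. f x y) (finite_subsets_at_top UNIV)"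
    using assms by (intro Weierstrass_m_test_general) auto
  moreover have "continuous_on {a..b} (\<lambda>y. \<Sum>x\<in>X. f x y)" for X
    using cont by (intro continuous_on_sum) auto
  ultimately obtain I J where I: "\<And>X. ((\<lambda>y. \<Sum>x\<in>X. f x y) has_integral I X) {a..b}"
    and J: "((\<lambda>y. \<Sum>\<^sub>\<infinity>x. f x y) has_integral J) {a..b}"
    and lim: "(I \<longlongrightarrow> J) (finite_subsets_at_top UNIV)"
    by (rule uniform_limit_integral) auto
  have "\<forall>\<^sub>F X in finite_subsets_at_top UNIV. I X = (\<Sum>i\<in>X. integral {a..b} (f i))"
  proof (intro eventually_finite_subsets_at_top_weakI)
    fix X :: "'i set" assume "finite X"
    have "I X = integral {a..b} (\<lambda>y. \<Sum>x\<in>X. f x y)" using I[of X] by (simp add: integral_unique)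
    also have "\<dots> = (\<Sum>i\<in>X. integral {a..b} (f i))"
      using \<open>finite X\<close> cont by (intro integral_sum) (auto intro: integrable_continuous_real)
    finally show "I X = (\<Sum>i\<in>X. integral {a..b} (f i))" .
  qed
  from tendsto_cong[OF this] lim J show ?thesis
    by (auto simp: has_sum_def integral_unique)
qed


lemma has_sum_finite_sum:
  fixes f :: "'i \<Rightarrow> 'a \<Rightarrow> 'b::topological_comm_monoid_add"
  assumes "finite I" "\<And>i. i \<in> I \<Longrightarrow> (f i has_sum s i) A"
  shows "((\<lambda>x. \<Sum>i\<in>I. f i x) has_sum (\<Sum>i\<in>I. s i)) A"
  using assms by (induction I rule: finite_induct) (auto intro: has_sum_add)


section \<open>Fourier representation of the lattice heat kernel\<close>

text \<open>
  The transition probability \<open>e\<^sup>-\<^sup>r I\<^sub>n(r)\<close> from \<open>0\<close> to \<open>n\<close> at time \<open>r\<close> of the simple random walk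
  in continuous time with jump rate one.
\<close>

definition walk :: "int \<Rightarrow> real \<Rightarrow> real" where
  "walk n r = exp (- r) * besselI n r"

definition walk_lap :: "int \<Rightarrow> real \<Rightarrow> real" where
  "walk_lap n r = walk (n + 1) r - 2 * walk n r + walk (n - 1) r"

lemma cis_int_add: "cis (of_int (m + n) * t) = cis (of_int m * t) * cis (of_int n * t)"
  by (simp add: cis_mult algebra_simps)

lemma has_vector_derivative_cis_int:
  "((\<lambda>t. cis (of_int n * t)) has_vector_derivative \<i> * of_int n * cis (of_int n * t)) (at t within S)"
proof -
  have "((\<lambda>z. exp (\<i> * of_int n * z)) has_field_derivative \<i> * of_int n * exp (\<i> * of_int n * of_real t))
     (at (of_real t))"
    by (auto intro!: derivative_eq_intros)
  from has_vector_derivative_real_field[OF this, of S] show ?thesis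
    by (simp add: cis_conv_exp mult_ac)
qed

lemma integral_cis_int:
  "integral {-pi..pi} (\<lambda>t. cis (of_int n * t)) = (if n = 0 then 2 * of_real pi else 0)"
proof (cases "n = 0")
  case True
  have "integral {-pi..pi} (\<lambda>t. 1 :: complex) = of_real (2 * pi)"
    by (simp add: scaleR_conv_of_real)
  then show ?thesis using True by simp
next
  case False
  have "((\<lambda>t. cis (of_int n * t)) has_integral
      (cis (of_int n * pi) / (\<i> * of_int n) - cis (of_int n * (-pi)) / (\<i> * of_int n))) {-pi..pi}"
    using False
    by (intro fundamental_theorem_of_calculus)
       (auto intro!: has_vector_derivative_divide[OF has_vector_derivative_cis_int, THEN has_vector_derivative_eq_rhs])
  moreover have "cis (of_int n * pi) = cis (of_int n * (-pi))"
    by (simp add: complex_eq_iff sin_int_times_real mult.commute)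
  ultimately show ?thesis using False by (simp add: integral_unique)
qed

lemma exp_complex_has_sum: "((\<lambda>k. z ^ k / fact k) has_sum exp z) (UNIV :: nat set)" for z :: complex
proof (rule norm_summable_imp_has_sum)
  show "summable (\<lambda>k. norm (z ^ k / fact k))"
    using summable_norm_exp[of z] by (simp add: scaleR_conv_of_real divide_inverse mult.commute)
  show "(\<lambda>k. z ^ k / fact k) sums exp z"
    using exp_converges[of z] by (simp add: scaleR_conv_of_real divide_inverse mult.commute)
qed

lemma exp_real_summable_on: "(\<lambda>k. x ^ k / fact k * c) summable_on (UNIV :: nat set)" for x :: real
  using summable_norm_exp[of x] 
  by (intro summable_on_cmult_left norm_summable_imp_summable_on)
     (auto simp: divide_inverse mult.commute)

text \<open>
  Only the term \<open>k = -m\<close> of the exponential series has a nonzero mean over the circle.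
\<close>

lemma integral_exp_cis:
  "integral {-pi..pi} (\<lambda>t. exp (of_real a * cis t) * cis (of_int m * t))
    = (if m \<le> 0 then 2 * of_real pi * of_real (a ^ nat (-m) / fact (nat (-m))) else 0)"
proof -
  let ?f = "\<lambda>k t. (of_real a * cis t) ^ k / fact k * cis (of_int m * t)"
  have "((\<lambda>k. integral {-pi..pi} (?f k)) has_sum integral {-pi..pi} (\<lambda>t. \<Sum>\<^sub>\<infinity>k. ?f k t)) UNIV"
    using exp_real_summable_on[of "\<bar>a\<bar>" 1]
    by (intro has_sum_integral_dominated[where M = "\<lambda>k. \<bar>a\<bar> ^ k / fact k"])
       (auto intro!: continuous_intros simp: norm_mult norm_divide norm_power)
  moreover have "(\<Sum>\<^sub>\<infinity>k. ?f k t) = exp (of_real a * cis t) * cis (of_int m * t)" for t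
    by (intro infsumI has_sum_cmult_left exp_complex_has_sum)
  moreover have "integral {-pi..pi} (?f k) = (if int k = - m then 2 * of_real pi * of_real (a ^ k / fact k) else 0)" for k
  proof -
    have "?f k t = of_real (a ^ k / fact k) * cis (of_int (int k + m) * t)" for t
      by (simp only: cis_int_add power_mult_distrib cis_power_int of_int_of_nat_eq)
         (simp add: Complex.DeMoivre)
    then have "integral {-pi..pi} (?f k) = of_real (a ^ k / fact k) * integral {-pi..pi} (\<lambda>t. cis (of_int (int k + m) * t))"
      by (simp only: integral_mult_right)
    then show ?thesis by (simp only: integral_cis_int) (auto simp: )
  qed
  ultimately have *: "((\<lambda>k. (if int k = - m then 2 * of_real pi * of_real (a ^ k / fact k) else 0))
      has_sum integral {-pi..pi} (\<lambda>t. exp (of_real a * cis t) * cis (of_int m * t))) UNIV" by simp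
  have "((\<lambda>k. (if int k = - m then 2 * of_real pi * of_real (a ^ k / fact k) else 0)) has_sum 
     (\<Sum>k\<in>(if m \<le> 0 then {nat (-m)} else {}). (if int k = - m then 2 * of_real pi * of_real (a ^ k / fact k) else 0 :: complex))) UNIV"
    by (rule has_sum_finite_neutralI) (auto split: if_splits)
  from has_sum_unique[OF * this] show ?thesis by auto
qed

lemma besselI_has_sum:
  "((\<lambda>k. (x / 2) ^ (2 * k + nat \<bar>n\<bar>) / (fact k * fact (k + nat \<bar>n\<bar>))) has_sum besselI n x) UNIV"
proof -
  have "norm ((x / 2) ^ (2 * k + nat \<bar>n\<bar>) / (fact k * fact (k + nat \<bar>n\<bar>)))
     \<le> ((x / 2)\<^sup>2) ^ k / fact k * \<bar>x / 2\<bar> ^ nat \<bar>n\<bar>" for k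
  proof -
    have "norm ((x / 2) ^ (2 * k + nat \<bar>n\<bar>) / (fact k * fact (k + nat \<bar>n\<bar>))) =
       ((x / 2)\<^sup>2) ^ k * \<bar>x / 2\<bar> ^ nat \<bar>n\<bar> / (fact k * fact (k + nat \<bar>n\<bar>))"
      by (simp add: power_add power_mult abs_mult) (simp add: power_abs)
    also have "\<dots> \<le> ((x / 2)\<^sup>2) ^ k * \<bar>x / 2\<bar> ^ nat \<bar>n\<bar> / (fact k * 1)"
      by (intro divide_left_mono mult_left_mono) auto
    finally show ?thesis by simp
  qed
  then have "summable (\<lambda>k. norm ((x / 2) ^ (2 * k + nat \<bar>n\<bar>) / (fact k * fact (k + nat \<bar>n\<bar>))))"
    using exp_real_summable_on[of "(x/2)\<^sup>2" "\<bar>x / 2\<bar> ^ nat \<bar>n\<bar>", THEN summable_on_imp_summable]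
    by (rule_tac summable_comparison_test) auto
  from norm_summable_imp_has_sum[OF this summable_sums[OF summable_norm_cancel[OF this]]]
  show ?thesis by (simp add: besselI_def)
qed

text \<open>
  The generating function of the Bessel functions: \<open>e\<^bsup>r cos t\<^esup>\<close> is the product of \<open>exp ((r / 2)
  cis t)\<close> and \<open>exp ((r / 2) cis (-t))\<close>; the second factor is expanded, and the preceding lemma
  evaluates each term. The index is nonpositive, so that every term of the series contributes.
\<close>

lemma integral_exp_cos_nonpos:
  fixes r :: real
  shows "integral {-pi..pi} (\<lambda>t. of_real (exp (r * cos t)) * cis (of_int (- int m) * t))
    = 2 * of_real pi * of_real (besselI (int m) r)"
proof -
  define a where "a = r / 2"
  have ex: "of_real (exp (r * cos t)) = exp (of_real a * cis t) * exp (of_real a * cis (-t))" for t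
  proof -
    have "of_real (r * cos t) = of_real a * cis t + of_real a * cis (-t)"
      by (simp add: a_def complex_eq_iff)
    then show ?thesis by (metis exp_add exp_of_real)
  qed
  let ?f = "\<lambda>k t. (of_real a * cis (-t)) ^ k / fact k * (exp (of_real a * cis t) * cis (of_int (- int m) * t))"
  have hs: "((\<lambda>k. integral {-pi..pi} (?f k)) has_sum integral {-pi..pi} (\<lambda>t. \<Sum>\<^sub>\<infinity>k. ?f k t)) UNIV"
  proof (rule has_sum_integral_dominated[where M = "\<lambda>k. \<bar>a\<bar> ^ k / fact k * exp \<bar>a\<bar>"])
    show "(\<lambda>k. \<bar>a\<bar> ^ k / fact k * exp \<bar>a\<bar>) summable_on UNIV" by (rule exp_real_summable_on)
    fix k t
    have "norm (exp (of_real a * cis t)) \<le> exp \<bar>a\<bar>"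
      using norm_exp[of "of_real a * cis t"] by (simp add: norm_mult)
    then show "norm (?f k t) \<le> \<bar>a\<bar> ^ k / fact k * exp \<bar>a\<bar>" 
      by (simp add: norm_mult norm_divide norm_power divide_right_mono mult_left_mono)
  qed (auto intro!: continuous_intros)
  have "(\<Sum>\<^sub>\<infinity>k. ?f k t) = exp (of_real a * cis (-t)) * (exp (of_real a * cis t) * cis (of_int (- int m) * t))" for t
    by (intro infsumI has_sum_cmult_left exp_complex_has_sum)
  moreover have "exp (of_real a * cis (-t)) * (exp (of_real a * cis t) * cis (of_int (- int m) * t)) =
      of_real (exp (r * cos t)) * cis (of_int (- int m) * t)" for t
    unfolding ex by (rule mult.left_commute[THEN trans, OF mult.assoc[symmetric]])
  ultimately have S: "(\<lambda>t. \<Sum>\<^sub>\<infinity>k. ?f k t) = (\<lambda>t. of_real (exp (r * cos t)) * cis (of_int (- int m) * t))"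
    by (intro ext) (rule trans)
  have I: "integral {-pi..pi} (?f k) = 2 * of_real pi * of_real (a ^ (2 * k + m) / (fact k * fact (k + m)))" for k
  proof -
    have "cis (- t) ^ k = cis (of_int (- int k) * t)" for t by (simp add: Complex.DeMoivre)
    then have "?f k t = of_real (a ^ k / fact k) * (exp (of_real a * cis t) * cis (of_int (- int k - int m) * t))" for t
      using cis_int_add[of "- int k" "- int m" t]
      by (simp add: power_mult_distrib mult_ac)
    then have "integral {-pi..pi} (?f k) = of_real (a ^ k / fact k) *
        integral {-pi..pi} (\<lambda>t. exp (of_real a * cis t) * cis (of_int (- int k - int m) * t))"
      by (simp only: integral_mult_right)
    also have "nat (- (- int k - int m)) = k + m" by simp
    then have "integral {-pi..pi} (\<lambda>t. exp (of_real a * cis t) * cis (of_int (- int k - int m) * t)) =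
       2 * of_real pi * of_real (a ^ (k + m) / fact (k + m))"
      by (simp only: integral_exp_cis) simp
    finally have "integral {-pi..pi} (?f k) = of_real (a ^ k / fact k) * (2 * of_real pi * of_real (a ^ (k + m) / fact (k + m)))" .
    moreover have "a ^ (2 * k + m) = a ^ k * a ^ (k + m)"
      by (simp add: mult_2 add.assoc flip: power_add)
    ultimately show ?thesis by simp
  qed
  note hs[unfolded S I]
  moreover have "((\<lambda>k. 2 * of_real pi * (of_real (a ^ (2 * k + m) / (fact k * fact (k + m))) :: complex)) has_sum
      2 * of_real pi * of_real (besselI (int m) r)) UNIV"
    using besselI_has_sum[of r "int m"] by (intro has_sum_cmult_right has_sum_of_real) (simp add: a_def)
  ultimately show ?thesis by (rule has_sum_unique)
qed

text \<open>
  The reflection \<open>t \<mapsto> -t\<close> reduces positive indices to negative ones.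
\<close>

lemma walk_fourier:
  "complex_of_real (walk n r) =
     integral {-pi..pi} (\<lambda>t. of_real (exp (- r * (1 - cos t))) * cis (of_int n * t)) / (2 * of_real pi)"
proof -
  have "integral {-pi..pi} (\<lambda>t. of_real (exp (r * cos t)) * cis (of_int n * t)) = 2 * of_real pi * of_real (besselI n r)"
  proof (cases "n \<le> 0")
    case True
    then obtain m where "n = - int m" by (metis zero_le_imp_eq_int neg_0_le_iff_le minus_minus)
    moreover have "besselI (- int m) r = besselI (int m) r" by (simp add: besselI_def)
    ultimately show ?thesis using integral_exp_cos_nonpos[of r m] by simp
  next
    case False
    then obtain m where n: "n = int m" by (metis zero_le_imp_eq_int linear)
    have "integral {-pi..pi} (\<lambda>t. of_real (exp (r * cos t)) * cis (of_int n * t)) =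
       integral {-pi..pi} (\<lambda>t. of_real (exp (r * cos t)) * cis (of_int (- int m) * t))"
      using Henstock_Kurzweil_Integration.integral_reflect_real[of pi "-pi" "\<lambda>t. of_real (exp (r * cos t)) * cis (of_int n * t)"]
      by (simp add: n)
    then show ?thesis using integral_exp_cos_nonpos[of r m] n by simp
  qed
  moreover have "of_real (exp (- r * (1 - cos t))) * cis (of_int n * t) =
      of_real (exp (- r)) * (of_real (exp (r * cos t)) * cis (of_int n * t))" for t
    by (simp add: algebra_simps exp_add exp_diff exp_minus divide_inverse)
  ultimately show ?thesis
    by (simp only: integral_mult_right walk_def of_real_mult) simp
qed

text \<open>
  The boundary terms cancel because \<open>F\<close> and \<open>cis\<close> take the same values at \<open>-\<pi>\<close> and \<open>\<pi>\<close>.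
\<close>

lemma fourier_by_parts:
  fixes F F' :: "real \<Rightarrow> real"
  assumes "\<And>t. (F has_real_derivative F' t) (at t)" and "continuous_on UNIV F'"
    and "F (- pi) = F pi"
  shows "\<i> * of_int n * integral {-pi..pi} (\<lambda>t. of_real (F t) * cis (of_int n * t))
    = - integral {-pi..pi} (\<lambda>t. of_real (F' t) * cis (of_int n * t))"
proof -
  have contF: "continuous_on UNIV F"
    using assms(1) by (intro DERIV_continuous_on) auto
  have "((\<lambda>t. of_real (F' t) * cis (of_int n * t) + \<i> * of_int n * (of_real (F t) * cis (of_int n * t)))
     has_integral (of_real (F pi) * cis (of_int n * pi) - of_real (F (-pi)) * cis (of_int n * (-pi)))) {-pi..pi}"
  proof (rule fundamental_theorem_of_calculus)
    fix t
    have "((\<lambda>t. complex_of_real (F t)) has_vector_derivative of_real (F' t)) (at t within {-pi..pi})"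
      using assms(1)[of t] 
      by (intro has_vector_derivative_of_real) (auto simp: has_real_derivative_iff_has_vector_derivative intro: has_vector_derivative_at_within)
    from has_vector_derivative_mult[OF this has_vector_derivative_cis_int[of n t]]
    show "((\<lambda>t. of_real (F t) * cis (of_int n * t)) has_vector_derivative
       (of_real (F' t) * cis (of_int n * t) + \<i> * of_int n * (of_real (F t) * cis (of_int n * t)))) (at t within {-pi..pi})"
      by (simp add: add.commute mult.left_commute)
  qed simp
  moreover have "cis (of_int n * pi) = cis (of_int n * (-pi))"
    by (simp add: complex_eq_iff sin_int_times_real mult.commute)
  ultimately have 0: "integral {-pi..pi} (\<lambda>t. of_real (F' t) * cis (of_int n * t) + \<i> * of_int n * (of_real (F t) * cis (of_int n * t))) = 0"
    using assms(3) by (simp add: integral_unique)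
  have "(\<lambda>t. of_real (F' t) * cis (of_int n * t)) integrable_on {-pi..pi}"
    "(\<lambda>t. \<i> * of_int n * (of_real (F t) * cis (of_int n * t))) integrable_on {-pi..pi}"
    using contF assms(2) by (auto intro!: integrable_continuous_real continuous_intros intro: continuous_on_subset)
  from integral_add[OF this] 0
  have "integral {-pi..pi} (\<lambda>t. of_real (F' t) * cis (of_int n * t)) +
     integral {-pi..pi} (\<lambda>t. \<i> * of_int n * (of_real (F t) * cis (of_int n * t))) = 0" by (simp only:)
  then show ?thesis by (simp only: integral_mult_right add_eq_0_iff)
qed

lemma fourier_cubic_decay:
  fixes F :: "nat \<Rightarrow> real \<Rightarrow> real" and n :: int
  assumes "\<And>k t. k < 3 \<Longrightarrow> (F k has_real_derivative F (Suc k) t) (at t)"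
    and "\<And>k. k < 3 \<Longrightarrow> F k (- pi) = F k pi"
    and "continuous_on UNIV (F 3)"
    and "continuous_on {-pi..pi} g" "\<And>t. t \<in> {-pi..pi} \<Longrightarrow> \<bar>F 3 t\<bar> \<le> g t"
  shows "\<bar>of_int n\<bar> ^ 3 * norm (integral {-pi..pi} (\<lambda>t. of_real (F 0 t) * cis (of_int n * t)))
    \<le> integral {-pi..pi} g"
proof -
  have cont: "continuous_on UNIV (F (Suc k))" if "k < 3" for k
  proof (cases "k = 2")
    case False
    then show ?thesis using that assms(1)[of "Suc k"] by (intro DERIV_continuous_on) auto
  qed (use assms(3) in \<open>simp add: numeral_eq_Suc\<close>)
  define I where "I k = norm (integral {-pi..pi} (\<lambda>t. of_real (F k t) * cis (of_int n * t)))" for k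
  have step: "\<bar>of_int n\<bar> * I k = I (Suc k)" if "k < 3" for k
    using arg_cong[OF fourier_by_parts[OF assms(1)[OF that] cont[OF that] assms(2)[OF that], of n], of norm]
    by (simp add: norm_mult I_def)
  have "\<bar>of_int n\<bar> ^ 3 * x = \<bar>of_int n\<bar> * (\<bar>of_int n\<bar> * (\<bar>of_int n\<bar> * x))" for x :: real
    unfolding power3_eq_cube by (simp only: mult.assoc)
  then have "\<bar>of_int n\<bar> ^ 3 * I 0 = I 3"
    using step[of 0] step[of 1] step[of 2] by (simp only: less_numeral_simps numeral_3_eq_3 numeral_2_eq_2 One_nat_def zero_less_Suc Suc_less_eq simp_thms)
  then have "\<bar>of_int n\<bar> ^ 3 * norm (integral {-pi..pi} (\<lambda>t. of_real (F 0 t) * cis (of_int n * t))) =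
    norm (integral {-pi..pi} (\<lambda>t. of_real (F 3 t) * cis (of_int n * t)))"
    by (simp add: I_def)
  also have "\<dots> \<le> integral {-pi..pi} g"
    using assms
    by (intro integral_norm_bound_integral integrable_continuous_real continuous_intros)
       (auto simp: norm_mult intro: continuous_on_subset)
  finally show ?thesis .
qed

text \<open>
  The Fourier symbol of the walk. The second difference of the walk has symbol \<open>-2 (1 - cos t)
  symb r t\<close>.
\<close>

definition symb :: "real \<Rightarrow> real \<Rightarrow> real" where
  "symb r t = exp (- r * (1 - cos t))"

lemma has_real_derivative_symb [derivative_intros]:
  "(f has_real_derivative f') (at t within S) \<Longrightarrow>
     ((\<lambda>t. symb r (f t)) has_real_derivative - r * sin (f t) * symb r (f t) * f') (at t within S)"
  unfolding symb_def by (auto intro!: derivative_eq_intros)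

lemma continuous_on_symb [continuous_intros]:
  fixes f g :: "'a::t2_space \<Rightarrow> real"
  shows "continuous_on S f \<Longrightarrow> continuous_on S g \<Longrightarrow> continuous_on S (\<lambda>x. symb (f x) (g x))"
  unfolding symb_def by (auto intro!: continuous_intros)

lemma symb_pos: "0 < symb r t" and symb_neg_pi [simp]: "symb r (- pi) = symb r pi"
  by (simp_all add: symb_def)

lemma walk_as_integral:
  "complex_of_real (walk n r) = integral {-pi..pi} (\<lambda>t. of_real (symb r t) * cis (of_int n * t)) / (2 * of_real pi)"
  using walk_fourier[of n r] by (simp add: symb_def)

lemma walk_lap_as_integral:
  "complex_of_real (walk_lap n r) =
     - integral {-pi..pi} (\<lambda>t. of_real ((1 - cos t) * symb r t) * cis (of_int n * t)) / of_real pi"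
proof -
  define f where "f m t = of_real (symb r t) * cis (of_int m * t)" for m t
  have shift: "f (n + 1) t - 2 * f n t + f (n - 1) t = -2 * (of_real ((1 - cos t) * symb r t) * cis (of_int n * t))" for t
  proof -
    have "cis (of_int (n + 1) * t) = cis (of_int n * t) * cis t"
      "cis (of_int (n - 1) * t) = cis (of_int n * t) * cis (- t)"
      by (simp_all add: cis_mult algebra_simps)
    then have "f (n + 1) t - 2 * f n t + f (n - 1) t
        = of_real (symb r t) * cis (of_int n * t) * ((cis t + cis (- t)) - 2)"
      unfolding f_def by (simp only:) (simp add: algebra_simps)
    moreover have "cis t + cis (- t) = of_real (2 * cos t)" by (simp add: complex_eq_iff)
    ultimately have "f (n + 1) t - 2 * f n t + f (n - 1) t
        = of_real (symb r t) * cis (of_int n * t) * (of_real (2 * cos t) - 2)" by (simp only:)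
    also have "\<dots> = -2 * (of_real ((1 - cos t) * symb r t) * cis (of_int n * t))"
      by (simp add: algebra_simps)
    finally show ?thesis .
  qed
  have I: "(f m has_integral 2 * of_real pi * of_real (walk m r)) {-pi..pi}" for m
  proof -
    have "f m integrable_on {-pi..pi}"
      unfolding f_def by (intro integrable_continuous_real continuous_intros)
    then show ?thesis
      using walk_as_integral[of m r] by (simp add: f_def[abs_def] has_integral_integral)
  qed
  have "((\<lambda>t. f (n + 1) t - 2 * f n t + f (n - 1) t) has_integral
      (2 * of_real pi * of_real (walk (n + 1) r) - 2 * (2 * of_real pi * of_real (walk n r))
        + 2 * of_real pi * of_real (walk (n - 1) r))) {-pi..pi}"
    by (intro has_integral_add has_integral_diff has_integral_mult_right I)
  then have "-2 * integral {-pi..pi} (\<lambda>t. of_real ((1 - cos t) * symb r t) * cis (of_int n * t)) =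
      2 * of_real pi * of_real (walk (n + 1) r) - 2 * (2 * of_real pi * of_real (walk n r))
        + 2 * of_real pi * of_real (walk (n - 1) r)"
    unfolding shift integral_mult_right[symmetric] by (rule integral_unique)
  also have "\<dots> = 2 * (of_real pi * of_real (walk_lap n r))"
    by (simp add: walk_lap_def algebra_simps)
  finally have "- integral {-pi..pi} (\<lambda>t. of_real ((1 - cos t) * symb r t) * cis (of_int n * t)) =
      of_real pi * of_real (walk_lap n r)"
    by simp
  then show ?thesis by simp
qed

text \<open>The heat equation on the integers, by differentiation under the Fourier integral.\<close>

lemma has_real_derivative_walk:
  "(walk n has_real_derivative walk_lap n r / 2) (at r)"
proof -
  have "((\<lambda>r. integral (cbox (-pi) pi) (\<lambda>t. of_real (symb r t) * cis (of_int n * t))) has_vector_derivative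
      integral (cbox (-pi) pi) (\<lambda>t. - (of_real ((1 - cos t) * symb r t) * cis (of_int n * t)))) (at r within UNIV)"
  proof (rule leibniz_rule_vector_derivative)
    fix r t :: real
    have "((\<lambda>r. symb r t) has_real_derivative - ((1 - cos t) * symb r t)) (at r)"
      unfolding symb_def by (auto intro!: derivative_eq_intros simp: algebra_simps)
    then have "((\<lambda>r. complex_of_real (symb r t)) has_vector_derivative of_real (- ((1 - cos t) * symb r t))) (at r)"
      by (intro has_vector_derivative_of_real) (simp add: has_real_derivative_iff_has_vector_derivative)
    from has_vector_derivative_mult_left[OF this, of "cis (of_int n * t)"]
    show "((\<lambda>r. of_real (symb r t) * cis (of_int n * t)) has_vector_derivative
       - (of_real ((1 - cos t) * symb r t) * cis (of_int n * t))) (at r within UNIV)" by simp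
  qed (auto intro!: integrable_continuous_real continuous_intros simp: split_beta)
  from has_vector_derivative_divide[OF this, of "2 * of_real pi"]
  have "((\<lambda>r. complex_of_real (walk n r)) has_vector_derivative of_real (walk_lap n r / 2)) (at r)"
    by (simp add: walk_as_integral walk_lap_as_integral integral_neg mult.commute[of 2])
  from bounded_linear.has_vector_derivative[OF bounded_linear_Re this]
  show ?thesis by (simp add: has_real_derivative_iff_has_vector_derivative)
qed

lemma walk_0: "walk n 0 = (if n = 0 then 1 else 0)"
proof -
  have "besselI n 0 = (if n = 0 then 1 else 0)"
  proof (cases "n = 0")
    case True
    have "(\<Sum>k. (0 / 2) ^ (2 * k + nat \<bar>n\<bar>) / (fact k * fact (k + nat \<bar>n\<bar>)) :: real) =
       (\<Sum>k\<in>{0::nat}. (0 / 2) ^ (2 * k + nat \<bar>n\<bar>) / (fact k * fact (k + nat \<bar>n\<bar>)))"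
      by (rule suminf_finite) auto
    then show ?thesis using True by (simp add: besselI_def)
  next
    case False
    then have "(\<lambda>k. (0 / 2) ^ (2 * k + nat \<bar>n\<bar>) / (fact k * fact (k + nat \<bar>n\<bar>)) :: real) = (\<lambda>k. 0)"
      by (auto simp: fun_eq_iff power_0_left)
    then have "besselI n 0 = (\<Sum>k::nat. 0)" unfolding besselI_def by (rule arg_cong)
    then show ?thesis using False by simp
  qed
  then show ?thesis by (simp add: walk_def)
qed

text \<open>
  The first three derivatives of the symbol in \<open>t\<close> (every index from \<open>3\<close> on gives the third), and
  below those of \<open>(1 - cos t) symb r t\<close>. The estimates use the closed forms.
\<close>

definition symb_deriv :: "real \<Rightarrow> nat \<Rightarrow> real \<Rightarrow> real" where
  "symb_deriv r k t = (if k = 0 then 1 else if k = 1 then - r * sin t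
     else if k = 2 then - r * cos t + r\<^sup>2 * (sin t)\<^sup>2
     else r * sin t + 3 * r\<^sup>2 * sin t * cos t - r ^ 3 * sin t ^ 3) * symb r t"

lemma symb_deriv:
  assumes "k < 3" shows "(symb_deriv r k has_real_derivative symb_deriv r (Suc k) t) (at t)"
proof -
  have F: "(symb r has_real_derivative - r * sin t * symb r t) (at t)"
    using has_real_derivative_symb[OF DERIV_ident, of r t UNIV] by simp
  have P1: "((\<lambda>t. - r * sin t) has_real_derivative - r * cos t) (at t)"
    and P2: "((\<lambda>t. - r * cos t + r\<^sup>2 * (sin t)\<^sup>2) has_real_derivative r * sin t + 2 * r\<^sup>2 * sin t * cos t) (at t)"
    by (auto intro!: derivative_eq_intros)
  have 1: "- r * cos t * symb r t + (- r * sin t * symb r t) * (- r * sin t)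
      = (- r * cos t + r\<^sup>2 * (sin t)\<^sup>2) * symb r t" by algebra
  have 2: "(r * sin t + 2 * r\<^sup>2 * sin t * cos t) * symb r t + (- r * sin t * symb r t) * (- r * cos t + r\<^sup>2 * (sin t)\<^sup>2)
      = (r * sin t + 3 * r\<^sup>2 * sin t * cos t - r ^ 3 * sin t ^ 3) * symb r t" by algebra
  note F DERIV_mult[OF P1 F, unfolded 1] DERIV_mult[OF P2 F, unfolded 2]
  moreover have "k = 0 \<or> k = 1 \<or> k = 2" using assms by auto
  ultimately show ?thesis
    by (elim disjE; simp only: symb_deriv_def[abs_def]; simp)
qed

definition lap_deriv :: "real \<Rightarrow> nat \<Rightarrow> real \<Rightarrow> real" where
  "lap_deriv r k t = (if k = 0 then (1 - cos t) * symb_deriv r 0 t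
     else if k = 1 then sin t * symb_deriv r 0 t + (1 - cos t) * symb_deriv r 1 t
     else if k = 2 then cos t * symb_deriv r 0 t + 2 * sin t * symb_deriv r 1 t + (1 - cos t) * symb_deriv r 2 t
     else - sin t * symb_deriv r 0 t + 3 * cos t * symb_deriv r 1 t + 3 * sin t * symb_deriv r 2 t
       + (1 - cos t) * symb_deriv r 3 t)"

lemma lap_deriv:
  assumes "k < 3" shows "(lap_deriv r k has_real_derivative lap_deriv r (Suc k) t) (at t)"
proof -
  have "(symb_deriv r 0 has_real_derivative symb_deriv r (Suc 0) t) (at t)"
    "(symb_deriv r (Suc 0) has_real_derivative symb_deriv r 2 t) (at t)"
    "(symb_deriv r 2 has_real_derivative symb_deriv r 3 t) (at t)"
    using symb_deriv[of 0] symb_deriv[of 1] symb_deriv[of 2] by (simp_all add: numeral_eq_Suc)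
  note [derivative_intros] = this
  have "k = 0 \<or> k = 1 \<or> k = 2" using assms by auto
  then show ?thesis
    by (elim disjE; simp add: lap_deriv_def[abs_def])
       (auto intro!: derivative_eq_intros simp: algebra_simps)
qed

lemma one_minus_cos: "1 - cos t = 2 * (sin (t / 2))\<^sup>2" for t :: real
  using cos_double_sin[of "t / 2"] by simp

lemma one_minus_cos_le: "1 - cos t \<le> t\<^sup>2 / 2" for t :: real
proof -
  have "\<bar>sin (t / 2)\<bar>\<^sup>2 \<le> \<bar>t / 2\<bar>\<^sup>2" by (intro power_mono abs_sin_x_le_abs_x) simp
  then show ?thesis by (simp add: one_minus_cos power_divide)
qed

lemma sin_ge_chord:
  fixes x :: real
  assumes "0 \<le> x" "x \<le> pi / 2"
  shows "2 * x / pi \<le> sin x"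
proof -
  have "convex_on {0..pi} (\<lambda>x. - sin x)"
    by (rule f''_ge0_imp_convex[where f' = "\<lambda>x. - cos x" and f'' = sin])
       (auto intro!: derivative_eq_intros sin_ge_zero)
  from convex_onD[OF this, of "2 * x / pi" 0 "pi / 2"] assms show ?thesis
    by (simp add: field_simps)
qed

lemma one_minus_cos_ge:
  fixes t :: real
  assumes "\<bar>t\<bar> \<le> pi"
  shows "t\<^sup>2 / 8 \<le> 1 - cos t"
proof -
  have "\<bar>t\<bar> / 4 \<le> \<bar>t\<bar> / pi"
    using pi_less_4 by (intro divide_left_mono) auto
  also have "\<dots> \<le> sin (\<bar>t\<bar> / 2)" using sin_ge_chord[of "\<bar>t\<bar> / 2"] assms by simp
  finally have "(\<bar>t\<bar> / 4)\<^sup>2 \<le> (sin (\<bar>t\<bar> / 2))\<^sup>2" by (intro power_mono) auto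
  also have "(sin (\<bar>t\<bar> / 2))\<^sup>2 = (sin (t / 2))\<^sup>2" by (cases "t \<ge> 0") auto
  finally show ?thesis by (simp add: one_minus_cos power_divide)
qed

text \<open>
  On \<open>[-\<pi>, \<pi>]\<close> the symbol is at most \<open>exp (- r t\<^sup>2 / 8)\<close>. A fourth power of \<open>1 + r t\<^sup>2\<close> suffices
  to absorb every polynomial factor below and still leave an integrable Cauchy density.
\<close>

lemma symb_decay:
  assumes "0 \<le> r" "\<bar>t\<bar> \<le> pi"
  shows "(1 + r * t\<^sup>2) ^ 4 * symb r t \<le> 32 ^ 4"
proof -
  let ?y = "r * t\<^sup>2"
  \<comment> \<open>The fourth root of the exponential is bounded below by its tangent.\<close>
  have "(1 + ?y) / 32 \<le> exp (?y / 32)"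
    using exp_ge_add_one_self[of "?y / 32"] by (simp add: field_simps)
  then have "((1 + ?y) / 32) ^ 4 \<le> exp (?y / 32) ^ 4" using assms by (intro power_mono) auto
  also have "\<dots> = exp (?y / 8)" by (simp flip: exp_of_nat_mult)
  finally have 1: "(1 + ?y) ^ 4 \<le> 32 ^ 4 * exp (?y / 8)" by (simp add: power_divide)
  have "r * (t\<^sup>2 / 8) \<le> r * (1 - cos t)" using assms by (intro mult_left_mono one_minus_cos_ge)
  then have 2: "symb r t \<le> exp (- (?y / 8))" by (simp add: symb_def)
  have "(1 + ?y) ^ 4 * symb r t \<le> (32 ^ 4 * exp (?y / 8)) * exp (- (?y / 8))"
    using 1 2 assms by (intro mult_mono) (auto simp: symb_def)
  also have "\<dots> = 32 ^ 4" by (simp flip: exp_add)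
  finally show ?thesis .
qed

lemma power_succ_4: "x * x ^ 3 = x ^ 4" for x :: real
  by (simp add: eval_nat_numeral)

lemma power_symb_le:
  assumes "0 \<le> r" "\<bar>t\<bar> \<le> pi" "k \<le> 6"
  shows "(sqrt r * \<bar>t\<bar>) ^ k * symb r t \<le> 32 ^ 4 / (1 + r * t\<^sup>2)"
proof -
  define x where "x = sqrt r * \<bar>t\<bar>"
  have x: "0 \<le> x" "x\<^sup>2 = r * t\<^sup>2" using assms by (auto simp: x_def power_mult_distrib)
  have "x ^ k \<le> (1 + x\<^sup>2) ^ 3"
  proof (cases "x \<le> 1")
    case True
    then have "x ^ k \<le> 1" using x by (intro power_le_one)
    also have "1 \<le> (1 + x\<^sup>2) ^ 3" by (intro one_le_power) auto
    finally show ?thesis .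
  next
    case False
    then have "x ^ k \<le> x ^ 6" using assms by (intro power_increasing) auto
    also have "\<dots> = (x\<^sup>2) ^ 3" by simp
    also have "\<dots> \<le> (1 + x\<^sup>2) ^ 3" by (intro power_mono) auto
    finally show ?thesis .
  qed
  then have "x ^ k * symb r t \<le> (1 + x\<^sup>2) ^ 3 * symb r t"
    using symb_pos[of r t] by (intro mult_right_mono) auto
  also have "\<dots> \<le> 32 ^ 4 / (1 + x\<^sup>2)"
  proof -
    have "0 < 1 + x\<^sup>2" by (simp add: add_pos_nonneg)
    moreover have "(1 + x\<^sup>2) ^ 3 * symb r t * (1 + x\<^sup>2) = (1 + r * t\<^sup>2) ^ 4 * symb r t"
      unfolding x(2) power_succ_4[symmetric] by (simp only: mult_ac)
    ultimately show ?thesis using symb_decay[OF assms(1,2)] by (simp only: pos_le_divide_eq)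
  qed
  finally show ?thesis by (simp add: x_def x(2)[unfolded x_def])
qed

text \<open>
  The factor \<open>\<surd>r\<close> makes the integral bounded uniformly in \<open>r\<close>. It is the source of the decay
  \<open>r\<^sup>-\<^sup>1\<^sup>/\<^sup>2\<close> of the walk at its centre.
\<close>

lemma integral_cauchy_density_le:
  assumes "0 < r"
  shows "integral {-pi..pi} (\<lambda>t. sqrt r / (1 + r * t\<^sup>2)) \<le> pi"
proof -
  have "((\<lambda>t. arctan (sqrt r * t)) has_real_derivative sqrt r / (1 + r * t\<^sup>2)) (at t within {-pi..pi})" for t
    using assms by (auto intro!: derivative_eq_intros simp: power_mult_distrib divide_inverse)
  then have "((\<lambda>t. sqrt r / (1 + r * t\<^sup>2)) has_integral (arctan (sqrt r * pi) - arctan (sqrt r * (- pi)))) {-pi..pi}"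
    by (intro fundamental_theorem_of_calculus) (simp_all add: has_real_derivative_iff_has_vector_derivative)
  then show ?thesis using arctan_ubound[of "sqrt r * pi"] arctan_lbound[of "sqrt r * (- pi)"]
    by (simp add: integral_unique)
qed

section \<open>Pointwise bounds for the lattice heat kernel\<close>

text \<open>A bound for a Fourier coefficient from a bound for the integral that represents it.\<close>

lemma abs_le_integral_symbol:
  assumes eq: "complex_of_real x = z / of_real b" "0 < b"
    and z: "a * norm z \<le> I" and I: "I \<le> b * M" and a: "0 \<le> a"
  shows "a * \<bar>x\<bar> \<le> M"
proof -
  have "\<bar>x\<bar> = norm z / b" using arg_cong[OF eq(1), of norm] \<open>0 < b\<close> by (simp add: norm_divide)
  then have "a * \<bar>x\<bar> = a * norm z / b" by simp
  also have "\<dots> \<le> M" using z I \<open>0 < b\<close> by (simp add: divide_le_eq mult.commute)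
  finally show ?thesis .
qed

lemma norm_integral_symbol_le:
  assumes "continuous_on UNIV F" "continuous_on {-pi..pi} g" "\<And>t. \<bar>t\<bar> \<le> pi \<Longrightarrow> \<bar>F t\<bar> \<le> g t"
  shows "norm (integral {-pi..pi} (\<lambda>t. of_real (F t) * cis (of_int n * t))) \<le> integral {-pi..pi} g"
  using assms
  by (intro integral_norm_bound_integral integrable_continuous_real continuous_intros)
     (auto simp: norm_mult abs_le_iff intro: continuous_on_subset)

lemma continuous_on_cauchy_density:
  "0 < r \<Longrightarrow> continuous_on S (\<lambda>t::real. sqrt r / (1 + r * t\<^sup>2))"
  by (intro continuous_intros ballI) (metis add_pos_nonneg less_numeral_extra(1,3) mult_nonneg_nonneg order_less_imp_le zero_le_power2)

lemma walk_as_integral':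
  "complex_of_real (walk n r) = integral {-pi..pi} (\<lambda>t. of_real (symb r t) * cis (of_int n * t)) / of_real (2 * pi)"
  by (simp add: walk_as_integral)

lemma abs_sin_cos_bounds: "\<bar>sin t\<bar> \<le> 1" "\<bar>cos t\<bar> \<le> 1" "\<bar>sin t\<bar> \<le> \<bar>t\<bar>" for t :: real
  using abs_sin_x_le_abs_x by auto

lemma abs_symb_deriv_le:
  assumes "0 \<le> r"
  shows "\<bar>symb_deriv r 1 t\<bar> \<le> r * \<bar>t\<bar> * symb r t"
    and "\<bar>symb_deriv r 2 t\<bar> \<le> (r + r\<^sup>2 * t\<^sup>2) * symb r t"
    and "\<bar>symb_deriv r 3 t\<bar> \<le> (r * \<bar>sin t\<bar> + 3 * (r\<^sup>2 * \<bar>t\<bar>) + r ^ 3 * \<bar>t\<bar> ^ 3) * symb r t"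
proof -
  note b = abs_sin_cos_bounds[of t]
  have "\<bar>- r * sin t\<bar> \<le> r * \<bar>t\<bar>" using assms b by (simp add: abs_mult mult_left_mono)
  then show "\<bar>symb_deriv r 1 t\<bar> \<le> r * \<bar>t\<bar> * symb r t"
    using symb_pos[of r t] by (simp add: symb_deriv_def abs_mult mult_right_mono)
  have s2: "(sin t)\<^sup>2 \<le> t\<^sup>2" using b(3) by (simp add: abs_le_square_iff)
  have "\<bar>- r * cos t + r\<^sup>2 * (sin t)\<^sup>2\<bar> \<le> \<bar>- r * cos t\<bar> + \<bar>r\<^sup>2 * (sin t)\<^sup>2\<bar>" by (rule abs_triangle_ineq)
  also have "\<dots> \<le> r * 1 + r\<^sup>2 * t\<^sup>2"
    using assms b s2 by (intro add_mono) (auto simp: abs_mult intro!: mult_left_mono mult_left_le)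
  finally show "\<bar>symb_deriv r 2 t\<bar> \<le> (r + r\<^sup>2 * t\<^sup>2) * symb r t"
    using symb_pos[of r t] by (simp add: symb_deriv_def abs_mult mult_right_mono)
  have "\<bar>r * sin t + 3 * r\<^sup>2 * sin t * cos t - r ^ 3 * sin t ^ 3\<bar>
      \<le> \<bar>r * sin t\<bar> + \<bar>3 * r\<^sup>2 * (sin t * cos t)\<bar> + \<bar>r ^ 3 * sin t ^ 3\<bar>"
    by (simp add: mult.assoc)
  also have "\<dots> \<le> r * \<bar>sin t\<bar> + 3 * (r\<^sup>2 * \<bar>t\<bar>) + r ^ 3 * \<bar>t\<bar> ^ 3"
  proof (intro add_mono)
    have "\<bar>sin t * cos t\<bar> \<le> \<bar>t\<bar> * 1" unfolding abs_mult by (intro mult_mono b) auto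
    then show "\<bar>3 * r\<^sup>2 * (sin t * cos t)\<bar> \<le> 3 * (r\<^sup>2 * \<bar>t\<bar>)"
      by (simp add: abs_mult[of "3 * r\<^sup>2"] mult_left_mono)
    have "\<bar>sin t\<bar> ^ 3 \<le> \<bar>t\<bar> ^ 3" by (intro power_mono b) auto
    then show "\<bar>r ^ 3 * sin t ^ 3\<bar> \<le> r ^ 3 * \<bar>t\<bar> ^ 3"
      using assms by (simp add: abs_mult power_abs mult_left_mono)
  qed (use assms in \<open>simp add: abs_mult\<close>)
  finally show "\<bar>symb_deriv r 3 t\<bar> \<le> (r * \<bar>sin t\<bar> + 3 * (r\<^sup>2 * \<bar>t\<bar>) + r ^ 3 * \<bar>t\<bar> ^ 3) * symb r t"
    using symb_pos[of r t] by (simp add: symb_deriv_def abs_mult mult_right_mono)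
qed

lemma power_symb_le_density:
  assumes "0 < r" "\<bar>t\<bar> \<le> pi"
  shows "sqrt r * symb r t \<le> 32 ^ 4 * (sqrt r / (1 + r * t\<^sup>2))"
    and "r * \<bar>t\<bar> * symb r t \<le> 32 ^ 4 * (sqrt r / (1 + r * t\<^sup>2))"
    and "sqrt r * (r * t\<^sup>2) * symb r t \<le> 32 ^ 4 * (sqrt r / (1 + r * t\<^sup>2))"
    and "r\<^sup>2 * \<bar>t\<bar> ^ 3 * symb r t \<le> 32 ^ 4 * (sqrt r / (1 + r * t\<^sup>2))"
    and "r ^ 3 * \<bar>t\<bar> ^ 5 * symb r t \<le> 32 ^ 4 * (sqrt r / (1 + r * t\<^sup>2))"
proof -
  have s: "sqrt r * ((sqrt r * \<bar>t\<bar>) ^ k * symb r t) \<le> 32 ^ 4 * (sqrt r / (1 + r * t\<^sup>2))" if "k \<le> 6" for k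
    using mult_left_mono[OF power_symb_le[of r t k], of "sqrt r"] assms that by (simp add: mult.commute)
  have q: "sqrt r ^ 2 = r" "sqrt r ^ 4 = r\<^sup>2" "sqrt r ^ 6 = r ^ 3"
    using assms power_mult[of "sqrt r" 2 2] power_mult[of "sqrt r" 2 3] by simp_all
  show "sqrt r * symb r t \<le> 32 ^ 4 * (sqrt r / (1 + r * t\<^sup>2))" using s[of 0] by simp
  have "sqrt r * (sqrt r * \<bar>t\<bar>) ^ 1 = sqrt r ^ 2 * \<bar>t\<bar>" by (simp add: power2_eq_square mult_ac)
  then show "r * \<bar>t\<bar> * symb r t \<le> 32 ^ 4 * (sqrt r / (1 + r * t\<^sup>2))" using s[of 1] q by (simp add: mult.assoc[symmetric])
  have "sqrt r * (r * t\<^sup>2) * symb r t = sqrt r * ((sqrt r * \<bar>t\<bar>) ^ 2 * symb r t)"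
    using assms by (simp add: power_mult_distrib)
  then show "sqrt r * (r * t\<^sup>2) * symb r t \<le> 32 ^ 4 * (sqrt r / (1 + r * t\<^sup>2))"
    using s[of 2] by (simp only:)
  have "sqrt r * (sqrt r * \<bar>t\<bar>) ^ 3 = sqrt r ^ 4 * \<bar>t\<bar> ^ 3" by (simp only: power_mult_distrib) (simp add: numeral_eq_Suc)
  then show "r\<^sup>2 * \<bar>t\<bar> ^ 3 * symb r t \<le> 32 ^ 4 * (sqrt r / (1 + r * t\<^sup>2))" using s[of 3] q by (simp add: mult.assoc[symmetric])
  have "sqrt r * (sqrt r * \<bar>t\<bar>) ^ 5 = sqrt r ^ 6 * \<bar>t\<bar> ^ 5" by (simp only: power_mult_distrib) (simp add: numeral_eq_Suc)
  then show "r ^ 3 * \<bar>t\<bar> ^ 5 * symb r t \<le> 32 ^ 4 * (sqrt r / (1 + r * t\<^sup>2))" using s[of 5] q by (simp add: mult.assoc[symmetric])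
qed

lemma symb_le_1: "0 \<le> r \<Longrightarrow> symb r t \<le> 1"
  by (simp add: symb_def mult_nonneg_nonneg)

text \<open>
  For the bounds without the factor \<open>n\<^sup>3\<close>, the modulus of the symbol is at most a Cauchy density.
  The others come from three integrations by parts: every term of the third derivative of \<open>symb r\<close>
  contains the factor \<open>r\<close>, and what remains is at most a constant plus a multiple of the Cauchy
  density. For the second difference the factor \<open>1 - cos t \<le> t\<^sup>2 / 2\<close> is worth \<open>1 / r\<close>. The first
  bound prevents the constants from degenerating for small \<open>r\<close>.
\<close>

lemma walk_bounds:
  assumes r: "0 < r"
  shows "\<bar>walk n r\<bar> \<le> 1"
    and "sqrt r * \<bar>walk n r\<bar> \<le> 32 ^ 4"
    and "\<bar>of_int n\<bar> ^ 3 * \<bar>walk n r\<bar> \<le> r * (1 + 2 * 32 ^ 4)"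
    and "sqrt r * r * \<bar>walk_lap n r\<bar> \<le> 32 ^ 4"
    and "\<bar>of_int n\<bar> ^ 3 * \<bar>walk_lap n r\<bar> \<le> 2 + 13 * 32 ^ 4"
proof -
  define g where "g t = sqrt r / (1 + r * t\<^sup>2)" for t
  have gc: "continuous_on S g" for S unfolding g_def by (rule continuous_on_cauchy_density[OF r])
  have gi: "g integrable_on {-pi..pi}" by (intro integrable_continuous_real gc)
  have gle: "integral {-pi..pi} g \<le> pi"
    using integral_cauchy_density_le[OF r] by (simp add: g_def[abs_def])
  then have gle2: "integral {-pi..pi} g \<le> 2 * pi" using pi_gt_zero by linarith
  have gint: "integral {-pi..pi} (\<lambda>t. a + b * g t) = a * (2 * pi) + b * integral {-pi..pi} g" for a b
  proof -
    have "((\<lambda>t. a + b * g t) has_integral (2 * pi) * a + b * integral {-pi..pi} g) {-pi..pi}"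
      using has_integral_const_real[of a "-pi" pi]
      by (intro has_integral_add has_integral_mult_right integrable_integral gi) simp_all
    then show ?thesis by (simp add: integral_unique mult_ac)
  qed
  note p = power_symb_le_density[OF r, folded g_def]
  note W = walk_as_integral'[of n r]
  note L = walk_lap_as_integral[of n r]
  have sc: "continuous_on S (symb r)" for S
    using continuous_on_symb[of S "\<lambda>_. r" "\<lambda>t. t"] by (simp add: continuous_on_const continuous_on_id)
  have "norm (integral {-pi..pi} (\<lambda>t. of_real (symb r t) * cis (of_int n * t))) \<le> integral {-pi..pi} (\<lambda>t. 1)"
    using r symb_pos[of r] symb_le_1[of r]
    by (intro norm_integral_symbol_le sc) (auto simp: abs_of_pos)
  with abs_le_integral_symbol[OF W, of 1 "integral {-pi..pi} (\<lambda>t. 1)" 1] show "\<bar>walk n r\<bar> \<le> 1" by simp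
  \<comment> \<open>Decay at the centre, from the modulus of the symbol.\<close>
  have "norm (integral {-pi..pi} (\<lambda>t. of_real (sqrt r * symb r t) * cis (of_int n * t)))
      \<le> integral {-pi..pi} (\<lambda>t. 0 + 32 ^ 4 * g t)"
    using r symb_pos[of r] p(1)
    by (intro norm_integral_symbol_le continuous_intros sc gc) (auto simp: abs_mult abs_of_pos)
  also have "(\<lambda>t. of_real (sqrt r * symb r t) * cis (of_int n * t)) = (\<lambda>t. of_real (sqrt r) * (of_real (symb r t) * cis (of_int n * t)))"
    by (simp add: mult.assoc)
  finally have "sqrt r * norm (integral {-pi..pi} (\<lambda>t. of_real (symb r t) * cis (of_int n * t))) \<le> 32 ^ 4 * integral {-pi..pi} g"
    unfolding gint integral_mult_right using r by (simp add: norm_mult)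
  from abs_le_integral_symbol[OF W _ this, of "32 ^ 4"] gle2 r show "sqrt r * \<bar>walk n r\<bar> \<le> 32 ^ 4"
    by (auto simp: mult_ac intro: order_trans)
  \<comment> \<open>Decay in \<open>n\<close>. The terms of the third derivative are regrouped so that each has a factor \<open>r\<close> in front
    of a quantity bounded by one or by the Cauchy density.\<close>
  have "\<bar>of_int n\<bar> ^ 3 * norm (integral {-pi..pi} (\<lambda>t. of_real (symb_deriv r 0 t) * cis (of_int n * t)))
      \<le> integral {-pi..pi} (\<lambda>t. r + (r * (4 * 32 ^ 4)) * g t)"
  proof (rule fourier_cubic_decay)
    fix t assume "t \<in> {-pi..pi}"
    then have t: "\<bar>t\<bar> \<le> pi" by auto
    have "r * \<bar>sin t\<bar> * symb r t \<le> r * 1 * 1"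
      using r symb_le_1[of r t] symb_pos[of r t] by (intro mult_mono) auto
    moreover have "3 * (r * (r * \<bar>t\<bar> * symb r t)) \<le> 3 * (r * (32 ^ 4 * g t))"
      "r * (r\<^sup>2 * \<bar>t\<bar> ^ 3 * symb r t) \<le> r * (32 ^ 4 * g t)"
      using p(2,4)[OF t] r by (auto intro!: mult_left_mono)
    moreover have "(r * \<bar>sin t\<bar> + 3 * (r\<^sup>2 * \<bar>t\<bar>) + r ^ 3 * \<bar>t\<bar> ^ 3) * symb r t =
       r * \<bar>sin t\<bar> * symb r t + 3 * (r * (r * \<bar>t\<bar> * symb r t)) + r * (r\<^sup>2 * \<bar>t\<bar> ^ 3 * symb r t)"
      by (simp add: algebra_simps power2_eq_square power3_eq_cube)
    moreover have "\<bar>symb_deriv r 3 t\<bar> \<le> (r * \<bar>sin t\<bar> + 3 * (r\<^sup>2 * \<bar>t\<bar>) + r ^ 3 * \<bar>t\<bar> ^ 3) * symb r t"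
      using abs_symb_deriv_le(3)[of r t] r by simp
    ultimately have "\<bar>symb_deriv r 3 t\<bar> \<le> r * 1 * 1 + 3 * (r * (32 ^ 4 * g t)) + r * (32 ^ 4 * g t)"
      by linarith
    then show "\<bar>symb_deriv r 3 t\<bar> \<le> r + (r * (4 * 32 ^ 4)) * g t" by (simp add: algebra_simps)
  next
    show "continuous_on UNIV (symb_deriv r 3)"
      unfolding symb_deriv_def[abs_def] by simp (intro continuous_intros sc)
  qed (auto simp: symb_deriv intro!: continuous_intros gc, auto simp: symb_deriv_def less_Suc_eq numeral_eq_Suc)
  then have "\<bar>of_int n\<bar> ^ 3 * norm (integral {-pi..pi} (\<lambda>t. of_real (symb r t) * cis (of_int n * t)))
     \<le> r * (2 * pi) + (r * (4 * 32 ^ 4)) * integral {-pi..pi} g"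
    unfolding gint by (simp add: symb_deriv_def)
  also have "\<dots> \<le> r * (2 * pi) + (r * (4 * 32 ^ 4)) * pi"
    using r gle by (intro add_left_mono mult_left_mono) auto
  finally show "\<bar>of_int n\<bar> ^ 3 * \<bar>walk n r\<bar> \<le> r * (1 + 2 * 32 ^ 4)"
    by (rule abs_le_integral_symbol[OF W, rotated]) (auto simp: algebra_simps)
  \<comment> \<open>The factor \<open>1 - cos t\<close> compensates one more power of \<open>r\<close>.\<close>
  have "norm (integral {-pi..pi} (\<lambda>t. of_real (sqrt r * r * ((1 - cos t) * symb r t)) * cis (of_int n * t)))
      \<le> integral {-pi..pi} (\<lambda>t. 0 + 32 ^ 4 * g t)"
  proof (intro norm_integral_symbol_le continuous_intros sc gc)
    fix t assume t: "\<bar>t\<bar> \<le> pi"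
    have "sqrt r * r * ((1 - cos t) * symb r t) \<le> sqrt r * r * (t\<^sup>2 * symb r t)"
      using r order_trans[OF one_minus_cos_le[of t], of "t\<^sup>2"] symb_pos[of r t]
      by (intro mult_left_mono mult_right_mono) auto
    also have "\<dots> \<le> 32 ^ 4 * g t" using p(3)[OF t] by (simp add: mult_ac)
    finally show "\<bar>sqrt r * r * ((1 - cos t) * symb r t)\<bar> \<le> 0 + 32 ^ 4 * g t"
      using r symb_pos[of r t] by (simp add: abs_mult)
  qed
  also have "(\<lambda>t. of_real (sqrt r * r * ((1 - cos t) * symb r t)) * cis (of_int n * t)) =
      (\<lambda>t. of_real (sqrt r * r) * (of_real ((1 - cos t) * symb r t) * cis (of_int n * t)))"
    by (simp add: mult.assoc)
  finally have "(sqrt r * r) * norm (- integral {-pi..pi} (\<lambda>t. of_real ((1 - cos t) * symb r t) * cis (of_int n * t))) \<le> 32 ^ 4 * integral {-pi..pi} g"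
    unfolding gint integral_mult_right using r by (simp add: norm_mult)
  from abs_le_integral_symbol[OF L _ this, of "32 ^ 4"] gle r
  show "sqrt r * r * \<bar>walk_lap n r\<bar> \<le> 32 ^ 4"
    by (auto simp: mult_ac intro: order_trans)
  \<comment> \<open>In the four terms of Leibniz' rule for \<open>(1 - cos t) symb r t\<close>, one factor \<open>t\<close> (from \<open>sin t\<close>) or two (from \<open>1 - cos t\<close>)
    match the powers of \<open>r\<close>. The numbers \<open>3\<close>, \<open>6\<close> and \<open>4\<close> add up to \<open>13\<close>.\<close>
  have "\<bar>of_int n\<bar> ^ 3 * norm (integral {-pi..pi} (\<lambda>t. of_real (lap_deriv r 0 t) * cis (of_int n * t)))
      \<le> integral {-pi..pi} (\<lambda>t. 1 + (13 * 32 ^ 4) * g t)"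
  proof (rule fourier_cubic_decay)
    fix t assume "t \<in> {-pi..pi}"
    then have t: "\<bar>t\<bar> \<le> pi" by auto
    note b = abs_sin_cos_bounds[of t] and d = abs_symb_deriv_le[OF order_less_imp_le[OF r], of t]
    define q where "q = 32 ^ 4 * g t"
    have s0: "symb_deriv r 0 t = symb r t" by (simp add: symb_deriv_def)
    have "\<bar>- sin t * symb_deriv r 0 t\<bar> \<le> 1 * 1"
      unfolding s0 abs_mult using b symb_pos[of r t] symb_le_1[of r t] r by (intro mult_mono) auto
    moreover have "\<bar>3 * cos t * symb_deriv r 1 t\<bar> \<le> 3 * 1 * q"
      unfolding abs_mult q_def using b order_trans[OF d(1) p(2)[OF t]] by (intro mult_mono) auto
    moreover have "\<bar>3 * sin t * symb_deriv r 2 t\<bar> \<le> 6 * q"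
    proof -
      have "\<bar>3 * sin t * symb_deriv r 2 t\<bar> \<le> 3 * \<bar>t\<bar> * ((r + r\<^sup>2 * t\<^sup>2) * symb r t)"
        unfolding abs_mult using b d(2) by (intro mult_mono) auto
      also have "\<dots> = 3 * (r * \<bar>t\<bar> * symb r t) + 3 * (r\<^sup>2 * \<bar>t\<bar> ^ 3 * symb r t)"
        by (simp add: algebra_simps power2_eq_square power3_eq_cube)
      finally show ?thesis using p(2,4)[OF t] by (simp add: q_def)
    qed
    moreover have "\<bar>(1 - cos t) * symb_deriv r 3 t\<bar> \<le> 4 * q"
    proof -
      let ?F = "symb r t"
      have F: "0 \<le> ?F" using symb_pos[of r t] by simp
      have c: "0 \<le> 1 - cos t" "1 - cos t \<le> 2" using b(2) by (auto simp: abs_le_iff)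
      have regroup: "2 * (r * u * ?F) + (u\<^sup>2 / 2) * (3 * (r\<^sup>2 * u) * ?F) + (u\<^sup>2 / 2) * (r ^ 3 * u ^ 3 * ?F)
          = 2 * (r * u * ?F) + 3/2 * (r\<^sup>2 * u ^ 3 * ?F) + 1/2 * (r ^ 3 * u ^ 5 * ?F)" for u :: real
        by (simp add: numeral_eq_Suc algebra_simps)
      have "\<bar>(1 - cos t) * symb_deriv r 3 t\<bar> \<le> (1 - cos t) * ((r * \<bar>sin t\<bar> + 3 * (r\<^sup>2 * \<bar>t\<bar>) + r ^ 3 * \<bar>t\<bar> ^ 3) * ?F)"
        unfolding abs_mult using c d(3) by (intro mult_mono) auto
      also have "\<dots> = (1 - cos t) * (r * \<bar>sin t\<bar> * ?F) + (1 - cos t) * (3 * (r\<^sup>2 * \<bar>t\<bar>) * ?F) + (1 - cos t) * (r ^ 3 * \<bar>t\<bar> ^ 3 * ?F)"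
        by (simp add: algebra_simps)
      also have "\<dots> \<le> 2 * (r * \<bar>t\<bar> * ?F) + (t\<^sup>2 / 2) * (3 * (r\<^sup>2 * \<bar>t\<bar>) * ?F) + (t\<^sup>2 / 2) * (r ^ 3 * \<bar>t\<bar> ^ 3 * ?F)"
        using c r F b one_minus_cos_le[of t] by (intro add_mono mult_mono) auto
      also have "\<dots> = 2 * (r * \<bar>t\<bar> * ?F) + 3/2 * (r\<^sup>2 * \<bar>t\<bar> ^ 3 * ?F) + 1/2 * (r ^ 3 * \<bar>t\<bar> ^ 5 * ?F)"
        by (simp only: regroup[of "\<bar>t\<bar>", unfolded power2_abs])
      also have "\<dots> \<le> 2 * q + 3/2 * q + 1/2 * q"
        unfolding q_def using p(2,4,5)[OF t] by (intro add_mono mult_left_mono) auto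
      finally show ?thesis by simp
    qed
    moreover have "\<bar>lap_deriv r 3 t\<bar> \<le> \<bar>- sin t * symb_deriv r 0 t\<bar> + \<bar>3 * cos t * symb_deriv r 1 t\<bar>
        + \<bar>3 * sin t * symb_deriv r 2 t\<bar> + \<bar>(1 - cos t) * symb_deriv r 3 t\<bar>"
      by (simp add: lap_deriv_def)
    ultimately have "\<bar>lap_deriv r 3 t\<bar> \<le> 1 + 13 * q" by linarith
    then show "\<bar>lap_deriv r 3 t\<bar> \<le> 1 + (13 * 32 ^ 4) * g t" by (simp add: q_def)
  next
    show "continuous_on UNIV (lap_deriv r 3)"
      unfolding lap_deriv_def[abs_def] symb_deriv_def by simp (intro continuous_intros sc)
  qed (auto simp: lap_deriv intro!: continuous_intros gc, auto simp: lap_deriv_def symb_deriv_def less_Suc_eq numeral_eq_Suc)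
  then have "\<bar>of_int n\<bar> ^ 3 * norm (- integral {-pi..pi} (\<lambda>t. of_real ((1 - cos t) * symb r t) * cis (of_int n * t)))
     \<le> 1 * (2 * pi) + (13 * 32 ^ 4) * integral {-pi..pi} g"
    unfolding gint by (simp add: symb_deriv_def lap_deriv_def)
  also have "\<dots> \<le> 1 * (2 * pi) + (13 * 32 ^ 4) * pi"
    using r gle by (intro add_left_mono mult_left_mono) auto
  finally show "\<bar>of_int n\<bar> ^ 3 * \<bar>walk_lap n r\<bar> \<le> 2 + 13 * 32 ^ 4"
    by (rule abs_le_integral_symbol[OF L, rotated]) (auto simp: algebra_simps)
qed

text \<open>
  For times in a compact interval, negative ones included, all factors of the third derivative are
  bounded. Negative times occur because a time convolution \<open>\<integral>\<^sub>0\<^sup>t F(t - s) H(s) ds\<close> will be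
  differentiated in the two occurrences of \<open>t\<close> separately.
\<close>

lemma walk_locally_bounded:
  obtains B where "1 \<le> B" "\<And>r n. \<bar>r\<bar> \<le> R \<Longrightarrow> (1 + \<bar>of_int n\<bar>) ^ 3 * \<bar>walk n r\<bar> \<le> B"
proof -
  define R' where "R' = max R 1"
  define E where "E = (R' + 3 * R'\<^sup>2 + R' ^ 3) * exp (2 * R')"
  have R': "1 \<le> R'" by (simp add: R'_def)
  show ?thesis
  proof (rule that)
    have "1 \<le> (1 + 0 + 0) * (1 :: real)" by simp
    also have "\<dots> \<le> E" unfolding E_def using R' by (intro mult_mono add_mono) auto
    finally have E1: "1 \<le> E" .
    then show "1 \<le> 8 * E" by simp
    fix r :: real and n :: int assume "\<bar>r\<bar> \<le> R"
    then have r: "\<bar>r\<bar> \<le> R'" by (simp add: R'_def)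
    have F: "symb r t \<le> exp (2 * R')" for t
    proof -
      have "\<bar>r * (1 - cos t)\<bar> \<le> R' * 2"
        unfolding abs_mult using r cos_le_one[of t] cos_ge_minus_one[of t] by (intro mult_mono) auto
      then show ?thesis by (auto simp: symb_def abs_le_iff)
    qed
    note W = walk_as_integral'[of n r]
    have sc: "continuous_on S (symb r)" for S
      using continuous_on_symb[of S "\<lambda>_. r" "\<lambda>t. t"] by (simp add: continuous_on_const continuous_on_id)
    have eE: "exp (2 * R') \<le> E"
    proof -
      have "1 * exp (2 * R') \<le> E" unfolding E_def using R' by (intro mult_right_mono) (auto intro!: add_increasing2)
      then show ?thesis by simp
    qed
    have "norm (integral {-pi..pi} (\<lambda>t. of_real (symb r t) * cis (of_int n * t))) \<le> integral {-pi..pi} (\<lambda>t. E)"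
      using symb_pos[of r] F eE
      by (intro norm_integral_symbol_le sc) (auto simp: abs_of_pos intro: order_trans)
    with abs_le_integral_symbol[OF W, of 1 "integral {-pi..pi} (\<lambda>t. E)" E] have 1: "\<bar>walk n r\<bar> \<le> E" by simp
    have "\<bar>of_int n\<bar> ^ 3 * norm (integral {-pi..pi} (\<lambda>t. of_real (symb_deriv r 0 t) * cis (of_int n * t)))
        \<le> integral {-pi..pi} (\<lambda>t. E)"
    proof (rule fourier_cubic_decay)
      fix t
      have "\<bar>r * sin t + 3 * r\<^sup>2 * (sin t * cos t) - r ^ 3 * sin t ^ 3\<bar>
        \<le> \<bar>r * sin t\<bar> + \<bar>3 * r\<^sup>2 * (sin t * cos t)\<bar> + \<bar>r ^ 3 * sin t ^ 3\<bar>" by simp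
      also have "\<dots> \<le> R' * 1 + 3 * R'\<^sup>2 * (1 * 1) + R' ^ 3 * 1 ^ 3"
        unfolding abs_mult power_abs using r R' by (intro add_mono mult_mono power_mono) (auto simp: abs_le_square_iff)
      finally have "\<bar>r * sin t + 3 * r\<^sup>2 * sin t * cos t - r ^ 3 * sin t ^ 3\<bar> \<le> R' + 3 * R'\<^sup>2 + R' ^ 3" by (simp add: mult.assoc)
      then show "\<bar>symb_deriv r 3 t\<bar> \<le> E"
        unfolding E_def using F[of t] symb_pos[of r t] R' by (auto simp: symb_deriv_def abs_mult intro!: mult_mono)
    next
      show "continuous_on UNIV (symb_deriv r 3)"
        unfolding symb_deriv_def[abs_def] by simp (intro continuous_intros sc)
    qed (auto simp: symb_deriv intro!: continuous_intros, auto simp: symb_deriv_def less_Suc_eq numeral_eq_Suc)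
    then have "\<bar>of_int n\<bar> ^ 3 * norm (integral {-pi..pi} (\<lambda>t. of_real (symb r t) * cis (of_int n * t)))
       \<le> (2 * pi) * E"
      by (simp add: symb_deriv_def)
    from abs_le_integral_symbol[OF W _ this, of E] have 3: "\<bar>of_int n\<bar> ^ 3 * \<bar>walk n r\<bar> \<le> E" by simp
    show "(1 + \<bar>of_int n\<bar>) ^ 3 * \<bar>walk n r\<bar> \<le> 8 * E"
    proof (cases "n = 0")
      case False
      then have "1 \<le> \<bar>real_of_int n\<bar>" by linarith
      then have "(1 + \<bar>real_of_int n\<bar>) ^ 3 \<le> (2 * \<bar>real_of_int n\<bar>) ^ 3" by (intro power_mono) auto
      then have "(1 + \<bar>real_of_int n\<bar>) ^ 3 * \<bar>walk n r\<bar> \<le> 8 * (\<bar>real_of_int n\<bar> ^ 3 * \<bar>walk n r\<bar>)"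
        by (simp add: power_mult_distrib mult_right_mono mult.assoc[symmetric])
      then show ?thesis using 3 by simp
    qed (use 1 E1 in simp)
  qed
qed

section \<open>A profile that is stable under convolution\<close>

text \<open>
  Up to constants, the one-dimensional factor of the bound (ii) at time \<open>t = \<tau> h\<^sup>2\<close>, multiplied by
  the mesh size \<open>h\<close>. For \<open>n \<noteq> 0\<close> it is \<open>\<pi>\<close> times the Poisson kernel of width \<open>\<surd>\<tau>\<close>. At \<open>n = 0\<close> that
  formula gives \<open>1 / \<surd>\<tau>\<close>, which for \<open>\<tau> < 1\<close> exceeds the total mass of the walk, and it is cut off
  at one.
\<close>

definition cell :: "real \<Rightarrow> int \<Rightarrow> real" where
  "cell \<tau> n = (if n = 0 then min 1 (1 / sqrt \<tau>) else sqrt \<tau> / (\<tau> + (of_int n)\<^sup>2))"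

lemma cell_pos: "0 < \<tau> \<Longrightarrow> 0 < cell \<tau> n"
  by (simp add: cell_def add_pos_nonneg)

lemma cell_le_1: "0 < \<tau> \<Longrightarrow> cell \<tau> n \<le> 1"
proof (cases "n = 0")
  case False
  assume \<tau>: "0 < \<tau>"
  have "1 \<le> \<bar>n\<bar>" using False by linarith
  then have n: "1 \<le> \<bar>real_of_int n\<bar>" by linarith
  have "2 * sqrt \<tau> * \<bar>of_int n\<bar> \<le> sqrt \<tau> ^ 2 + \<bar>of_int n\<bar>\<^sup>2" by (rule sum_squares_bound)
  then have "2 * (sqrt \<tau> * \<bar>of_int n\<bar>) \<le> \<tau> + (of_int n)\<^sup>2" using \<tau> by simp
  moreover have "sqrt \<tau> * 1 \<le> sqrt \<tau> * \<bar>of_int n\<bar>" using \<tau> n by (intro mult_left_mono) auto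
  ultimately have "sqrt \<tau> \<le> \<tau> + (of_int n)\<^sup>2"
    using real_sqrt_ge_zero[of \<tau>] \<tau> by linarith
  moreover have "0 < \<tau> + (of_int n)\<^sup>2" using \<tau> by (simp add: add_pos_nonneg)
  ultimately show ?thesis using False by (simp add: cell_def)
qed (simp add: cell_def)

lemma cell_le_inverse_sqrt: "0 < \<tau> \<Longrightarrow> cell \<tau> n \<le> 1 / sqrt \<tau>"
proof (cases "n = 0")
  case False
  assume \<tau>: "0 < \<tau>"
  have "sqrt \<tau> / (\<tau> + (of_int n)\<^sup>2) \<le> sqrt \<tau> / \<tau>"
    using \<tau> by (intro divide_left_mono) (auto intro!: mult_pos_pos add_pos_nonneg)
  also have "\<dots> = 1 / sqrt \<tau>" using \<tau> by (simp add: real_div_sqrt field_simps)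
  finally show ?thesis using False by (simp add: cell_def)
qed (simp add: cell_def)

lemma sum_cauchy_le_arctan:
  assumes "0 < \<tau>"
  shows "(\<Sum>k<N. sqrt \<tau> / (\<tau> + (real (Suc k))\<^sup>2)) \<le> arctan (real N / sqrt \<tau>)"
proof (induction N)
  case (Suc N)
  have lt: "real N / sqrt \<tau> < real (Suc N) / sqrt \<tau>" using assms by (simp add: divide_strict_right_mono)
  obtain z where z: "real N / sqrt \<tau> < z" "z < real (Suc N) / sqrt \<tau>"
    and eq: "arctan (real (Suc N) / sqrt \<tau>) - arctan (real N / sqrt \<tau>)
      = (real (Suc N) / sqrt \<tau> - real N / sqrt \<tau>) * inverse (1 + z\<^sup>2)"
    using MVT2[OF lt, of arctan "\<lambda>z. inverse (1 + z\<^sup>2)"] DERIV_arctan by blast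
  have "0 \<le> z" using z(1) assms by (meson divide_nonneg_nonneg less_imp_le of_nat_0_le_iff order_trans real_sqrt_ge_zero)
  then have "z\<^sup>2 \<le> (real (Suc N) / sqrt \<tau>)\<^sup>2" using z by (intro power_mono) auto
  then have "z\<^sup>2 \<le> (real (Suc N))\<^sup>2 / \<tau>" using assms by (simp add: power_divide)
  then have "(1 / sqrt \<tau>) * inverse (1 + (real (Suc N))\<^sup>2 / \<tau>) \<le> (1 / sqrt \<tau>) * inverse (1 + z\<^sup>2)"
    using assms by (intro mult_left_mono le_imp_inverse_le) (auto intro!: add_pos_nonneg)
  moreover have "(1 / sqrt \<tau>) * inverse (1 + (real (Suc N))\<^sup>2 / \<tau>) = sqrt \<tau> / (\<tau> + (real (Suc N))\<^sup>2)"
  proof -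
    have "1 + (real (Suc N))\<^sup>2 / \<tau> = (\<tau> + (real (Suc N))\<^sup>2) / \<tau>" using assms by (simp add: field_simps)
    moreover have "1 / sqrt \<tau> = sqrt \<tau> / \<tau>" using assms by (simp add: real_div_sqrt field_simps)
    ultimately show ?thesis using assms by simp
  qed
  moreover have "real (Suc N) / sqrt \<tau> - real N / sqrt \<tau> = 1 / sqrt \<tau>" by (simp add: add_divide_distrib)
  ultimately show ?case using Suc.IH eq by (simp del: of_nat_Suc)
qed simp

text \<open>
  Comparison of the sum over \<open>n \<noteq> 0\<close> with the integral of the Cauchy density on each half-line.
\<close>

lemma sum_cell_le:
  assumes "0 < \<tau>" "finite B"
  shows "(\<Sum>n\<in>B. cell \<tau> n) \<le> 1 + pi"
proof -
  define N where "N = nat (Max (insert 0 (abs ` B)))"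
  have "\<bar>n\<bar> \<le> int N" if "n \<in> B" for n
    using that assms by (auto simp: N_def intro!: Max_ge le_nat_iff[THEN iffD1])
  then have le: "\<bar>n\<bar> \<le> int N" if "n \<in> B" for n using that by blast
  have sub: "B \<subseteq> insert 0 ((\<lambda>k. int (Suc k)) ` {..<N} \<union> (\<lambda>k. - int (Suc k)) ` {..<N})"
  proof
    fix n assume "n \<in> B"
    from le[OF this] have n: "\<bar>n\<bar> \<le> int N" .
    consider "n = 0" | "0 < n" | "n < 0" by linarith
    then show "n \<in> insert 0 ((\<lambda>k. int (Suc k)) ` {..<N} \<union> (\<lambda>k. - int (Suc k)) ` {..<N})"
    proof cases
      case 2
      then have "n = int (Suc (nat (n - 1)))" "nat (n - 1) < N" using n by auto
      then show ?thesis by blast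
    next
      case 3
      then have "n = - int (Suc (nat (- n - 1)))" "nat (- n - 1) < N" using n by auto
      then show ?thesis by blast
    qed simp
  qed
  have "(\<Sum>n\<in>B. cell \<tau> n) \<le> (\<Sum>n\<in>insert 0 ((\<lambda>k. int (Suc k)) ` {..<N} \<union> (\<lambda>k. - int (Suc k)) ` {..<N}). cell \<tau> n)"
    by (intro sum_mono2 sub) (auto intro: less_imp_le[OF cell_pos[OF assms(1)]])
  also have "\<dots> = cell \<tau> 0 + ((\<Sum>n\<in>(\<lambda>k. int (Suc k)) ` {..<N}. cell \<tau> n) + (\<Sum>n\<in>(\<lambda>k. - int (Suc k)) ` {..<N}. cell \<tau> n))"
    by (subst sum.insert, simp, force, subst sum.union_disjoint) auto
  also have "(\<Sum>n\<in>(\<lambda>k. int (Suc k)) ` {..<N}. cell \<tau> n) = (\<Sum>k<N. sqrt \<tau> / (\<tau> + (real (Suc k))\<^sup>2))"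
    by (subst sum.reindex) (auto simp: inj_on_def cell_def)
  also have "(\<Sum>n\<in>(\<lambda>k. - int (Suc k)) ` {..<N}. cell \<tau> n) = (\<Sum>k<N. sqrt \<tau> / (\<tau> + (real (Suc k))\<^sup>2))"
  proof (subst sum.reindex)
    show "sum (cell \<tau> \<circ> (\<lambda>k. - int (Suc k))) {..<N} = (\<Sum>k<N. sqrt \<tau> / (\<tau> + (real (Suc k))\<^sup>2))"
    proof (rule sum.cong[OF refl])
      fix k
      have "(of_int (- int (Suc k)))\<^sup>2 = (real (Suc k))\<^sup>2"
        by (simp only: of_int_minus power2_minus of_int_of_nat_eq)
      moreover have "- int (Suc k) \<noteq> 0" by simp
      ultimately show "(cell \<tau> \<circ> (\<lambda>k. - int (Suc k))) k = sqrt \<tau> / (\<tau> + (real (Suc k))\<^sup>2)"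
        by (simp only: o_def cell_def if_False)
    qed
  qed (auto simp: inj_on_def)
  finally show ?thesis
    using sum_cauchy_le_arctan[OF assms(1), of N] arctan_ubound[of "real N / sqrt \<tau>"] cell_le_1[OF assms(1), of 0]
    by linarith
qed

text \<open>
  If \<open>n\<^sup>2 \<le> \<sigma> + \<tau>\<close>, the larger of the two times is at least half of the sum, and the cell at that
  time is bounded by its supremum, which is comparable to \<open>cell (\<sigma> + \<tau>) n\<close>. Otherwise one of \<open>n -
  k\<close> and \<open>k\<close> is at least \<open>n / 2\<close> in modulus, and that far from the origin a cell increases with
  time, up to a constant. In both cases one of the factors is at most \<open>8 cell (\<sigma> + \<tau>) n\<close>, and the
  other one is summable in \<open>k\<close>.
\<close>

lemma cell_mult_le:
  assumes "0 < \<sigma>" "0 < \<tau>"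
  shows "cell \<sigma> (n - k) * cell \<tau> k \<le> 8 * cell (\<sigma> + \<tau>) n * (cell \<sigma> (n - k) + cell \<tau> k)"
proof -
  define \<rho> where "\<rho> = \<sigma> + \<tau>"
  have \<rho>: "0 < \<rho>" "\<sigma> \<le> \<rho>" "\<tau> \<le> \<rho>" using assms by (auto simp: \<rho>_def)
  let ?c = "8 * cell \<rho> n"
  have c: "0 \<le> ?c" using cell_pos[OF \<rho>(1)] by (simp add: less_imp_le)
  have pos: "0 \<le> cell \<sigma> (n - k)" "0 \<le> cell \<tau> k" using cell_pos assms by (simp_all add: less_imp_le)
  have "cell \<sigma> (n - k) \<le> ?c \<or> cell \<tau> k \<le> ?c"
  proof (cases "(of_int n)\<^sup>2 \<le> \<rho>")
    case True
    have big: "cell s m \<le> ?c" if s: "\<rho> / 2 \<le> s" for s m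
    proof -
      have s0: "0 < s" using s \<rho> by linarith
      have "sqrt \<rho> / sqrt 2 \<le> sqrt s" using s by (simp flip: real_sqrt_divide)
      then have "1 / sqrt s \<le> 1 / (sqrt \<rho> / sqrt 2)" using \<rho> s0 by (intro divide_left_mono) auto
      then have 1: "cell s m \<le> sqrt 2 / sqrt \<rho>" using cell_le_inverse_sqrt[OF s0, of m] by simp
      have 2: "cell s m \<le> 1" by (rule cell_le_1[OF s0])
      have s2: "sqrt 2 \<le> (4 :: real)" by (rule real_le_lsqrt) auto
      have "sqrt 2 / sqrt \<rho> \<le> 4 / sqrt \<rho>" using \<rho> s2 by (intro divide_right_mono) auto
      with 1 have 1: "cell s m \<le> 4 / sqrt \<rho>" by linarith
      show ?thesis
      proof (cases "n = 0")
        case True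
        then show ?thesis using 1 2 \<rho>
          by (auto simp: cell_def min_def field_simps split: if_splits)
      next
        case False
        have "4 / sqrt \<rho> = 8 * (sqrt \<rho> / (\<rho> + \<rho>))" using \<rho> by (simp add: real_div_sqrt field_simps)
        also have "\<dots> \<le> 8 * (sqrt \<rho> / (\<rho> + (of_int n)\<^sup>2))"
          using \<rho> \<open>(of_int n)\<^sup>2 \<le> \<rho>\<close> by (intro mult_left_mono divide_left_mono) (auto intro!: mult_pos_pos add_pos_nonneg)
        finally show ?thesis using 1 False by (simp add: cell_def)
      qed
    qed
    have "\<rho> / 2 \<le> \<sigma> \<or> \<rho> / 2 \<le> \<tau>" by (auto simp: \<rho>_def)
    then show ?thesis using big by blast
  next
    case False
    then have n0: "n \<noteq> 0" using \<rho> by auto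
    have far: "cell s m \<le> ?c" if s: "0 < s" "s \<le> \<rho>" and m: "\<bar>n\<bar> \<le> 2 * \<bar>m\<bar>" for s m
    proof -
      have m0: "m \<noteq> 0" using m n0 by auto
      have "\<bar>real_of_int n\<bar> \<le> 2 * \<bar>real_of_int m\<bar>" using m by linarith
      then have "\<bar>real_of_int n\<bar>\<^sup>2 \<le> (2 * \<bar>real_of_int m\<bar>)\<^sup>2" by (intro power_mono) auto
      then have nm: "(of_int n)\<^sup>2 \<le> 4 * (real_of_int m)\<^sup>2" by (simp add: power_mult_distrib)
      have "sqrt s / (s + (of_int m)\<^sup>2) \<le> sqrt \<rho> / ((\<rho> + (of_int n)\<^sup>2) / 8)"
        using s \<rho> nm False by (intro frac_le) (auto intro!: add_pos_nonneg)
      then show ?thesis using m0 n0 by (simp add: cell_def mult.commute)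
    qed
    \<comment> \<open>The shorter of the two displacements may be zero, the longer one is not.\<close>
    have "\<bar>n\<bar> \<le> 2 * \<bar>n - k\<bar> \<or> \<bar>n\<bar> \<le> 2 * \<bar>k\<bar>"
      using abs_triangle_ineq[of "n - k" k] by auto
    then show ?thesis using far[OF assms(1) \<rho>(2), of "n - k"] far[OF assms(2) \<rho>(3), of k] by argo
  qed
  then have "cell \<sigma> (n - k) * cell \<tau> k \<le> ?c * (cell \<sigma> (n - k) + cell \<tau> k)"
  proof
    assume "cell \<sigma> (n - k) \<le> ?c"
    then have "cell \<sigma> (n - k) * cell \<tau> k \<le> ?c * cell \<tau> k" using pos by (intro mult_right_mono)
    also have "\<dots> \<le> ?c * (cell \<sigma> (n - k) + cell \<tau> k)" using pos c by (intro mult_left_mono) auto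
    finally show ?thesis .
  next
    assume "cell \<tau> k \<le> ?c"
    then have "cell \<sigma> (n - k) * cell \<tau> k \<le> cell \<sigma> (n - k) * ?c" using pos by (intro mult_left_mono)
    also have "\<dots> = ?c * cell \<sigma> (n - k)" by simp
    also have "\<dots> \<le> ?c * (cell \<sigma> (n - k) + cell \<tau> k)" using pos c by (intro mult_left_mono) auto
    finally show ?thesis .
  qed
  then show ?thesis by (simp add: \<rho>_def)
qed

text \<open>
  The coefficients change the time scale of the walk by a factor \<open>\<kappa>\<close> between positive bounds,
  which the cells absorb.
\<close>

lemma cell_scale_le:
  assumes "k0 \<le> \<kappa>" "\<kappa> \<le> k1" "0 < k0" "0 < \<tau>"
  shows "cell (\<kappa> * \<tau>) n \<le> (1 + sqrt k1) * (1 + 1 / k0) * cell \<tau> n"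
proof -
  have \<kappa>: "0 < \<kappa>" using assms by linarith
  have s: "sqrt \<kappa> \<le> sqrt k1" using assms by simp
  have i: "1 / \<kappa> \<le> 1 / k0" using assms by (simp add: frac_le)
  show ?thesis
  proof (cases "n = 0")
    case True
    have M: "1 / sqrt \<kappa> \<le> (1 + sqrt k1) * (1 + 1 / k0)" "1 \<le> (1 + sqrt k1) * (1 + 1 / k0)"
    proof -
      have "1 / sqrt \<kappa> \<le> 1 + 1 / \<kappa>"
      proof -
        have "0 \<le> (1 / sqrt \<kappa> - 1)\<^sup>2 + 1 + (1 / sqrt \<kappa>)\<^sup>2" by (intro add_nonneg_nonneg) auto
        then show ?thesis using \<kappa> by (simp add: power2_diff power_divide)
      qed
      also have "\<dots> \<le> 1 * (1 + 1 / k0)" using i by simp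
      also have "\<dots> \<le> (1 + sqrt k1) * (1 + 1 / k0)" using assms by (intro mult_right_mono) auto
      finally show "1 / sqrt \<kappa> \<le> (1 + sqrt k1) * (1 + 1 / k0)" .
      have "1 * 1 \<le> (1 + sqrt k1) * (1 + 1 / k0)" using assms by (intro mult_mono) auto
      then show "1 \<le> (1 + sqrt k1) * (1 + 1 / k0)" by simp
    qed
    have "1 / sqrt (\<kappa> * \<tau>) = 1 / sqrt \<kappa> * (1 / sqrt \<tau>)" by (simp add: real_sqrt_mult)
    also have "\<dots> \<le> (1 + sqrt k1) * (1 + 1 / k0) * (1 / sqrt \<tau>)"
      using M(1) assms by (intro mult_right_mono) auto
    finally show ?thesis using True M(2) by (auto simp: cell_def min_def)
  next
    case False
    have "(\<tau> + (of_int n)\<^sup>2) \<le> (1 + 1 / k0) * (\<kappa> * \<tau> + (of_int n)\<^sup>2)"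
    proof -
      have "\<tau> = (1 / \<kappa>) * (\<kappa> * \<tau>)" using \<kappa> by simp
      also have "\<dots> \<le> (1 + 1 / k0) * (\<kappa> * \<tau>)" using i \<kappa> assms by (intro mult_right_mono) auto
      finally have 1: "\<tau> \<le> (1 + 1 / k0) * (\<kappa> * \<tau>)" .
      have "1 * (real_of_int n)\<^sup>2 \<le> (1 + 1 / k0) * (of_int n)\<^sup>2" using assms by (intro mult_right_mono) auto
      with 1 show ?thesis by (simp add: distrib_left)
    qed
    then have "1 / (\<kappa> * \<tau> + (of_int n)\<^sup>2) \<le> (1 + 1 / k0) / (\<tau> + (of_int n)\<^sup>2)"
      using \<kappa> assms by (simp add: divide_le_eq le_divide_eq pos_divide_le_eq add_pos_nonneg mult.commute)
    then have "sqrt (\<kappa> * \<tau>) * (1 / (\<kappa> * \<tau> + (of_int n)\<^sup>2)) \<le> ((1 + sqrt k1) * sqrt \<tau>) * ((1 + 1 / k0) / (\<tau> + (of_int n)\<^sup>2))"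
      using order_trans[OF s, of "1 + sqrt k1"] \<kappa> assms
      by (intro mult_mono) (auto simp: real_sqrt_mult intro!: mult_right_mono add_nonneg_nonneg mult_nonneg_nonneg)
    then show ?thesis using False by (simp add: cell_def mult_ac)
  qed
qed

text \<open>
  The walk at time \<open>r\<close>, seen on the parabolic scale \<open>\<tau>\<close>: the second difference costs a factor \<open>1 /
  \<tau>\<close>, and multiplication by \<open>n\<close> costs \<open>\<surd>\<tau>\<close>. It is used with \<open>\<tau>\<close> proportional to \<open>r\<close>, for bounds
  uniform in the mesh, and with \<open>\<tau> = 1\<close>, for decay on compact time intervals.
\<close>

definition walk_bounded :: "real \<Rightarrow> real \<Rightarrow> real \<Rightarrow> bool" where
  "walk_bounded B \<tau> r \<longleftrightarrow> (\<forall>n. \<bar>walk n r\<bar> \<le> B * cell \<tau> n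
     \<and> \<bar>of_int n\<bar> * \<bar>walk n r\<bar> \<le> B * sqrt \<tau> * cell \<tau> n
     \<and> \<bar>walk_lap n r\<bar> \<le> B / \<tau> * cell \<tau> n
     \<and> \<bar>of_int n\<bar> * \<bar>walk_lap n r\<bar> \<le> B / sqrt \<tau> * cell \<tau> n)"

text \<open>
  The bounds at the centre govern \<open>n\<^sup>2 < r\<close>, and the cubic decay governs \<open>n\<^sup>2 \<ge> r\<close>. The exponent
  three is what is needed: one power of \<open>n\<close> is spent on the weight, two on the cell.
\<close>

lemma walk_bounded_self:
  assumes r: "0 < r"
  shows "walk_bounded (2 * (2 + 13 * 32 ^ 4)) r r"
proof -
  define W :: real where "W = 2 + 13 * 32 ^ 4"
  have W: "4 \<le> W" "1 + 2 * 32 ^ 4 \<le> W" "32 ^ 4 \<le> W" by (simp_all add: W_def)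
  note b = walk_bounds[OF r]
  have b1: "\<bar>walk n r\<bar> \<le> W / sqrt r" for n
    using b(2)[of n] W r by (simp add: le_divide_eq mult.commute)
  have b2: "\<bar>of_int n\<bar> ^ 3 * \<bar>walk n r\<bar> \<le> W * r" for n
    using order_trans[OF b(3)[of n] mult_left_mono[OF W(2)]] r by (simp add: mult.commute)
  have b3: "r * \<bar>walk_lap n r\<bar> \<le> W / sqrt r" for n
    using b(4)[of n] W r by (simp add: le_divide_eq mult_ac)
  have b4: "\<bar>of_int n\<bar> ^ 3 * \<bar>walk_lap n r\<bar> \<le> W" for n
    using b(5)[of n] by (simp add: W_def)
  have b5: "\<bar>walk_lap n r\<bar> \<le> W" for n
    using b(1)[of "n + 1"] b(1)[of n] b(1)[of "n - 1"] W by (simp add: walk_lap_def)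
  have goal: "\<bar>walk n r\<bar> \<le> 2 * W * cell r n
     \<and> \<bar>of_int n\<bar> * \<bar>walk n r\<bar> \<le> sqrt r * (2 * W * cell r n)
     \<and> r * \<bar>walk_lap n r\<bar> \<le> 2 * W * cell r n
     \<and> sqrt r * (\<bar>of_int n\<bar> * \<bar>walk_lap n r\<bar>) \<le> 2 * W * cell r n" for n
  proof -
    have c: "0 < cell r n" by (rule cell_pos[OF r])
    show ?thesis
    proof (cases "n = 0")
      case True
      have 1: "W * cell r n = min W (W / sqrt r)" using W True by (simp add: cell_def min_mult_distrib_left)
      have "r * \<bar>walk_lap n r\<bar> \<le> W \<or> W / sqrt r \<le> W"
      proof (cases "r \<le> 1")
        case True
        then have "r * \<bar>walk_lap n r\<bar> \<le> 1 * W" using r b5[of n] by (intro mult_mono) auto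
        then show ?thesis by simp
      next
        case False
        then show ?thesis using W r by (simp add: divide_le_eq)
      qed
      then have "r * \<bar>walk_lap n r\<bar> \<le> W * cell r n" using b3[of n] unfolding 1 by auto
      moreover have "\<bar>walk n r\<bar> \<le> W * cell r n" using b(1)[of n] b1[of n] W unfolding 1 by auto
      moreover have "W * cell r n \<le> 2 * W * cell r n" using c W by simp
      moreover have "0 \<le> 2 * W * cell r n" using c W by simp
      ultimately show ?thesis using True r by auto
    next
      case False
      have "1 \<le> \<bar>n\<bar>" using False by linarith
      then have n: "1 \<le> \<bar>real_of_int n\<bar>" by linarith
      have cn: "cell r n = sqrt r / (r + (of_int n)\<^sup>2)" using False by (simp add: cell_def)
      show ?thesis
      proof (cases "(of_int n)\<^sup>2 < r")
        case True
        have "1 / sqrt r = 2 * (sqrt r / (r + r))" using r by (simp add: real_div_sqrt field_simps)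
        also have "\<dots> \<le> 2 * cell r n" unfolding cn
          using True r by (intro mult_left_mono divide_left_mono) (auto intro!: mult_pos_pos add_pos_nonneg)
        finally have "W * (1 / sqrt r) \<le> W * (2 * cell r n)" using W by (intro mult_left_mono) auto
        then have q: "W / sqrt r \<le> 2 * W * cell r n" by simp
        have ns: "\<bar>of_int n\<bar> \<le> sqrt r" using True by (intro real_le_rsqrt) auto
        have 1: "\<bar>walk n r\<bar> \<le> 2 * W * cell r n" using b1[of n] q by linarith
        have 2: "r * \<bar>walk_lap n r\<bar> \<le> 2 * W * cell r n" using b3[of n] q by linarith
        have 3: "\<bar>of_int n\<bar> * \<bar>walk n r\<bar> \<le> sqrt r * (2 * W * cell r n)"
          using ns 1 r by (intro mult_mono) auto
        have "sqrt r * (\<bar>of_int n\<bar> * \<bar>walk_lap n r\<bar>) \<le> sqrt r * (sqrt r * \<bar>walk_lap n r\<bar>)"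
          using ns r by (intro mult_left_mono mult_right_mono) auto
        also have "\<dots> = r * \<bar>walk_lap n r\<bar>" using r by (simp add: mult.assoc[symmetric])
        finally show ?thesis using 1 2 3 by linarith
      next
        case F: False
        let ?n = "\<bar>real_of_int n\<bar>"
        have ns: "sqrt r \<le> ?n" using F by (intro real_le_lsqrt) auto
        have "r + (of_int n)\<^sup>2 \<le> 2 * (of_int n)\<^sup>2" using F by simp
        then have "sqrt r / (2 * (of_int n)\<^sup>2) \<le> cell r n" unfolding cn
          using r n by (intro divide_left_mono) (auto intro!: mult_pos_pos add_pos_nonneg simp: False)
        then have "2 * W * (sqrt r / (2 * (of_int n)\<^sup>2)) \<le> 2 * W * cell r n" using W by (intro mult_left_mono) auto
        then have q: "W * sqrt r / ?n\<^sup>2 \<le> 2 * W * cell r n" by simp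
        have n3: "?n ^ 3 = ?n * ?n\<^sup>2" by (simp add: power2_eq_square power3_eq_cube)
        have "?n * \<bar>walk n r\<bar> \<le> W * r / ?n\<^sup>2"
          using b2[of n] n False unfolding n3 by (simp add: le_divide_eq mult_ac)
        also have "\<dots> = sqrt r * (W * sqrt r / ?n\<^sup>2)" using r by (simp add: mult_ac)
        also have "\<dots> \<le> sqrt r * (2 * W * cell r n)" using q r by (intro mult_left_mono) auto
        finally have 3: "?n * \<bar>walk n r\<bar> \<le> sqrt r * (2 * W * cell r n)" .
        also have "\<dots> \<le> ?n * (2 * W * cell r n)" using ns c W by (intro mult_right_mono) auto
        finally have 1: "\<bar>walk n r\<bar> \<le> 2 * W * cell r n"
          by (rule mult_left_le_imp_le) (use n in simp)
        have "?n * \<bar>walk_lap n r\<bar> \<le> W / ?n\<^sup>2"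
          using b4[of n] n False unfolding n3 by (simp add: le_divide_eq mult_ac)
        then have "sqrt r * (?n * \<bar>walk_lap n r\<bar>) \<le> sqrt r * (W / ?n\<^sup>2)" using r by (intro mult_left_mono) auto
        with q have 4: "sqrt r * (?n * \<bar>walk_lap n r\<bar>) \<le> 2 * W * cell r n" by (simp add: mult_ac)
        have "r * \<bar>walk_lap n r\<bar> = sqrt r * (sqrt r * \<bar>walk_lap n r\<bar>)" using r by (simp add: mult.assoc[symmetric])
        also have "\<dots> \<le> sqrt r * (?n * \<bar>walk_lap n r\<bar>)" using ns r by (intro mult_left_mono mult_right_mono) auto
        finally show ?thesis using 1 3 4 by linarith
      qed
    qed
  qed
  show ?thesis unfolding walk_bounded_def W_def[symmetric]
  proof (intro allI conjI)
    fix n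
    show "\<bar>walk n r\<bar> \<le> 2 * W * cell r n" using goal[of n] by blast
    show "\<bar>of_int n\<bar> * \<bar>walk n r\<bar> \<le> 2 * W * sqrt r * cell r n" using goal[of n] by (simp add: mult_ac)
    show "\<bar>walk_lap n r\<bar> \<le> 2 * W / r * cell r n"
      using goal[of n] r by (simp add: le_divide_eq mult_ac)
    show "\<bar>of_int n\<bar> * \<bar>walk_lap n r\<bar> \<le> 2 * W / sqrt r * cell r n"
      using goal[of n] r by (simp add: le_divide_eq mult_ac)
  qed
qed

lemma walk_bounded_uniform:
  assumes "0 < k0"
  obtains B where "1 \<le> B" "\<And>\<kappa> \<tau>. k0 \<le> \<kappa> \<Longrightarrow> \<kappa> \<le> k1 \<Longrightarrow> 0 < \<tau> \<Longrightarrow> walk_bounded B \<tau> (\<kappa> * \<tau>)"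
proof -
  define A :: real where "A = 2 * (2 + 13 * 32 ^ 4)"
  define M where "M = (1 + sqrt (max k0 k1)) * (1 + 1 / k0)"
  have s0: "0 < sqrt (max k0 k1)" using assms by simp
  have M1: "1 \<le> M" unfolding M_def using assms s0 mult_mono[of 1 "1 + sqrt (max k0 k1)" 1 "1 + 1 / k0"] by simp
  have A1: "1 \<le> A" by (simp add: A_def)
  show ?thesis
  proof (rule that)
    show "1 \<le> A * (M * M)" using A1 M1 by (simp add: mult_ge1_I)
    fix \<kappa> \<tau> :: real assume \<kappa>: "k0 \<le> \<kappa>" "\<kappa> \<le> k1" and \<tau>: "0 < \<tau>"
    have k: "0 < \<kappa>" using \<kappa> assms by simp
    have r: "0 < \<kappa> * \<tau>" using k \<tau> by simp
    have sM: "sqrt \<kappa> \<le> M"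
    proof -
      have "sqrt \<kappa> * 1 \<le> M" unfolding M_def using \<kappa> assms by (intro mult_mono) (auto intro: add_increasing)
      then show ?thesis by simp
    qed
    have iM: "1 / \<kappa> \<le> M"
    proof -
      have "1 * (1 / \<kappa>) \<le> M" unfolding M_def using \<kappa> assms s0 by (intro mult_mono) (auto simp: frac_le add_increasing)
      then show ?thesis by simp
    qed
    have isM: "1 / sqrt \<kappa> \<le> M"
    proof -
      have "1 / sqrt \<kappa> = sqrt \<kappa> * (1 / \<kappa>)" using k by (simp add: real_div_sqrt field_simps)
      also have "\<dots> \<le> (1 + sqrt (max k0 k1)) * (1 + 1 / k0)"
        using \<kappa> assms k by (intro mult_mono) (auto simp: frac_le add_increasing)
      finally show ?thesis by (simp add: M_def)
    qed
    have cM: "cell (\<kappa> * \<tau>) n \<le> M * cell \<tau> n" for n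
      unfolding M_def using \<kappa> assms \<tau> by (intro cell_scale_le) auto
    have sc: "A * x * cell (\<kappa> * \<tau>) n \<le> A * (M * M) * y * cell \<tau> n" if "x \<le> M * y" "0 \<le> x" for x y n
    proof -
      have "A * x * cell (\<kappa> * \<tau>) n \<le> A * (M * y) * (M * cell \<tau> n)"
        using that cM[of n] A1 M1 cell_pos[OF r, of n] by (intro mult_mono) (auto intro: order_trans)
      then show ?thesis by (simp add: mult_ac)
    qed
    note w = walk_bounded_self[OF r, folded A_def, unfolded walk_bounded_def, rule_format]
    show "walk_bounded (A * (M * M)) \<tau> (\<kappa> * \<tau>)"
      unfolding walk_bounded_def
    proof (intro allI conjI)
      fix n
      show "\<bar>walk n (\<kappa> * \<tau>)\<bar> \<le> A * (M * M) * cell \<tau> n"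
        using w[of n] sc[of 1 1 n] M1 by simp
      have x: "sqrt (\<kappa> * \<tau>) \<le> M * sqrt \<tau>"
        using mult_right_mono[OF sM, of "sqrt \<tau>"] \<tau> by (simp add: real_sqrt_mult)
      show "\<bar>of_int n\<bar> * \<bar>walk n (\<kappa> * \<tau>)\<bar> \<le> A * (M * M) * sqrt \<tau> * cell \<tau> n"
        using w[of n] sc[of "sqrt (\<kappa> * \<tau>)" "sqrt \<tau>" n, OF x] r by (meson order_trans real_sqrt_ge_zero less_imp_le)
      have x: "1 / (\<kappa> * \<tau>) \<le> M * (1 / \<tau>)" using mult_right_mono[OF iM, of "1 / \<tau>"] \<tau> by simp
      have "0 \<le> 1 / (\<kappa> * \<tau>)" using r by simp
      from sc[OF x this, of n]
      have "A / (\<kappa> * \<tau>) * cell (\<kappa> * \<tau>) n \<le> A * (M * M) / \<tau> * cell \<tau> n" by (simp only: times_divide_eq_right mult_1_right)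
      with w[of n] show "\<bar>walk_lap n (\<kappa> * \<tau>)\<bar> \<le> A * (M * M) / \<tau> * cell \<tau> n" by linarith
      have x: "1 / sqrt (\<kappa> * \<tau>) \<le> M * (1 / sqrt \<tau>)"
        using mult_right_mono[OF isM, of "1 / sqrt \<tau>"] \<tau> by (simp add: real_sqrt_mult)
      have "0 \<le> 1 / sqrt (\<kappa> * \<tau>)" using r by simp
      from sc[OF x this, of n]
      have "A / sqrt (\<kappa> * \<tau>) * cell (\<kappa> * \<tau>) n \<le> A * (M * M) / sqrt \<tau> * cell \<tau> n" by (simp only: times_divide_eq_right mult_1_right)
      with w[of n] show "\<bar>of_int n\<bar> * \<bar>walk_lap n (\<kappa> * \<tau>)\<bar> \<le> A * (M * M) / sqrt \<tau> * cell \<tau> n" by linarith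
    qed
  qed
qed

text \<open>
  The value at \<open>n\<close> of the second difference involves the neighbours of \<open>n\<close>; a shift by one changes
  \<open>(1 + \<bar>n\<bar>)\<^sup>3\<close> by a factor of at most eight.
\<close>

lemma walk_bounded_local:
  obtains B where "1 \<le> B" "\<And>r. \<bar>r\<bar> \<le> R \<Longrightarrow> walk_bounded B 1 r"
proof -
  obtain B where B1: "1 \<le> B" and B: "\<And>r n. \<bar>r\<bar> \<le> R \<Longrightarrow> (1 + \<bar>of_int n\<bar>) ^ 3 * \<bar>walk n r\<bar> \<le> B"
    using walk_locally_bounded[of R] by blast
  show ?thesis
  proof (rule that)
    show "1 \<le> 32 * B" using B1 by simp
    fix r :: real assume r: "\<bar>r\<bar> \<le> R"
    have cell1: "1 / (1 + (of_int n)\<^sup>2) \<le> cell 1 n" for n by (simp add: cell_def)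
    have lap: "(1 + \<bar>of_int n\<bar>) ^ 3 * \<bar>walk_lap n r\<bar> \<le> 32 * B" for n
    proof -
      let ?q = "(1 + \<bar>real_of_int n\<bar>) ^ 3"
      have q: "?q * \<bar>walk m r\<bar> \<le> 8 * B" if "\<bar>m - n\<bar> \<le> 1" for m
      proof -
        have "1 + \<bar>n\<bar> \<le> 2 * (1 + \<bar>m\<bar>)" using that abs_triangle_ineq4[of m "m - n"] by simp
        then have "real_of_int (1 + \<bar>n\<bar>) \<le> real_of_int (2 * (1 + \<bar>m\<bar>))" by (simp only: of_int_le_iff)
        then have "1 + \<bar>real_of_int n\<bar> \<le> 2 * (1 + \<bar>real_of_int m\<bar>)" by simp
        then have "?q \<le> (2 * (1 + \<bar>real_of_int m\<bar>)) ^ 3" by (intro power_mono) auto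
        also have "\<dots> = 8 * (1 + \<bar>real_of_int m\<bar>) ^ 3" unfolding power_mult_distrib by simp
        finally have "?q * \<bar>walk m r\<bar> \<le> 8 * (1 + \<bar>real_of_int m\<bar>) ^ 3 * \<bar>walk m r\<bar>" by (intro mult_right_mono) auto
        then show ?thesis using B[OF r, of m] by (simp add: mult.assoc)
      qed
      have "\<bar>walk_lap n r\<bar> \<le> \<bar>walk (n + 1) r\<bar> + 2 * \<bar>walk n r\<bar> + \<bar>walk (n - 1) r\<bar>" by (simp add: walk_lap_def)
      then have "?q * \<bar>walk_lap n r\<bar> \<le> ?q * (\<bar>walk (n + 1) r\<bar> + 2 * \<bar>walk n r\<bar> + \<bar>walk (n - 1) r\<bar>)"
        by (intro mult_left_mono) auto
      also have "\<dots> = ?q * \<bar>walk (n + 1) r\<bar> + 2 * (?q * \<bar>walk n r\<bar>) + ?q * \<bar>walk (n - 1) r\<bar>" by (simp add: algebra_simps)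
      finally show ?thesis using q[of "n + 1"] q[of n] q[of "n - 1"] by simp
    qed
    have fin: "x \<le> 32 * B * cell 1 n \<and> \<bar>of_int n\<bar> * x \<le> 32 * B * cell 1 n"
      if x: "(1 + \<bar>of_int n\<bar>) ^ 3 * x \<le> 32 * B" "0 \<le> x" for x :: real and n :: int
    proof -
      let ?n = "\<bar>real_of_int n\<bar>"
      have "(1 + ?n\<^sup>2) * ((1 + ?n) * x) \<le> (1 + ?n)\<^sup>2 * ((1 + ?n) * x)"
        using x by (intro mult_right_mono) (auto simp: power2_eq_square algebra_simps)
      also have "\<dots> = (1 + ?n) ^ 3 * x" by (simp add: power2_eq_square power3_eq_cube mult_ac)
      also have "\<dots> \<le> 32 * B" by (rule x)
      finally have "(1 + ?n) * x \<le> 32 * B * (1 / (1 + (of_int n)\<^sup>2))" by (simp add: le_divide_eq add_pos_nonneg mult_ac)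
      also have "\<dots> \<le> 32 * B * cell 1 n" using B1 cell1[of n] by (intro mult_left_mono) auto
      finally have "x + ?n * x \<le> 32 * B * cell 1 n" by (simp add: algebra_simps)
      moreover have "0 \<le> ?n * x" using x by simp
      ultimately show ?thesis using x by linarith
    qed
    have "(1 + \<bar>of_int n\<bar>) ^ 3 * \<bar>walk n r\<bar> \<le> 32 * B" for n using B[OF r, of n] B1 by simp
    then show "walk_bounded (32 * B) 1 r" unfolding walk_bounded_def using fin lap by simp
  qed
qed

text \<open>
  The envelope in grid units: \<open>\<alpha>\<close> is a displacement, and \<open>\<tau>\<close> is the time divided by the square of
  the mesh size.
\<close>

definition env :: "real \<Rightarrow> int ^ 'd::finite \<Rightarrow> real" where
  "env \<tau> \<alpha> = (\<Prod>j\<in>UNIV. cell \<tau> (\<alpha> $ j))"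

lemma env_pos: "0 < \<tau> \<Longrightarrow> 0 < env \<tau> \<alpha>"
  by (simp add: env_def prod_pos cell_pos)

lemma env_nonneg: "0 < \<tau> \<Longrightarrow> 0 \<le> env \<tau> \<alpha>"
  using env_pos less_imp_le by blast

lemma env_le_1: "0 < \<tau> \<Longrightarrow> env \<tau> \<alpha> \<le> 1"
  unfolding env_def by (intro prod_le_1) (simp add: cell_le_1 less_imp_le[OF cell_pos])

text \<open>
  Every finite set of multi-indices lies in a box, over which the sum of the products is the
  product of the sums.
\<close>

lemma summable_prod_coords:
  fixes f :: "'d::finite \<Rightarrow> int \<Rightarrow> real"
  assumes nn: "\<And>j n. 0 \<le> f j n" and S: "\<And>j B. finite B \<Longrightarrow> sum (f j) B \<le> S j"
  shows "(\<lambda>\<alpha> :: int ^ 'd. \<Prod>j\<in>UNIV. f j (\<alpha> $ j)) summable_on UNIV"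
    and "(\<Sum>\<^sub>\<infinity>\<alpha> :: int ^ 'd. \<Prod>j\<in>UNIV. f j (\<alpha> $ j)) \<le> (\<Prod>j\<in>UNIV. S j)"
proof -
  have fin: "(\<Sum>\<alpha>\<in>A. \<Prod>j\<in>UNIV. f j (\<alpha> $ j)) \<le> (\<Prod>j\<in>UNIV. S j)" if "finite A" for A :: "(int ^ 'd) set"
  proof -
    define B where "B j = (\<lambda>\<alpha>. \<alpha> $ j) ` A" for j
    have "(\<Sum>\<alpha>\<in>A. \<Prod>j\<in>UNIV. f j (\<alpha> $ j)) = (\<Sum>g\<in>vec_nth ` A. \<Prod>j\<in>UNIV. f j (g j))"
      by (subst sum.reindex) (auto simp: inj_on_def vec_nth_inject)
    also have "\<dots> \<le> (\<Sum>g\<in>PiE UNIV B. \<Prod>j\<in>UNIV. f j (g j))"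
      using that by (intro sum_mono2 finite_PiE prod_nonneg) (auto simp: B_def nn)
    also have "\<dots> = (\<Prod>j\<in>UNIV. sum (f j) (B j))"
      using that by (subst prod_sum_PiE) (auto simp: B_def)
    also have "\<dots> \<le> (\<Prod>j\<in>UNIV. S j)"
      using that by (intro prod_mono) (auto simp: B_def intro!: sum_nonneg nn S)
    finally show ?thesis .
  qed
  show s: "(\<lambda>\<alpha> :: int ^ 'd. \<Prod>j\<in>UNIV. f j (\<alpha> $ j)) summable_on UNIV"
    using fin by (intro nonneg_bounded_partial_sums_imp_summable_on[where C = "\<Prod>j\<in>UNIV. S j"])
      (auto intro!: prod_nonneg nn eventually_finite_subsets_at_top_weakI)
  show "(\<Sum>\<^sub>\<infinity>\<alpha> :: int ^ 'd. \<Prod>j\<in>UNIV. f j (\<alpha> $ j)) \<le> (\<Prod>j\<in>UNIV. S j)"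
    using fin by (intro infsum_le_finite_sums[OF s]) auto
qed

lemma sum_cell_shift:
  assumes "0 < \<tau>" "finite B"
  shows "(\<Sum>k\<in>B. cell \<tau> (a - k)) \<le> 1 + pi" "(\<Sum>k\<in>B. cell \<tau> (k - a)) \<le> 1 + pi"
proof -
  have "(\<Sum>k\<in>B. cell \<tau> (a - k)) = (\<Sum>k\<in>(\<lambda>k. a - k) ` B. cell \<tau> k)"
    by (subst sum.reindex) (auto simp: inj_on_def)
  then show "(\<Sum>k\<in>B. cell \<tau> (a - k)) \<le> 1 + pi" using sum_cell_le[OF assms(1)] assms(2) by simp
  have "(\<Sum>k\<in>B. cell \<tau> (k - a)) = (\<Sum>k\<in>(\<lambda>k. k - a) ` B. cell \<tau> k)"
    by (subst sum.reindex) (auto simp: inj_on_def)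
  then show "(\<Sum>k\<in>B. cell \<tau> (k - a)) \<le> 1 + pi" using sum_cell_le[OF assms(1)] assms(2) by simp
qed

lemma env_summable:
  fixes \<alpha> :: "int ^ 'd::finite"
  assumes "0 < \<tau>"
  shows "(\<lambda>\<eta>. env \<tau> (\<alpha> - \<eta>)) summable_on UNIV" "(\<Sum>\<^sub>\<infinity>\<eta>. env \<tau> (\<alpha> - \<eta>)) \<le> (1 + pi) ^ CARD('d)"
    and "(\<lambda>\<eta>. env \<tau> (\<eta> - \<alpha>)) summable_on UNIV" "(\<Sum>\<^sub>\<infinity>\<eta>. env \<tau> (\<eta> - \<alpha>)) \<le> (1 + pi) ^ CARD('d)"
  using summable_prod_coords[of "\<lambda>j k. cell \<tau> (\<alpha> $ j - k)" "\<lambda>_. 1 + pi"]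
    summable_prod_coords[of "\<lambda>j k. cell \<tau> (k - \<alpha> $ j)" "\<lambda>_. 1 + pi"] assms
  by (simp_all add: env_def sum_cell_shift less_imp_le[OF cell_pos])

text \<open>
  The convolution of two products is the product of the convolutions, so that the one-dimensional
  estimate applies in each coordinate.
\<close>

lemma env_conv:
  fixes \<alpha> \<beta> :: "int ^ 'd::finite"
  assumes "0 < \<sigma>" "0 < \<tau>"
  shows "(\<lambda>\<eta>. env \<sigma> (\<alpha> - \<eta>) * env \<tau> (\<eta> - \<beta>)) summable_on UNIV"
    and "(\<Sum>\<^sub>\<infinity>\<eta>. env \<sigma> (\<alpha> - \<eta>) * env \<tau> (\<eta> - \<beta>)) \<le> (16 * (1 + pi)) ^ CARD('d) * env (\<sigma> + \<tau>) (\<alpha> - \<beta>)"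
proof -
  define f where "f j k = 8 * cell (\<sigma> + \<tau>) (\<alpha> $ j - \<beta> $ j) * (cell \<sigma> (\<alpha> $ j - k) + cell \<tau> (k - \<beta> $ j))" for j k
  have c: "0 < cell (\<sigma> + \<tau>) n" "0 < cell \<sigma> n" "0 < cell \<tau> n" for n using assms by (simp_all add: cell_pos)
  have nn: "0 \<le> f j k" for j k
    unfolding f_def using c by (intro mult_nonneg_nonneg add_nonneg_nonneg) (auto intro: less_imp_le)
  have S: "sum (f j) B \<le> 16 * (1 + pi) * cell (\<sigma> + \<tau>) (\<alpha> $ j - \<beta> $ j)" if "finite B" for j B
  proof -
    have "sum (f j) B = 8 * cell (\<sigma> + \<tau>) (\<alpha> $ j - \<beta> $ j) * ((\<Sum>k\<in>B. cell \<sigma> (\<alpha> $ j - k)) + (\<Sum>k\<in>B. cell \<tau> (k - \<beta> $ j)))"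
      unfolding f_def by (simp add: sum_distrib_left[symmetric] sum.distrib)
    also have "\<dots> \<le> 8 * cell (\<sigma> + \<tau>) (\<alpha> $ j - \<beta> $ j) * ((1 + pi) + (1 + pi))"
      using assms that c[of "\<alpha> $ j - \<beta> $ j"] by (intro mult_left_mono add_mono sum_cell_shift) auto
    finally show ?thesis by (simp add: algebra_simps)
  qed
  have le: "env \<sigma> (\<alpha> - \<eta>) * env \<tau> (\<eta> - \<beta>) \<le> (\<Prod>j\<in>UNIV. f j (\<eta> $ j))" for \<eta>
    unfolding env_def prod.distrib[symmetric] f_def
  proof (intro prod_mono conjI)
    fix j
    show "0 \<le> cell \<sigma> ((\<alpha> - \<eta>) $ j) * cell \<tau> ((\<eta> - \<beta>) $ j)" using c by (simp add: less_imp_le)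
    show "cell \<sigma> ((\<alpha> - \<eta>) $ j) * cell \<tau> ((\<eta> - \<beta>) $ j) \<le> 8 * cell (\<sigma> + \<tau>) (\<alpha> $ j - \<beta> $ j) *
        (cell \<sigma> (\<alpha> $ j - \<eta> $ j) + cell \<tau> (\<eta> $ j - \<beta> $ j))"
      using cell_mult_le[OF assms, of "\<alpha> $ j - \<beta> $ j" "\<eta> $ j - \<beta> $ j"] by simp
  qed
  have P: "(\<lambda>\<eta> :: int ^ 'd. \<Prod>j\<in>UNIV. f j (\<eta> $ j)) summable_on UNIV"
    "(\<Sum>\<^sub>\<infinity>\<eta> :: int ^ 'd. \<Prod>j\<in>UNIV. f j (\<eta> $ j)) \<le> (\<Prod>j\<in>UNIV. 16 * (1 + pi) * cell (\<sigma> + \<tau>) (\<alpha> $ j - \<beta> $ j))"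
    by (rule summable_prod_coords; rule nn S; assumption?)+
  show s: "(\<lambda>\<eta>. env \<sigma> (\<alpha> - \<eta>) * env \<tau> (\<eta> - \<beta>)) summable_on UNIV"
    by (rule summable_on_comparison_test[OF P(1)]) (auto simp: le env_nonneg assms)
  have "(\<Sum>\<^sub>\<infinity>\<eta>. env \<sigma> (\<alpha> - \<eta>) * env \<tau> (\<eta> - \<beta>)) \<le> (\<Sum>\<^sub>\<infinity>\<eta>. \<Prod>j\<in>UNIV. f j (\<eta> $ j))"
    by (rule infsum_mono[OF s P(1)]) (rule le)
  also have "\<dots> \<le> (\<Prod>j\<in>UNIV. 16 * (1 + pi) * cell (\<sigma> + \<tau>) (\<alpha> $ j - \<beta> $ j))" by (rule P(2))
  also have "\<dots> = (16 * (1 + pi)) ^ CARD('d) * env (\<sigma> + \<tau>) (\<alpha> - \<beta>)"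
    by (subst prod.distrib) (simp only: prod_constant env_def vector_minus_component)
  finally show "(\<Sum>\<^sub>\<infinity>\<eta>. env \<sigma> (\<alpha> - \<eta>) * env \<tau> (\<eta> - \<beta>)) \<le> (16 * (1 + pi)) ^ CARD('d) * env (\<sigma> + \<tau>) (\<alpha> - \<beta>)" .
qed

text \<open>
  The form in which the envelope is used. When \<open>F\<close> and \<open>H\<close> are of size \<open>1 / dx ^ CARD('d)\<close>, so is
  their convolution.
\<close>

lemma conv_env_bound:
  fixes \<alpha> \<beta> :: "int ^ 'd::finite"
  assumes "0 < \<sigma>" "0 < \<tau>" "0 \<le> dx"
    and F: "\<And>\<eta>. \<bar>F \<alpha> \<eta>\<bar> \<le> f * env \<sigma> (\<alpha> - \<eta>)" and H: "\<And>\<eta>. \<bar>H \<eta> \<beta>\<bar> \<le> g * env \<tau> (\<eta> - \<beta>)"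
  shows "(\<lambda>\<eta>. F \<alpha> \<eta> * H \<eta> \<beta>) summable_on UNIV"
    and "\<bar>conv dx F H \<alpha> \<beta>\<bar> \<le> dx ^ CARD('d) * (16 * (1 + pi)) ^ CARD('d) * f * g * env (\<sigma> + \<tau>) (\<alpha> - \<beta>)"
proof -
  have f: "0 \<le> f"
    using order_trans[OF abs_ge_zero F[of \<alpha>]] env_pos[OF assms(1), of "\<alpha> - \<alpha>"] by (simp add: zero_le_mult_iff)
  have g: "0 \<le> g"
    using order_trans[OF abs_ge_zero H[of \<beta>]] env_pos[OF assms(2), of "\<beta> - \<beta>"] by (simp add: zero_le_mult_iff)
  let ?e = "\<lambda>\<eta>. env \<sigma> (\<alpha> - \<eta>) * env \<tau> (\<eta> - \<beta>)"
  have le: "norm (F \<alpha> \<eta> * H \<eta> \<beta>) \<le> f * g * ?e \<eta>" for \<eta>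
  proof -
    have "\<bar>F \<alpha> \<eta>\<bar> * \<bar>H \<eta> \<beta>\<bar> \<le> (f * env \<sigma> (\<alpha> - \<eta>)) * (g * env \<tau> (\<eta> - \<beta>))"
      using f env_nonneg[OF assms(1)] by (intro mult_mono F H mult_nonneg_nonneg) auto
    then show ?thesis by (simp add: abs_mult mult_ac)
  qed
  have es: "(\<lambda>\<eta>. f * g * ?e \<eta>) summable_on UNIV" by (intro summable_on_cmult_right env_conv assms)
  have n: "(\<lambda>\<eta>. norm (F \<alpha> \<eta> * H \<eta> \<beta>)) summable_on UNIV"
    by (rule Infinite_Sum.abs_summable_on_comparison_test'[OF es]) (rule le)
  then show s: "(\<lambda>\<eta>. F \<alpha> \<eta> * H \<eta> \<beta>) summable_on UNIV" by (rule abs_summable_summable)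
  have "conv dx F H \<alpha> \<beta> = (\<Sum>\<^sub>\<infinity>\<eta>. F \<alpha> \<eta> * H \<eta> \<beta>) * dx ^ CARD('d)"
    unfolding conv_def by (rule infsum_cmult_left) (use s in auto)
  then have "\<bar>conv dx F H \<alpha> \<beta>\<bar> = norm (\<Sum>\<^sub>\<infinity>\<eta>. F \<alpha> \<eta> * H \<eta> \<beta>) * dx ^ CARD('d)" using assms by (simp add: abs_mult)
  also have "\<dots> \<le> (\<Sum>\<^sub>\<infinity>\<eta>. f * g * ?e \<eta>) * dx ^ CARD('d)"
    using assms by (intro mult_right_mono order_trans[OF norm_infsum_bound[OF n] infsum_mono[OF n es le]]) auto
  also have "(\<Sum>\<^sub>\<infinity>\<eta>. f * g * ?e \<eta>) = f * g * (\<Sum>\<^sub>\<infinity>\<eta>. ?e \<eta>)"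
    by (rule infsum_cmult_right) (use env_conv(1)[OF assms(1,2)] in auto)
  also have "f * g * (\<Sum>\<^sub>\<infinity>\<eta>. ?e \<eta>) * dx ^ CARD('d) \<le>
      f * g * ((16 * (1 + pi)) ^ CARD('d) * env (\<sigma> + \<tau>) (\<alpha> - \<beta>)) * dx ^ CARD('d)"
    using f g assms by (intro mult_right_mono mult_left_mono env_conv) auto
  finally show "\<bar>conv dx F H \<alpha> \<beta>\<bar> \<le> dx ^ CARD('d) * (16 * (1 + pi)) ^ CARD('d) * f * g * env (\<sigma> + \<tau>) (\<alpha> - \<beta>)"
    by (simp only: mult_ac)
qed

text \<open>
  On a fixed mesh every kernel is compared with the envelope at time one; the time two that a
  convolution produces is absorbed in the constant.
\<close>

lemma env_2_le: "env 2 \<alpha> \<le> 2 ^ CARD('d) * env 1 (\<alpha> :: int ^ 'd::finite)"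
proof -
  have "cell 2 n \<le> 2 * cell 1 n" for n
  proof (cases "n = 0")
    case True
    then show ?thesis using cell_le_1[of 2 0] by (simp add: cell_def[of 1 0])
  next
    case False
    have "sqrt 2 / (2 + (of_int n)\<^sup>2) \<le> 2 / (1 + (real_of_int n)\<^sup>2)"
      by (intro frac_le real_le_lsqrt) (auto intro: add_pos_nonneg)
    then show ?thesis using False by (simp add: cell_def)
  qed
  then have "env 2 \<alpha> \<le> (\<Prod>j\<in>UNIV. 2 * cell 1 (\<alpha> $ j))"
    unfolding env_def by (intro prod_mono) (simp add: less_imp_le[OF cell_pos])
  then show ?thesis by (simp add: env_def prod.distrib)
qed


section \<open>Kernels with summable decay\<close>

text \<open>
  The class of kernels for a fixed mesh. The profile \<open>env 1\<close> is fixed, so that continuity in time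
  and domination allow all exchanges of limits.
\<close>

definition kernel_on :: "real set \<Rightarrow> (real \<Rightarrow> int ^ 'd::finite \<Rightarrow> int ^ 'd \<Rightarrow> real) \<Rightarrow> bool" where
  "kernel_on S F \<longleftrightarrow> (\<forall>\<alpha> \<beta>. continuous_on S (\<lambda>t. F t \<alpha> \<beta>)) \<and>
     (\<exists>C. \<forall>t\<in>S. \<forall>\<alpha> \<beta>. \<bar>F t \<alpha> \<beta>\<bar> \<le> C * env 1 (\<alpha> - \<beta>))"

lemma kernel_onE:
  assumes "kernel_on S F"
  obtains C where "0 \<le> C" "\<And>t \<alpha> \<beta>. t \<in> S \<Longrightarrow> \<bar>F t \<alpha> \<beta>\<bar> \<le> C * env 1 (\<alpha> - \<beta>)"
proof -
  obtain C where C: "\<And>t \<alpha> \<beta>. t \<in> S \<Longrightarrow> \<bar>F t \<alpha> \<beta>\<bar> \<le> C * env 1 (\<alpha> - \<beta>)"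
    using assms unfolding kernel_on_def by blast
  show ?thesis
  proof (rule that)
    show "0 \<le> max C 0" by simp
    fix t \<alpha> \<beta> assume "t \<in> S"
    then have "\<bar>F t \<alpha> \<beta>\<bar> \<le> C * env 1 (\<alpha> - \<beta>)" by (rule C)
    also have "\<dots> \<le> max C 0 * env 1 (\<alpha> - \<beta>)" by (intro mult_right_mono env_nonneg) auto
    finally show "\<bar>F t \<alpha> \<beta>\<bar> \<le> max C 0 * env 1 (\<alpha> - \<beta>)" .
  qed
qed

lemma kernel_on_continuous: "kernel_on S F \<Longrightarrow> continuous_on S (\<lambda>t. F t \<alpha> \<beta>)"
  by (simp add: kernel_on_def)

lemma kernel_on_subset: "kernel_on S F \<Longrightarrow> S' \<subseteq> S \<Longrightarrow> kernel_on S' F"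
  unfolding kernel_on_def using continuous_on_subset by blast

lemma kernel_on_add:
  assumes "kernel_on S F" "kernel_on S H"
  shows "kernel_on S (\<lambda>t \<alpha> \<beta>. F t \<alpha> \<beta> + H t \<alpha> \<beta>)"
proof -
  obtain C D where "\<And>t \<alpha> \<beta>. t \<in> S \<Longrightarrow> \<bar>F t \<alpha> \<beta>\<bar> \<le> C * env 1 (\<alpha> - \<beta>)"
    "\<And>t \<alpha> \<beta>. t \<in> S \<Longrightarrow> \<bar>H t \<alpha> \<beta>\<bar> \<le> D * env 1 (\<alpha> - \<beta>)"
    using kernel_onE[OF assms(1)] kernel_onE[OF assms(2)] by metis
  then have "\<forall>t\<in>S. \<forall>\<alpha> \<beta>. \<bar>F t \<alpha> \<beta> + H t \<alpha> \<beta>\<bar> \<le> (C + D) * env 1 (\<alpha> - \<beta>)"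
    by (auto simp: distrib_right intro: order_trans[OF abs_triangle_ineq add_mono])
  then show ?thesis using assms unfolding kernel_on_def by (auto intro: continuous_on_add)
qed

lemma kernel_on_cmult:
  assumes "kernel_on S F" shows "kernel_on S (\<lambda>t \<alpha> \<beta>. c * F t \<alpha> \<beta>)"
proof -
  obtain C where "\<And>t \<alpha> \<beta>. t \<in> S \<Longrightarrow> \<bar>F t \<alpha> \<beta>\<bar> \<le> C * env 1 (\<alpha> - \<beta>)"
    using kernel_onE[OF assms] by metis
  then have "\<forall>t\<in>S. \<forall>\<alpha> \<beta>. \<bar>c * F t \<alpha> \<beta>\<bar> \<le> (\<bar>c\<bar> * C) * env 1 (\<alpha> - \<beta>)"
    by (auto simp: abs_mult mult.assoc intro: mult_left_mono)
  then show ?thesis using assms unfolding kernel_on_def by (auto intro: continuous_on_mult_left)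
qed

lemma kernel_on_conv_bound:
  fixes \<alpha> \<beta> :: "int ^ 'd::finite"
  assumes "0 \<le> dx" "0 \<le> f" "0 \<le> g"
    and "\<And>\<eta>. \<bar>F \<alpha> \<eta>\<bar> \<le> f * env 1 (\<alpha> - \<eta>)" "\<And>\<eta>. \<bar>H \<eta> \<beta>\<bar> \<le> g * env 1 (\<eta> - \<beta>)"
  shows "\<bar>conv dx F H \<alpha> \<beta>\<bar> \<le> (dx * (32 * (1 + pi))) ^ CARD('d) * f * g * env 1 (\<alpha> - \<beta>)"
proof -
  have "\<bar>conv dx F H \<alpha> \<beta>\<bar> \<le> dx ^ CARD('d) * (16 * (1 + pi)) ^ CARD('d) * f * g * env (1 + 1) (\<alpha> - \<beta>)"
    using assms by (intro conv_env_bound) auto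
  also have "\<dots> \<le> dx ^ CARD('d) * (16 * (1 + pi)) ^ CARD('d) * f * g * (2 ^ CARD('d) * env 1 (\<alpha> - \<beta>))"
    using assms env_2_le by (intro mult_left_mono) auto
  also have "\<dots> = (dx * (2 * (16 * (1 + pi)))) ^ CARD('d) * f * g * env 1 (\<alpha> - \<beta>)"
    by (simp only: power_mult_distrib mult_ac)
  finally show ?thesis by simp
qed

lemma kernel_on_conv_summable:
  assumes "kernel_on S F" "kernel_on S' H" "u \<in> S" "v \<in> S'"
  shows "conv_summable (F u) (H v)"
proof -
  obtain C D where "\<And>t \<alpha> \<beta>. t \<in> S \<Longrightarrow> \<bar>F t \<alpha> \<beta>\<bar> \<le> C * env 1 (\<alpha> - \<beta>)"
    "\<And>t \<alpha> \<beta>. t \<in> S' \<Longrightarrow> \<bar>H t \<alpha> \<beta>\<bar> \<le> D * env 1 (\<alpha> - \<beta>)"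
    using kernel_onE[OF assms(1)] kernel_onE[OF assms(2)] by metis
  then show ?thesis unfolding conv_summable_def
    using assms by (intro allI conv_env_bound(1)[of 1 1 0 _ _ C _ _ D]) auto
qed

lemma kernel_on_conv_continuous:
  fixes F :: "real \<Rightarrow> int ^ 'd::finite \<Rightarrow> int ^ 'd \<Rightarrow> real"
  assumes "kernel_on S F" "kernel_on S' H" "0 \<le> dx"
  shows "continuous_on (S \<times> S') (\<lambda>x. conv dx (F (fst x)) (H (snd x)) \<alpha> \<beta>)"
proof -
  obtain C D where C: "0 \<le> C" "\<And>t \<alpha> \<beta>. t \<in> S \<Longrightarrow> \<bar>F t \<alpha> \<beta>\<bar> \<le> C * env 1 (\<alpha> - \<beta>)"
    and D: "0 \<le> D" "\<And>t \<alpha> \<beta>. t \<in> S' \<Longrightarrow> \<bar>H t \<alpha> \<beta>\<bar> \<le> D * env 1 (\<alpha> - \<beta>)"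
    using kernel_onE[OF assms(1)] kernel_onE[OF assms(2)] by metis
  show ?thesis unfolding conv_def
  proof (rule continuous_on_infsum_dominated)
    show "(\<lambda>\<eta>. (C * D * dx ^ CARD('d)) * (env 1 (\<alpha> - \<eta>) * env 1 (\<eta> - \<beta>))) summable_on UNIV"
      by (intro summable_on_cmult_right env_conv) auto
    fix \<eta>
    have "continuous_on (S \<times> S') (\<lambda>x. F (fst x) \<alpha> \<eta>)"
      by (rule continuous_on_compose2[OF kernel_on_continuous[OF assms(1)] continuous_on_fst[OF continuous_on_id]]) auto
    moreover have "continuous_on (S \<times> S') (\<lambda>x. H (snd x) \<eta> \<beta>)"
      by (rule continuous_on_compose2[OF kernel_on_continuous[OF assms(2)] continuous_on_snd[OF continuous_on_id]]) auto
    ultimately show "continuous_on (S \<times> S') (\<lambda>x. F (fst x) \<alpha> \<eta> * H (snd x) \<eta> \<beta> * dx ^ CARD('d))"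
      by (intro continuous_intros)
    fix x assume x: "x \<in> S \<times> S'"
    have "\<bar>F (fst x) \<alpha> \<eta>\<bar> * \<bar>H (snd x) \<eta> \<beta>\<bar> * dx ^ CARD('d) \<le> (C * env 1 (\<alpha> - \<eta>)) * (D * env 1 (\<eta> - \<beta>)) * dx ^ CARD('d)"
      using x C D assms(3) env_nonneg[of 1] by (intro mult_mono mult_nonneg_nonneg) auto
    then show "norm (F (fst x) \<alpha> \<eta> * H (snd x) \<eta> \<beta> * dx ^ CARD('d)) \<le> (C * D * dx ^ CARD('d)) * (env 1 (\<alpha> - \<eta>) * env 1 (\<eta> - \<beta>))"
      using assms(3) by (simp add: abs_mult mult_ac)
  qed
qed

lemma kernel_on_conv_continuous':
  assumes "kernel_on S F" "kernel_on S' H" "0 \<le> dx" "continuous_on A p" "continuous_on A q" "p ` A \<subseteq> S" "q ` A \<subseteq> S'"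
  shows "continuous_on A (\<lambda>x. conv dx (F (p x)) (H (q x)) \<alpha> \<beta>)"
proof -
  have "continuous_on A (\<lambda>x. (p x, q x))" using assms by (intro continuous_on_Pair)
  from continuous_on_compose2[OF kernel_on_conv_continuous[OF assms(1-3), of \<alpha> \<beta>] this] assms(6,7)
  show ?thesis by (auto simp: image_subset_iff)
qed

lemma kernel_on_conv_add:
  assumes "kernel_on S F" "kernel_on S' H" "kernel_on S' J" "u \<in> S" "v \<in> S'"
  shows "conv dx (F u) (\<lambda>\<alpha> \<beta>. H v \<alpha> \<beta> + J v \<alpha> \<beta>) \<alpha> \<beta> = conv dx (F u) (H v) \<alpha> \<beta> + conv dx (F u) (J v) \<alpha> \<beta>"
  using kernel_on_conv_summable[OF assms(1,2,4,5)] kernel_on_conv_summable[OF assms(1,3,4,5)]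
  unfolding conv_def distrib_left distrib_right conv_summable_def
  by (intro infsum_add summable_on_cmult_left) auto

text \<open>
  Convolution in space and time. Each step from \<open>K\<^sup>(\<^sup>m\<^sup>)\<close> to \<open>K\<^sup>(\<^sup>m\<^sup>+\<^sup>1\<^sup>)\<close> is such a convolution,
  and so is the correction term of the fundamental solution.
\<close>

definition tconv :: "real \<Rightarrow> (real \<Rightarrow> int ^ 'd::finite \<Rightarrow> int ^ 'd \<Rightarrow> real) \<Rightarrow> (real \<Rightarrow> int ^ 'd \<Rightarrow> int ^ 'd \<Rightarrow> real)
    \<Rightarrow> real \<Rightarrow> int ^ 'd \<Rightarrow> int ^ 'd \<Rightarrow> real" where
  "tconv dx F H t \<alpha> \<beta> = integral {0..t} (\<lambda>s. conv dx (F (t - s)) (H s) \<alpha> \<beta>)"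

lemma tconv_integrand_continuous:
  assumes "kernel_on {0..T} F" "kernel_on {0..T} H" "0 \<le> dx" "t \<in> {0..T}"
  shows "continuous_on {0..t} (\<lambda>s. conv dx (F (t - s)) (H s) \<alpha> \<beta>)"
  using assms by (intro kernel_on_conv_continuous'[OF assms(1,2)] continuous_intros) auto

lemma tconv_integrable:
  assumes "kernel_on {0..T} F" "kernel_on {0..T} H" "0 \<le> dx" "t \<in> {0..T}"
  shows "(\<lambda>s. conv dx (F (t - s)) (H s) \<alpha> \<beta>) integrable_on {0..t}"
  using tconv_integrand_continuous[OF assms] by (rule integrable_continuous_real)

lemma tconv_bound:
  fixes F :: "real \<Rightarrow> int ^ 'd::finite \<Rightarrow> int ^ 'd \<Rightarrow> real"
  assumes "kernel_on {0..T} F" "kernel_on {0..T} H" "0 \<le> dx" "t \<in> {0..T}" "0 \<le> f" "0 \<le> g"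
    and "\<And>t \<alpha> \<beta>. t \<in> {0..T} \<Longrightarrow> \<bar>F t \<alpha> \<beta>\<bar> \<le> f * env 1 (\<alpha> - \<beta>)"
    and "\<And>t \<alpha> \<beta>. t \<in> {0..T} \<Longrightarrow> \<bar>H t \<alpha> \<beta>\<bar> \<le> g * env 1 (\<alpha> - \<beta>)"
  shows "\<bar>tconv dx F H t \<alpha> \<beta>\<bar> \<le> T * (dx * (32 * (1 + pi))) ^ CARD('d) * f * g * env 1 (\<alpha> - \<beta>)"
proof -
  let ?M = "(dx * (32 * (1 + pi))) ^ CARD('d) * f * g * env 1 (\<alpha> - \<beta>)"
  have M: "0 \<le> ?M" using assms env_nonneg[of 1] by (intro mult_nonneg_nonneg) auto
  have "norm (integral {0..t} (\<lambda>s. conv dx (F (t - s)) (H s) \<alpha> \<beta>)) \<le> integral {0..t} (\<lambda>s. ?M)"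
  proof (rule integral_norm_bound_integral)
    fix s assume "s \<in> {0..t}"
    then show "norm (conv dx (F (t - s)) (H s) \<alpha> \<beta>) \<le> ?M"
      unfolding real_norm_def using assms by (intro kernel_on_conv_bound) auto
  qed (use assms in \<open>auto intro: tconv_integrable\<close>)
  also have "\<dots> = t * ?M" using assms(4) by simp
  also have "\<dots> \<le> T * ?M" using assms(4) by (intro mult_right_mono M) auto
  finally show ?thesis by (simp add: tconv_def mult.assoc)
qed

text \<open>
  The substitution \<open>s = t x\<close> moves \<open>t\<close> from the domain of integration into the integrand.
\<close>

lemma continuous_on_convolution_integral:
  fixes \<phi> :: "real \<Rightarrow> real \<Rightarrow> real"
  assumes "continuous_on ({0..T} \<times> {0..T}) (\<lambda>x. \<phi> (fst x) (snd x))"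
  shows "continuous_on {0..T} (\<lambda>t. integral {0..t} (\<lambda>s. \<phi> (t - s) s))"
proof -
  have stretch: "integral {0..t} (\<lambda>s. \<phi> (t - s) s) = integral (cbox 0 1) (\<lambda>x. t * \<phi> (t - t * x) (t * x))" if "t \<in> {0..T}" for t
  proof -
    have "continuous_on {0..t} (\<lambda>s. \<phi> (t - s) s)"
      using that by (intro continuous_on_compose2[OF assms, of _ "\<lambda>s. (t - s, s)", simplified] continuous_intros) auto
    then have "((\<lambda>x. t *\<^sub>R \<phi> (t - t * x) (t * x)) has_integral integral {t * 0..t * 1} (\<lambda>s. \<phi> (t - s) s)) {0..1}"
      using that
      by (intro has_integral_substitution[where c = 0 and d = t and f = "\<lambda>s. \<phi> (t - s) s" and g = "\<lambda>x. t * x"])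
         (auto intro!: derivative_eq_intros continuous_intros simp: mult_left_le)
    from integral_unique[OF this, symmetric] show ?thesis by simp
  qed
  have "continuous_on ({0..T} \<times> cbox 0 1) (\<lambda>(t, x). t * \<phi> (t - t * x) (t * x))"
    unfolding split_beta
  proof (intro continuous_intros continuous_on_compose2[OF assms, of _ "\<lambda>p. (fst p - fst p * snd p, fst p * snd p)", simplified])
    have "0 \<le> a - a * b \<and> a - a * b \<le> T \<and> 0 \<le> a * b \<and> a * b \<le> T" if "0 \<le> a" "a \<le> T" "0 \<le> b" "b \<le> 1" for a b :: real
    proof -
      have "0 \<le> a * b" "a * b \<le> a" using that by (simp_all add: mult_left_le)
      then show ?thesis using that by linarith
    qed
    then show "(\<lambda>x. (fst x - fst x * snd x, fst x * snd x)) ` ({0..T} \<times> cbox 0 1) \<subseteq> {0..T} \<times> {0..T}"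
      by (auto simp: image_subset_iff)
  qed
  then have "continuous_on {0..T} (\<lambda>t. integral (cbox 0 1) (\<lambda>x. t * \<phi> (t - t * x) (t * x)))"
    by (rule integral_continuous_on_param)
  then show ?thesis by (rule continuous_on_eq) (simp add: stretch)
qed

lemma kernel_on_tconv:
  assumes "kernel_on {0..T} F" "kernel_on {0..T} H" "0 \<le> dx"
  shows "kernel_on {0..T} (tconv dx F H)"
proof -
  obtain C D where C: "0 \<le> C" "\<And>t \<alpha> \<beta>. t \<in> {0..T} \<Longrightarrow> \<bar>F t \<alpha> \<beta>\<bar> \<le> C * env 1 (\<alpha> - \<beta>)"
    and D: "0 \<le> D" "\<And>t \<alpha> \<beta>. t \<in> {0..T} \<Longrightarrow> \<bar>H t \<alpha> \<beta>\<bar> \<le> D * env 1 (\<alpha> - \<beta>)"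
    using kernel_onE[OF assms(1)] kernel_onE[OF assms(2)] by metis
  have "continuous_on {0..T} (\<lambda>t. tconv dx F H t \<alpha> \<beta>)" for \<alpha> \<beta>
    unfolding tconv_def
    by (rule continuous_on_convolution_integral[OF kernel_on_conv_continuous[OF assms, of \<alpha> \<beta>]])
  moreover have "\<bar>tconv dx F H t \<alpha> \<beta>\<bar> \<le> T * (dx * (32 * (1 + pi))) ^ CARD('a) * C * D * env 1 (\<alpha> - \<beta>)" if "t \<in> {0..T}" for t \<alpha> \<beta>
    using assms that C D by (intro tconv_bound) auto
  ultimately show ?thesis unfolding kernel_on_def by blast
qed

lemma tconv_add:
  assumes "kernel_on {0..T} F" "kernel_on {0..T} H" "kernel_on {0..T} J" "0 \<le> dx" "t \<in> {0..T}"
  shows "tconv dx F (\<lambda>t \<alpha> \<beta>. H t \<alpha> \<beta> + J t \<alpha> \<beta>) t \<alpha> \<beta> = tconv dx F H t \<alpha> \<beta> + tconv dx F J t \<alpha> \<beta>"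
proof -
  have "tconv dx F (\<lambda>t \<alpha> \<beta>. H t \<alpha> \<beta> + J t \<alpha> \<beta>) t \<alpha> \<beta> =
      integral {0..t} (\<lambda>s. conv dx (F (t - s)) (H s) \<alpha> \<beta> + conv dx (F (t - s)) (J s) \<alpha> \<beta>)"
    unfolding tconv_def using assms by (intro integral_cong kernel_on_conv_add) auto
  also have "\<dots> = tconv dx F H t \<alpha> \<beta> + tconv dx F J t \<alpha> \<beta>"
    unfolding tconv_def using assms by (intro integral_add tconv_integrable) auto
  finally show ?thesis .
qed

section \<open>The Volterra equation\<close>

lemma Kiter_Suc_Suc: "Kiter dx c (Suc (Suc m)) = tconv dx (Kker dx c) (Kiter dx c (Suc m))"
  by (intro ext) (simp add: tconv_def)

lemma kernel_on_Kiter: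
  assumes "kernel_on {0..T} (Kker dx c)" "0 \<le> dx"
  shows "kernel_on {0..T} (Kiter dx c (Suc m))"
  using assms by (induction m) (simp_all only: Kiter_Suc_Suc kernel_on_tconv Kiter.simps(2))

lemma integral_exp_scaled:
  fixes l t :: real
  assumes "0 < l" "0 \<le> t"
  shows "((\<lambda>s. exp (l * s)) has_integral (exp (l * t) - 1) / l) {0..t}"
proof -
  have "((\<lambda>s. exp (l * s)) has_integral (exp (l * t) / l - exp (l * 0) / l)) {0..t}"
    using assms
    by (intro fundamental_theorem_of_calculus[where f = "\<lambda>s. exp (l * s) / l"])
       (auto intro!: derivative_eq_intros simp: has_real_derivative_iff_has_vector_derivative[symmetric])
  then show ?thesis by (simp add: diff_divide_distrib)
qed

text \<open>
  Against the weight \<open>e\<^sup>l\<^sup>t\<close>, convolution with the bounded kernel \<open>K\<close> has norm of order \<open>1 / l\<close>.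
  For \<open>l\<close> large it is a contraction with factor one half.
\<close>

lemma Kiter_geometric_bound:
  fixes c :: "'d::finite \<Rightarrow> int ^ 'd \<Rightarrow> real"
  assumes K: "kernel_on {0..T} (Kker dx c)" and "0 \<le> dx"
  obtains C where "0 \<le> C"
    "\<And>m t \<alpha> \<beta>. t \<in> {0..T} \<Longrightarrow> \<bar>Kiter dx c (Suc m) t \<alpha> \<beta>\<bar> \<le> C * (1/2) ^ m * env 1 (\<alpha> - \<beta>)"
proof -
  obtain k where k: "0 \<le> k" "\<And>t \<alpha> \<beta>. t \<in> {0..T} \<Longrightarrow> \<bar>Kker dx c t \<alpha> \<beta>\<bar> \<le> k * env 1 (\<alpha> - \<beta>)"
    using kernel_onE[OF K] by metis
  define D where "D = (dx * (32 * (1 + pi))) ^ CARD('d)"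
  have D: "0 \<le> D" using assms by (simp add: D_def)
  \<comment> \<open>The factor \<open>D * k / l\<close> gained in each step is at most one half.\<close>
  define l where "l = 2 * D * k + 1"
  have l: "0 < l" using D k by (simp add: l_def add_nonneg_pos)
  have main: "\<bar>Kiter dx c (Suc m) t \<alpha> \<beta>\<bar> \<le> k * (1/2) ^ m * exp (l * t) * env 1 (\<alpha> - \<beta>)" if "t \<in> {0..T}" for m t \<alpha> \<beta>
    using that
  proof (induction m arbitrary: t \<alpha> \<beta>)
    case (0 t \<alpha> \<beta>)
    have "\<bar>Kker dx c t \<alpha> \<beta>\<bar> \<le> k * env 1 (\<alpha> - \<beta>)" using k 0 by auto
    also have "\<dots> \<le> k * exp (l * t) * env 1 (\<alpha> - \<beta>)"
      using k l 0 mult_left_mono[of 1 "exp (l * t)" k] by (intro mult_right_mono env_nonneg) auto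
    finally show ?case by simp
  next
    case (Suc m t \<alpha> \<beta>)
    let ?e = "env 1 (\<alpha> - \<beta>)"
    let ?q = "D * k * (k * (1/2) ^ m) * ?e"
    have e: "0 \<le> ?e" by (intro env_nonneg) simp
    have q: "0 \<le> ?q" using D k e by (intro mult_nonneg_nonneg) auto
    have hi: "((\<lambda>s. ?q * exp (l * s)) has_integral ?q * ((exp (l * t) - 1) / l)) {0..t}"
      using Suc.prems l by (intro has_integral_mult_right integral_exp_scaled) auto
    have "norm (tconv dx (Kker dx c) (Kiter dx c (Suc m)) t \<alpha> \<beta>) \<le> integral {0..t} (\<lambda>s. ?q * exp (l * s))"
      unfolding tconv_def
    proof (rule integral_norm_bound_integral)
      show "(\<lambda>s. conv dx (Kker dx c (t - s)) (Kiter dx c (Suc m) s) \<alpha> \<beta>) integrable_on {0..t}"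
        using Suc.prems assms by (intro tconv_integrable[OF K kernel_on_Kiter]) auto
      show "(\<lambda>s. ?q * exp (l * s)) integrable_on {0..t}" using hi by blast
      fix s assume s: "s \<in> {0..t}"
      have "\<bar>conv dx (Kker dx c (t - s)) (Kiter dx c (Suc m) s) \<alpha> \<beta>\<bar> \<le> (dx * (32 * (1 + pi))) ^ CARD('d) * k * (k * (1/2) ^ m * exp (l * s)) * ?e"
        using s Suc.prems k assms by (intro kernel_on_conv_bound Suc.IH) auto
      then show "norm (conv dx (Kker dx c (t - s)) (Kiter dx c (Suc m) s) \<alpha> \<beta>) \<le> ?q * exp (l * s)"
        unfolding D_def[symmetric] by (simp add: mult_ac)
    qed
    also have "\<dots> = ?q * ((exp (l * t) - 1) / l)" using hi by (rule integral_unique)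
    also have "\<dots> \<le> ?q * (exp (l * t) / l)" using q l by (intro mult_left_mono divide_right_mono) auto
    also have "\<dots> = (D * k / l) * (k * (1/2) ^ m * exp (l * t) * ?e)" by simp
    also have "\<dots> \<le> (1/2) * (k * (1/2) ^ m * exp (l * t) * ?e)"
    proof (intro mult_right_mono)
      show "D * k / l \<le> 1 / 2" using l D k by (simp add: l_def divide_le_eq)
    qed (use k e in auto)
    finally show ?case by (simp only: Kiter_Suc_Suc) simp
  qed
  show ?thesis
  proof (rule that)
    show "0 \<le> k * exp (l * T)" using k by simp
    fix m t and \<alpha> \<beta> :: "int ^ 'd" assume t: "t \<in> {0..T}"
    have "k * (1/2) ^ m * exp (l * t) * env 1 (\<alpha> - \<beta>) \<le> k * (1/2) ^ m * exp (l * T) * env 1 (\<alpha> - \<beta>)"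
      using t k l by (intro mult_right_mono mult_left_mono env_nonneg) auto
    with main[OF t, of m \<alpha> \<beta>] show "\<bar>Kiter dx c (Suc m) t \<alpha> \<beta>\<bar> \<le> k * exp (l * T) * (1/2) ^ m * env 1 (\<alpha> - \<beta>)"
      by (simp add: mult_ac)
  qed
qed

text \<open>
  Stated for fixed arguments, because the series is compared with the envelope at time one and
  with the one at time \<open>t\<close>.
\<close>

lemma Phi_tail:
  fixes c :: "'d::finite \<Rightarrow> int ^ 'd \<Rightarrow> real"
  assumes b: "\<And>m. \<bar>Kiter dx c (Suc m) t \<alpha> \<beta>\<bar> \<le> C * (1/2) ^ m * e"
  shows "summable (\<lambda>m. Kiter dx c (Suc m) t \<alpha> \<beta>)"
    and "\<bar>Phi dx c t \<alpha> \<beta> - (\<Sum>m<M. Kiter dx c (Suc m) t \<alpha> \<beta>)\<bar> \<le> 2 * C * (1/2) ^ M * e"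
proof -
  have g: "summable (\<lambda>m. C * (1/2) ^ m * e)"
    by (intro summable_mult summable_mult2 summable_geometric) auto
  show s: "summable (\<lambda>m. Kiter dx c (Suc m) t \<alpha> \<beta>)"
    by (rule summable_comparison_test'[OF g]) (use b in auto)
  have n: "summable (\<lambda>m. norm (Kiter dx c (Suc (m + M)) t \<alpha> \<beta>))"
    by (rule summable_comparison_test'[OF summable_ignore_initial_segment[OF g, of M]]) (use b in auto)
  have "Phi dx c t \<alpha> \<beta> - (\<Sum>m<M. Kiter dx c (Suc m) t \<alpha> \<beta>) = (\<Sum>m. Kiter dx c (Suc (m + M)) t \<alpha> \<beta>)"
    unfolding Phi_def using suminf_minus_initial_segment[OF s, of M] by simp
  also have "\<bar>\<dots>\<bar> \<le> (\<Sum>m. norm (Kiter dx c (Suc (m + M)) t \<alpha> \<beta>))"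
    using summable_norm[OF n] by simp
  also have "\<dots> \<le> (\<Sum>m. C * (1/2) ^ (m + M) * e)"
    by (rule suminf_le[OF _ n summable_ignore_initial_segment[OF g]]) (use b in auto)
  also have "\<dots> = (C * (1/2) ^ M * e) * (\<Sum>m. (1/2) ^ m)"
    by (subst suminf_mult[symmetric]) (auto simp: power_add mult_ac intro: summable_geometric)
  also have "(\<Sum>m. (1/2 :: real) ^ m) = 2" by (simp add: suminf_geometric)
  finally show "\<bar>Phi dx c t \<alpha> \<beta> - (\<Sum>m<M. Kiter dx c (Suc m) t \<alpha> \<beta>)\<bar> \<le> 2 * C * (1/2) ^ M * e"
    by (simp add: mult_ac)
qed

lemma kernel_on_remainder:
  assumes K: "kernel_on {0..T} (Kker dx c)" and "0 \<le> dx"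
  shows "kernel_on {0..T} (\<lambda>t \<alpha> \<beta>. Phi dx c t \<alpha> \<beta> - (\<Sum>m<M. Kiter dx c (Suc m) t \<alpha> \<beta>))"
proof -
  obtain C where C: "0 \<le> C" and b: "\<And>m t \<alpha> \<beta>. t \<in> {0..T} \<Longrightarrow> \<bar>Kiter dx c (Suc m) t \<alpha> \<beta>\<bar> \<le> C * (1/2) ^ m * env 1 (\<alpha> - \<beta>)"
    using Kiter_geometric_bound[OF assms] by metis
  have cont: "continuous_on {0..T} (\<lambda>t. Kiter dx c (Suc m) t \<alpha> \<beta>)" for m \<alpha> \<beta>
    by (rule kernel_on_continuous[OF kernel_on_Kiter[OF assms]])
  have "continuous_on {0..T} (\<lambda>t. Phi dx c t \<alpha> \<beta>)" for \<alpha> \<beta>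
  proof (rule uniform_limit_theorem[where F = sequentially and f = "\<lambda>M t. \<Sum>m<M. Kiter dx c (Suc m) t \<alpha> \<beta>"])
    show "\<forall>\<^sub>F M in sequentially. continuous_on {0..T} (\<lambda>t. \<Sum>m<M. Kiter dx c (Suc m) t \<alpha> \<beta>)"
      by (intro always_eventually allI continuous_on_sum cont)
    show "uniform_limit {0..T} (\<lambda>M t. \<Sum>m<M. Kiter dx c (Suc m) t \<alpha> \<beta>) (\<lambda>t. Phi dx c t \<alpha> \<beta>) sequentially"
      unfolding Phi_def
    proof (rule Weierstrass_m_test)
      show "summable (\<lambda>m. C * (1/2) ^ m * env 1 (\<alpha> - \<beta>))"
        by (intro summable_mult summable_mult2 summable_geometric) auto
    qed (use b in auto)
  qed simp
  then have "continuous_on {0..T} (\<lambda>t. Phi dx c t \<alpha> \<beta> - (\<Sum>m<M. Kiter dx c (Suc m) t \<alpha> \<beta>))" for \<alpha> \<beta>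
    by (intro continuous_on_diff continuous_on_sum cont)
  moreover have "\<bar>Phi dx c t \<alpha> \<beta> - (\<Sum>m<M. Kiter dx c (Suc m) t \<alpha> \<beta>)\<bar> \<le> 2 * C * (1/2) ^ M * env 1 (\<alpha> - \<beta>)"
    if "t \<in> {0..T}" for t \<alpha> \<beta>
    by (rule Phi_tail(2)) (rule b[OF that])
  ultimately show ?thesis unfolding kernel_on_def by blast
qed

lemma kernel_on_Phi:
  assumes "kernel_on {0..T} (Kker dx c)" "0 \<le> dx"
  shows "kernel_on {0..T} (Phi dx c)"
  using kernel_on_remainder[OF assms, of 0] by simp

lemma Phi_summable:
  assumes "kernel_on {0..T} (Kker dx c)" "0 \<le> dx" "t \<in> {0..T}"
  shows "summable (\<lambda>m. Kiter dx c (Suc m) t \<alpha> \<beta>)"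
  using Kiter_geometric_bound[OF assms(1,2)] Phi_tail(1) assms(3) by metis

text \<open>
  Up to the term \<open>K\<close>, convolution with \<open>K\<close> shifts the partial sums of the series by one. The
  remainders tend to zero and so do their convolutions with \<open>K\<close>.
\<close>

lemma Phi_Volterra:
  fixes c :: "'d::finite \<Rightarrow> int ^ 'd \<Rightarrow> real"
  assumes K: "kernel_on {0..T} (Kker dx c)" and dx: "0 \<le> dx" and t: "t \<in> {0..T}"
  shows "Phi dx c t \<alpha> \<beta> = Kker dx c t \<alpha> \<beta> + tconv dx (Kker dx c) (Phi dx c) t \<alpha> \<beta>"
proof -
  define R where "R M t \<alpha> \<beta> = Phi dx c t \<alpha> \<beta> - (\<Sum>m<M. Kiter dx c (Suc m) t \<alpha> \<beta>)" for M t \<alpha> \<beta>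
  have kR: "kernel_on {0..T} (R M)" for M
    unfolding R_def[abs_def] by (rule kernel_on_remainder[OF K dx])
  obtain C where C: "0 \<le> C" and b: "\<And>m t \<alpha> \<beta>. t \<in> {0..T} \<Longrightarrow> \<bar>Kiter dx c (Suc m) t \<alpha> \<beta>\<bar> \<le> C * (1/2) ^ m * env 1 (\<alpha> - \<beta>)"
    using Kiter_geometric_bound[OF K dx] by metis
  obtain k where k: "0 \<le> k" "\<And>t \<alpha> \<beta>. t \<in> {0..T} \<Longrightarrow> \<bar>Kker dx c t \<alpha> \<beta>\<bar> \<le> k * env 1 (\<alpha> - \<beta>)"
    using kernel_onE[OF K] by metis
  have Rb: "\<bar>R M t \<alpha> \<beta>\<bar> \<le> 2 * C * (1/2) ^ M * env 1 (\<alpha> - \<beta>)" if "t \<in> {0..T}" for M t \<alpha> \<beta>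
    unfolding R_def by (rule Phi_tail(2)) (rule b[OF that])
  have split: "tconv dx (Kker dx c) (Phi dx c) t \<alpha> \<beta> =
      (\<Sum>m<M. Kiter dx c (Suc (Suc m)) t \<alpha> \<beta>) + tconv dx (Kker dx c) (R M) t \<alpha> \<beta>" for M
  proof (induction M)
    case 0
    have "R 0 = Phi dx c" by (intro ext) (simp add: R_def)
    then show ?case by simp
  next
    case (Suc M)
    have "R M = (\<lambda>t \<alpha> \<beta>. Kiter dx c (Suc M) t \<alpha> \<beta> + R (Suc M) t \<alpha> \<beta>)"
      by (intro ext) (simp add: R_def)
    then have "tconv dx (Kker dx c) (R M) t \<alpha> \<beta> =
        tconv dx (Kker dx c) (\<lambda>t \<alpha> \<beta>. Kiter dx c (Suc M) t \<alpha> \<beta> + R (Suc M) t \<alpha> \<beta>) t \<alpha> \<beta>"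
      by (rule arg_cong)
    also have "\<dots> = tconv dx (Kker dx c) (Kiter dx c (Suc M)) t \<alpha> \<beta> + tconv dx (Kker dx c) (R (Suc M)) t \<alpha> \<beta>"
      by (rule tconv_add[OF K kernel_on_Kiter[OF K dx] kR dx t])
    finally show ?case using Suc.IH by (simp only: Kiter_Suc_Suc sum.lessThan_Suc add.assoc)
  qed
  \<comment> \<open>The error made by truncating both sides after \<open>M\<close> terms.\<close>
  define e where "e M = T * (dx * (32 * (1 + pi))) ^ CARD('d) * k * (2 * C * (1/2) ^ M) * env 1 (\<alpha> - \<beta>) + 2 * C * (1/2) ^ Suc M * env 1 (\<alpha> - \<beta>)" for M
  have "\<bar>Phi dx c t \<alpha> \<beta> - (Kker dx c t \<alpha> \<beta> + tconv dx (Kker dx c) (Phi dx c) t \<alpha> \<beta>)\<bar> \<le> e M" for M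
  proof -
    have 1: "(\<Sum>m<Suc M. Kiter dx c (Suc m) t \<alpha> \<beta>) = Kker dx c t \<alpha> \<beta> + (\<Sum>m<M. Kiter dx c (Suc (Suc m)) t \<alpha> \<beta>)"
      by (subst sum.lessThan_Suc_shift) (simp only: Kiter.simps(2))
    have 2: "\<bar>tconv dx (Kker dx c) (R M) t \<alpha> \<beta>\<bar> \<le> T * (dx * (32 * (1 + pi))) ^ CARD('d) * k * (2 * C * (1/2) ^ M) * env 1 (\<alpha> - \<beta>)"
      using C by (intro tconv_bound[OF K kR dx t]) (use k Rb in auto)
    have "Phi dx c t \<alpha> \<beta> - (Kker dx c t \<alpha> \<beta> + tconv dx (Kker dx c) (Phi dx c) t \<alpha> \<beta>) =
        R (Suc M) t \<alpha> \<beta> - tconv dx (Kker dx c) (R M) t \<alpha> \<beta>"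
      unfolding split[of M] using 1 unfolding R_def by linarith
    then show ?thesis using 2 Rb[OF t, of "Suc M" \<alpha> \<beta>] unfolding e_def by linarith
  qed
  moreover have "e \<longlonglongrightarrow> T * (dx * (32 * (1 + pi))) ^ CARD('d) * k * (2 * C * 0) * env 1 (\<alpha> - \<beta>) + 2 * C * 0 * env 1 (\<alpha> - \<beta>)"
    unfolding e_def by (intro tendsto_intros LIMSEQ_power_zero LIMSEQ_Suc[OF LIMSEQ_power_zero]) auto
  ultimately have "\<bar>Phi dx c t \<alpha> \<beta> - (Kker dx c t \<alpha> \<beta> + tconv dx (Kker dx c) (Phi dx c) t \<alpha> \<beta>)\<bar> \<le> 0"
    by (intro Lim_bounded2[of e _ 0 "\<bar>Phi dx c t \<alpha> \<beta> - (Kker dx c t \<alpha> \<beta> + tconv dx (Kker dx c) (Phi dx c) t \<alpha> \<beta>)\<bar>"]) auto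
  then show ?thesis by simp
qed


section \<open>Time derivatives of convolutions\<close>

text \<open>
  The sum and the integral of the derivative may be exchanged, by domination; the fundamental
  theorem of calculus does the rest.
\<close>

lemma conv_has_derivative:
  fixes F F' :: "real \<Rightarrow> int ^ 'd::finite \<Rightarrow> int ^ 'd \<Rightarrow> real"
  assumes kF: "kernel_on {a..b} F" and kF': "kernel_on {a..b} F'" and kH: "kernel_on S H" and "0 \<le> dx"
    and deriv: "\<And>t \<alpha> \<beta>. t \<in> {a..b} \<Longrightarrow> ((\<lambda>t. F t \<alpha> \<beta>) has_real_derivative F' t \<alpha> \<beta>) (at t within {a..b})"
    and t: "t \<in> {a..b}" and v: "v \<in> S"
  shows "((\<lambda>t. conv dx (F t) (H v) \<alpha> \<beta>) has_real_derivative conv dx (F' t) (H v) \<alpha> \<beta>) (at t within {a..b})"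
proof -
  obtain C D where C: "0 \<le> C" "\<And>t \<alpha> \<beta>. t \<in> {a..b} \<Longrightarrow> \<bar>F' t \<alpha> \<beta>\<bar> \<le> C * env 1 (\<alpha> - \<beta>)"
    and D: "0 \<le> D" "\<And>t \<alpha> \<beta>. t \<in> S \<Longrightarrow> \<bar>H t \<alpha> \<beta>\<bar> \<le> D * env 1 (\<alpha> - \<beta>)"
    using kernel_onE[OF kF'] kernel_onE[OF kH] by metis
  have cc: "continuous_on {a..b} (\<lambda>x. conv dx (F' x) (H v) \<alpha> \<beta>)"
    using v assms by (intro kernel_on_conv_continuous'[OF kF' kH] continuous_intros) auto
  have eq: "conv dx (F u) (H v) \<alpha> \<beta> = conv dx (F a) (H v) \<alpha> \<beta> + integral {a..u} (\<lambda>x. conv dx (F' x) (H v) \<alpha> \<beta>)"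
    if u: "u \<in> {a..b}" for u
  proof -
    let ?f = "\<lambda>\<eta> x. F' x \<alpha> \<eta> * H v \<eta> \<beta> * dx ^ CARD('d)"
    have hs: "((\<lambda>\<eta>. integral {a..u} (?f \<eta>)) has_sum integral {a..u} (\<lambda>x. \<Sum>\<^sub>\<infinity>\<eta>. ?f \<eta> x)) UNIV"
    proof (rule has_sum_integral_dominated)
      show "(\<lambda>\<eta>. (C * D * dx ^ CARD('d)) * (env 1 (\<alpha> - \<eta>) * env 1 (\<eta> - \<beta>))) summable_on UNIV"
        by (intro summable_on_cmult_right env_conv) auto
      fix \<eta>
      show "continuous_on {a..u} (?f \<eta>)"
        using u by (intro continuous_intros continuous_on_subset[OF kernel_on_continuous[OF kF']]) auto
      fix x assume x: "x \<in> {a..u}"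
      have "\<bar>F' x \<alpha> \<eta>\<bar> * \<bar>H v \<eta> \<beta>\<bar> * dx ^ CARD('d) \<le> (C * env 1 (\<alpha> - \<eta>)) * (D * env 1 (\<eta> - \<beta>)) * dx ^ CARD('d)"
        using x u v C D assms(4) env_nonneg[of 1] by (intro mult_mono mult_nonneg_nonneg) auto
      then show "norm (?f \<eta> x) \<le> (C * D * dx ^ CARD('d)) * (env 1 (\<alpha> - \<eta>) * env 1 (\<eta> - \<beta>))"
        using assms(4) by (simp add: abs_mult mult_ac)
    qed
    have ints: "integral {a..u} (?f \<eta>) = F u \<alpha> \<eta> * H v \<eta> \<beta> * dx ^ CARD('d) - F a \<alpha> \<eta> * H v \<eta> \<beta> * dx ^ CARD('d)" for \<eta>
    proof (rule integral_unique, rule fundamental_theorem_of_calculus)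
      fix x assume "x \<in> {a..u}"
      then have "((\<lambda>t. F t \<alpha> \<eta>) has_real_derivative F' x \<alpha> \<eta>) (at x within {a..u})"
        using deriv[of x \<alpha> \<eta>] u by (auto intro: DERIV_subset)
      from DERIV_cmult_right[OF DERIV_cmult_right[OF this]]
      show "((\<lambda>t. F t \<alpha> \<eta> * H v \<eta> \<beta> * dx ^ CARD('d)) has_vector_derivative ?f \<eta> x) (at x within {a..u})"
        by (simp only: has_real_derivative_iff_has_vector_derivative)
    qed (use u in auto)
    have hs2: "((\<lambda>\<eta>. F u \<alpha> \<eta> * H v \<eta> \<beta> * dx ^ CARD('d) - F a \<alpha> \<eta> * H v \<eta> \<beta> * dx ^ CARD('d)) has_sum
        (conv dx (F u) (H v) \<alpha> \<beta> - conv dx (F a) (H v) \<alpha> \<beta>)) UNIV"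
    proof -
      have "((\<lambda>\<eta>. F w \<alpha> \<eta> * H v \<eta> \<beta> * dx ^ CARD('d)) has_sum conv dx (F w) (H v) \<alpha> \<beta>) UNIV" if "w \<in> {a..b}" for w
        using kernel_on_conv_summable[OF kF kH that v] unfolding conv_def conv_summable_def
        by (intro has_sum_infsum summable_on_cmult_left) auto
      from has_sum_add[OF this has_sum_cmult_right[OF this, of a "-1"], of u] show ?thesis using u by simp
    qed
    have "integral {a..u} (\<lambda>x. \<Sum>\<^sub>\<infinity>\<eta>. ?f \<eta> x) = conv dx (F u) (H v) \<alpha> \<beta> - conv dx (F a) (H v) \<alpha> \<beta>"
      by (rule has_sum_unique[OF hs[unfolded ints] hs2])
    then show ?thesis unfolding conv_def by linarith
  qed
  have "((\<lambda>u. conv dx (F a) (H v) \<alpha> \<beta> + integral {a..u} (\<lambda>x. conv dx (F' x) (H v) \<alpha> \<beta>)) has_real_derivative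
      0 + conv dx (F' t) (H v) \<alpha> \<beta>) (at t within {a..b})"
    by (intro DERIV_add DERIV_const integral_has_real_derivative cc t)
  then have "((\<lambda>u. conv dx (F a) (H v) \<alpha> \<beta> + integral {a..u} (\<lambda>x. conv dx (F' x) (H v) \<alpha> \<beta>)) has_real_derivative
      conv dx (F' t) (H v) \<alpha> \<beta>) (at t within {a..b})" by simp
  then show ?thesis
    by (rule has_field_derivative_transform_within[where d = 1]) (use t in \<open>auto intro: eq[symmetric]\<close>)
qed

text \<open>
  \<open>\<integral>\<^sub>0\<^sup>y F(x - s) H(s) ds\<close> is differentiable in \<open>x\<close> by Leibniz' rule and in \<open>y\<close> by the fundamental
  theorem; the claim is the derivative along the diagonal \<open>x = y\<close>. Off the diagonal \<open>x - s\<close> can be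
  negative, hence the symmetric time interval for \<open>F\<close>.
\<close>

lemma tconv_has_derivative:
  fixes F F' :: "real \<Rightarrow> int ^ 'd::finite \<Rightarrow> int ^ 'd \<Rightarrow> real"
  assumes kF: "kernel_on {-T..T} F" and kF': "kernel_on {-T..T} F'" and kH: "kernel_on {0..T} H" and dx: "0 \<le> dx"
    and deriv: "\<And>t \<alpha> \<beta>. t \<in> {-T..T} \<Longrightarrow> ((\<lambda>t. F t \<alpha> \<beta>) has_real_derivative F' t \<alpha> \<beta>) (at t within {-T..T})"
    and t: "t \<in> {0..T}"
  shows "((\<lambda>t. tconv dx F H t \<alpha> \<beta>) has_real_derivative
      tconv dx F' H t \<alpha> \<beta> + conv dx (F 0) (H t) \<alpha> \<beta>) (at t within {0..T})"
proof -
  define \<phi> where "\<phi> t s = conv dx (F (t - s)) (H s) \<alpha> \<beta>" for t s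
  define \<psi> where "\<psi> t s = conv dx (F' (t - s)) (H s) \<alpha> \<beta>" for t s
  have c\<phi>: "continuous_on ({0..T} \<times> {0..T}) (\<lambda>p. \<phi> (fst p) (snd p))"
    unfolding \<phi>_def by (intro kernel_on_conv_continuous'[OF kF kH dx] continuous_intros) auto
  have c\<psi>: "continuous_on ({0..T} \<times> {0..T}) (\<lambda>p. \<psi> (fst p) (snd p))"
    unfolding \<psi>_def by (intro kernel_on_conv_continuous'[OF kF' kH dx] continuous_intros) auto
  have c1: "continuous_on {0..T} (\<phi> t)" if "t \<in> {0..T}" for t
    using that by (intro continuous_on_compose2[OF c\<phi>, of _ "\<lambda>s. (t, s)", simplified] continuous_intros) auto
  have d\<phi>: "((\<lambda>t. \<phi> t s) has_real_derivative \<psi> t s) (at t within {0..T})" if "t \<in> {0..T}" "s \<in> {0..T}" for t s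
  proof -
    have "((\<lambda>t. conv dx (F t) (H s) \<alpha> \<beta>) has_real_derivative conv dx (F' (t - s)) (H s) \<alpha> \<beta>) (at (t - s) within (\<lambda>t. t - s) ` {0..T})"
      using that by (intro DERIV_subset[OF conv_has_derivative[OF kF kF' kH dx deriv]]) auto
    moreover have "((\<lambda>t. t - s) has_real_derivative 1) (at t within {0..T})"
      by (auto intro!: derivative_eq_intros)
    ultimately show ?thesis
      using DERIV_image_chain[of "\<lambda>t. conv dx (F t) (H s) \<alpha> \<beta>" _ "\<lambda>t. t - s"]
      unfolding \<phi>_def \<psi>_def o_def by fastforce
  qed
  have part: "((\<lambda>(x, y). integral {0..y} (\<phi> x)) has_derivative
      (\<lambda>(tx, ty). integral {0..t} (\<psi> t) * tx + blinfun_apply (blinfun_scaleR_left (\<phi> t t)) ty)) (at (t, t) within {0..T} \<times> {0..T})"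
  proof (rule has_derivative_partialsI[where fy = "\<lambda>x y. blinfun_scaleR_left (\<phi> x y)"])
    have "((\<lambda>x. integral (cbox 0 t) (\<phi> x)) has_field_derivative integral (cbox 0 t) (\<psi> t)) (at t within {0..T})"
    proof (rule leibniz_rule_field_derivative)
      fix x s assume "x \<in> {0..T}" "s \<in> cbox 0 t"
      then show "((\<lambda>x. \<phi> x s) has_field_derivative \<psi> x s) (at x within {0..T})" using t by (intro d\<phi>) auto
    next
      fix x assume "x \<in> {0..T}"
      then show "\<phi> x integrable_on cbox 0 t"
        using t by (auto intro!: integrable_continuous_real continuous_on_subset[OF c1])
    next
      show "continuous_on ({0..T} \<times> cbox 0 t) (\<lambda>(x, t). \<psi> x t)"
        using t unfolding split_beta by (intro continuous_on_subset[OF c\<psi>]) auto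
    qed (use t in auto)
    then show "((\<lambda>x. integral {0..t} (\<phi> x)) has_derivative (\<lambda>tx. integral {0..t} (\<psi> t) * tx)) (at t within {0..T})"
      by (simp add: has_field_derivative_def)
  next
    fix x y assume xy: "x \<in> {0..T}" "y \<in> {0..T}"
    have "((\<lambda>y. integral {0..y} (\<phi> x)) has_real_derivative \<phi> x y) (at y within {0..T})"
      using xy by (intro integral_has_real_derivative c1)
    moreover have "(*) (\<phi> x y) = blinfun_apply (blinfun_scaleR_left (\<phi> x y))"
      by (intro ext) (simp add: mult.commute)
    ultimately show "((\<lambda>y. integral {0..y} (\<phi> x)) has_derivative blinfun_apply (blinfun_scaleR_left (\<phi> x y))) (at y within {0..T})"
      by (simp only: has_field_derivative_def)
  next
    have "continuous_on ({0..T} \<times> {0..T}) (\<lambda>p. blinfun_scaleR_left (\<phi> (fst p) (snd p)))"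
      by (rule bounded_linear.continuous_on[OF bounded_linear_blinfun_scaleR_left c\<phi>])
    then show "continuous (at (t, t) within {0..T} \<times> {0..T}) (\<lambda>(x, y). blinfun_scaleR_left (\<phi> x y))"
      using t unfolding split_beta by (simp add: continuous_on_eq_continuous_within)
  qed (use t in auto)
  have diag: "((\<lambda>t. (t, t)) has_derivative (\<lambda>h. (h, h))) (at t within {0..T})"
    by (intro has_derivative_Pair has_derivative_ident)
  have "((\<lambda>t. case (t, t) of (x, y) \<Rightarrow> integral {0..y} (\<phi> x)) has_derivative
      (\<lambda>h. case (h, h) of (tx, ty) \<Rightarrow> integral {0..t} (\<psi> t) * tx + blinfun_apply (blinfun_scaleR_left (\<phi> t t)) ty)) (at t within {0..T})"
    by (rule has_derivative_in_compose[OF diag has_derivative_subset[OF part]]) (auto simp: image_subset_iff)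
  then have "((\<lambda>t. integral {0..t} (\<phi> t)) has_derivative (\<lambda>h. (integral {0..t} (\<psi> t) + \<phi> t t) * h)) (at t within {0..T})"
    by (simp add: algebra_simps)
  then have "((\<lambda>t. integral {0..t} (\<phi> t)) has_real_derivative integral {0..t} (\<psi> t) + \<phi> t t) (at t within {0..T})"
    by (simp only: has_field_derivative_def)
  then show ?thesis by (simp add: tconv_def \<phi>_def[abs_def] \<psi>_def[abs_def])
qed


section \<open>Bounded solutions of linear equations\<close>

text \<open>
  Iterating the integral equation gives \<open>\<bar>u t i\<bar> \<le> M (\<Lambda> t)\<^sup>k / k!\<close> for every \<open>k\<close>.
\<close>

lemma bounded_linear_ode_unique:
  fixes u D :: "real \<Rightarrow> 'i \<Rightarrow> real"
  assumes deriv: "\<And>t i. t \<in> {0..T} \<Longrightarrow> ((\<lambda>t. u t i) has_real_derivative D t i) (at t within {0..T})"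
    and bounded: "\<And>t i. t \<in> {0..T} \<Longrightarrow> \<bar>u t i\<bar> \<le> M"
    and lip: "\<And>t B i. t \<in> {0..T} \<Longrightarrow> (\<And>i. \<bar>u t i\<bar> \<le> B) \<Longrightarrow> \<bar>D t i\<bar> \<le> \<Lambda> * B"
    and "u 0 = (\<lambda>i. 0)" and t: "t \<in> {0..T}"
  shows "u t i = 0"
proof -
  have "\<bar>u t i\<bar> \<le> M * ((\<Lambda> * t) ^ k / fact k)" if "t \<in> {0..T}" for k t i
    using that
  proof (induction k arbitrary: t i)
    case (Suc k t i)
    have D: "((\<lambda>s. D s i) has_integral (u t i - u 0 i)) {0..t}"
    proof (rule fundamental_theorem_of_calculus)
      fix s assume "s \<in> {0..t}"
      then have "((\<lambda>s. u s i) has_real_derivative D s i) (at s within {0..t})"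
        using Suc.prems by (intro DERIV_subset[OF deriv]) auto
      then show "((\<lambda>s. u s i) has_vector_derivative D s i) (at s within {0..t})"
        by (simp only: has_real_derivative_iff_has_vector_derivative)
    qed (use Suc.prems in simp)
    have A: "((\<lambda>s. M * (\<Lambda> ^ Suc k / fact (Suc k)) * (real (Suc k) * s ^ k)) has_integral
        M * (\<Lambda> ^ Suc k / fact (Suc k)) * (t ^ Suc k - 0 ^ Suc k)) {0..t}"
      using Suc.prems
      by (intro has_integral_mult_right fundamental_theorem_of_calculus)
         (auto simp: has_real_derivative_iff_has_vector_derivative[symmetric] simp del: power_Suc of_nat_Suc intro!: derivative_eq_intros)
    have eq: "M * (\<Lambda> ^ Suc k / fact (Suc k)) * (real (Suc k) * s ^ k) = \<Lambda> * (M * ((\<Lambda> * s) ^ k / fact k))" for s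
      by (simp add: power_mult_distrib field_simps del: of_nat_Suc)
    have B: "((\<lambda>s. \<Lambda> * (M * ((\<Lambda> * s) ^ k / fact k))) has_integral M * (\<Lambda> ^ Suc k / fact (Suc k)) * t ^ Suc k) {0..t}"
      using A[unfolded eq power_0_Suc diff_zero] .
    have "norm (integral {0..t} (\<lambda>s. D s i)) \<le> integral {0..t} (\<lambda>s. \<Lambda> * (M * ((\<Lambda> * s) ^ k / fact k)))"
    proof (rule integral_norm_bound_integral)
      fix s assume "s \<in> {0..t}"
      then have "s \<in> {0..T}" using Suc.prems by auto
      then show "norm (D s i) \<le> \<Lambda> * (M * ((\<Lambda> * s) ^ k / fact k))"
        unfolding real_norm_def by (intro lip Suc.IH)
    qed (use D B in blast)+
    then have "\<bar>u t i\<bar> \<le> M * (\<Lambda> ^ Suc k / fact (Suc k)) * t ^ Suc k"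
      unfolding integral_unique[OF D] integral_unique[OF B] assms(4) by (simp only: real_norm_def diff_zero)
    then show ?case by (simp add: power_mult_distrib mult_ac)
  qed (use bounded in simp)
  moreover have "(\<lambda>k. M * ((\<Lambda> * t) ^ k / fact k)) \<longlonglongrightarrow> M * 0"
    using summable_LIMSEQ_zero[OF summable_exp[of "\<Lambda> * t"]]
    by (intro tendsto_mult tendsto_const) (simp add: divide_inverse mult.commute)
  ultimately have "\<bar>u t i\<bar> \<le> M * 0"
    using t by (intro Lim_bounded2) auto
  then show ?thesis by simp
qed

text \<open>
  If the derivatives of the entries are Lipschitz in time with a common constant, then the error
  of the linear approximation of all entries is uniformly quadratic, which is differentiability in
  the supremum norm.
\<close>

lemma C1_LinftyI:
  fixes \<Gamma> D :: "real \<Rightarrow> int ^ 'd::finite \<Rightarrow> int ^ 'd \<Rightarrow> real"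
  assumes deriv: "\<And>t \<alpha> \<beta>. t \<in> {0..T} \<Longrightarrow> ((\<lambda>t. \<Gamma> t \<alpha> \<beta>) has_real_derivative D t \<alpha> \<beta>) (at t within {0..T})"
    and bd: "\<And>t \<alpha> \<beta>. t \<in> {0..T} \<Longrightarrow> \<bar>\<Gamma> t \<alpha> \<beta>\<bar> \<le> M" "\<And>t \<alpha> \<beta>. t \<in> {0..T} \<Longrightarrow> \<bar>D t \<alpha> \<beta>\<bar> \<le> M"
    and lip: "\<And>t s \<alpha> \<beta>. t \<in> {0..T} \<Longrightarrow> s \<in> {0..T} \<Longrightarrow> \<bar>D t \<alpha> \<beta> - D s \<alpha> \<beta>\<bar> \<le> \<Lambda> * \<bar>t - s\<bar>"
    and \<Lambda>: "0 < \<Lambda>"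
  shows "C1_Linfty T \<Gamma>"
proof -
  define G where "G t = Bcontfun (\<lambda>p. \<Gamma> t (fst p) (snd p))" for t
  define G' where "G' t = Bcontfun (\<lambda>p. D t (fst p) (snd p))" for t
  have G: "apply_bcontfun (G t) p = \<Gamma> t (fst p) (snd p)" if "t \<in> {0..T}" for t p
  proof -
    have "(\<lambda>p. \<Gamma> t (fst p) (snd p)) \<in> bcontfun"
      unfolding bounded_sequence_in_bcontfun using that bd by (auto intro!: boundedI[of _ M])
    then show ?thesis unfolding G_def by (simp add: Bcontfun_inverse)
  qed
  have G': "apply_bcontfun (G' t) p = D t (fst p) (snd p)" if "t \<in> {0..T}" for t p
  proof -
    have "(\<lambda>p. D t (fst p) (snd p)) \<in> bcontfun"
      unfolding bounded_sequence_in_bcontfun using that bd by (auto intro!: boundedI[of _ M])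
    then show ?thesis unfolding G'_def by (simp add: Bcontfun_inverse)
  qed
  show ?thesis unfolding C1_Linfty_def
  proof (rule exI[of _ G], rule exI[of _ G'], intro conjI ballI allI)
    fix t assume t: "t \<in> {0..T}"
    have quad: "norm (G y - G t - (y - t) *\<^sub>R G' t) \<le> (\<Lambda> * \<bar>y - t\<bar>) * \<bar>y - t\<bar>" if y: "y \<in> {0..T}" for y
    proof (rule norm_bound)
      fix p :: "(int ^ 'd) \<times> (int ^ 'd)"
      let ?S = "closed_segment t y"
      have S: "?S \<subseteq> {0..T}" using t y by (auto simp: closed_segment_eq_real_ivl split: if_splits)
      have "norm ((\<Gamma> y (fst p) (snd p) - y * D t (fst p) (snd p)) - (\<Gamma> t (fst p) (snd p) - t * D t (fst p) (snd p))) \<le> (\<Lambda> * \<bar>y - t\<bar>) * norm (y - t)"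
      proof (rule field_differentiable_bound[of ?S "\<lambda>s. \<Gamma> s (fst p) (snd p) - s * D t (fst p) (snd p)" "\<lambda>s. D s (fst p) (snd p) - D t (fst p) (snd p)"])
        fix s assume s: "s \<in> ?S"
        then have "((\<lambda>t. \<Gamma> t (fst p) (snd p)) has_real_derivative D s (fst p) (snd p)) (at s within ?S)"
          using S by (intro DERIV_subset[OF deriv S]) auto
        then show "((\<lambda>s. \<Gamma> s (fst p) (snd p) - s * D t (fst p) (snd p)) has_real_derivative D s (fst p) (snd p) - D t (fst p) (snd p)) (at s within ?S)"
          by (auto intro!: derivative_eq_intros)
        have "\<bar>D s (fst p) (snd p) - D t (fst p) (snd p)\<bar> \<le> \<Lambda> * \<bar>s - t\<bar>" using s S t by (intro lip) auto
        also have "\<dots> \<le> \<Lambda> * \<bar>y - t\<bar>"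
          using s \<Lambda> by (intro mult_left_mono) (auto simp: closed_segment_eq_real_ivl split: if_splits)
        finally show "norm (D s (fst p) (snd p) - D t (fst p) (snd p)) \<le> \<Lambda> * \<bar>y - t\<bar>" by simp
      qed auto
      then show "norm (apply_bcontfun (G y - G t - (y - t) *\<^sub>R G' t) p) \<le> (\<Lambda> * \<bar>y - t\<bar>) * \<bar>y - t\<bar>"
        using t y by (simp add: G G' minus_bcontfun.rep_eq scaleR_bcontfun.rep_eq algebra_simps)
    qed
    show "(G has_vector_derivative G' t) (at t within {0..T})"
      unfolding has_vector_derivative_def has_derivative_within_alt
    proof (intro conjI allI impI bounded_linear_scaleR_left)
      fix e :: real assume e: "0 < e"
      show "\<exists>d>0. \<forall>y\<in>{0..T}. norm (y - t) < d \<longrightarrow> norm (G y - G t - (y - t) *\<^sub>R G' t) \<le> e * norm (y - t)"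
      proof (intro exI[of _ "e / \<Lambda>"] conjI ballI impI)
        fix y assume y: "y \<in> {0..T}" "norm (y - t) < e / \<Lambda>"
        then have "\<Lambda> * \<bar>y - t\<bar> \<le> e" using \<Lambda> by (simp add: field_simps)
        then have "(\<Lambda> * \<bar>y - t\<bar>) * \<bar>y - t\<bar> \<le> e * \<bar>y - t\<bar>" by (intro mult_right_mono) auto
        with quad[OF y(1)] show "norm (G y - G t - (y - t) *\<^sub>R G' t) \<le> e * norm (y - t)" by simp
      qed (use e \<Lambda> in auto)
    qed
  next
    show "continuous_on {0..T} G'"
      unfolding continuous_on_iff
    proof (intro ballI allI impI)
      fix t e :: real assume t: "t \<in> {0..T}" and e: "0 < e"
      show "\<exists>d>0. \<forall>s\<in>{0..T}. dist s t < d \<longrightarrow> dist (G' s) (G' t) < e"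
      proof (intro exI[of _ "e / (2 * \<Lambda>)"] conjI ballI impI)
        fix s assume s: "s \<in> {0..T}" "dist s t < e / (2 * \<Lambda>)"
        have "dist (G' s) (G' t) \<le> \<Lambda> * \<bar>s - t\<bar>"
          using s t lip by (intro dist_bound) (auto simp: G' dist_real_def)
        also have "\<dots> \<le> e / 2" using s \<Lambda> by (simp add: dist_real_def field_simps)
        also have "\<dots> < e" using e by simp
        finally show "dist (G' s) (G' t) < e" .
      qed (use e \<Lambda> in auto)
    qed
  qed (use G in auto)
qed

section \<open>The difference operator\<close>

text \<open>
  The operator \<open>\<Sum>\<^sub>j c\<^sup>j \<nabla>\<^sub>+\<^sup>j \<nabla>\<^sub>-\<^sup>j\<close>, acting on the first index. As a finite linear combination of
  translations (over \<open>stencil\<close>, below) it commutes with sums and integrals.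
\<close>

definition diff_op :: "real \<Rightarrow> ('d::finite \<Rightarrow> int ^ 'd \<Rightarrow> real) \<Rightarrow> (int ^ 'd \<Rightarrow> int ^ 'd \<Rightarrow> real) \<Rightarrow> int ^ 'd \<Rightarrow> int ^ 'd \<Rightarrow> real" where
  "diff_op dx c F \<alpha> \<beta> = (\<Sum>j\<in>UNIV. c j \<alpha> * Dplus dx j (Dminus dx j (\<lambda>\<gamma>. F \<gamma> \<beta>)) \<alpha>)"

definition stencil :: "('d::finite \<times> int) set" where
  "stencil = UNIV \<times> {-1, 0, 1}"

definition stencil_weight :: "real \<Rightarrow> ('d::finite \<Rightarrow> int ^ 'd \<Rightarrow> real) \<Rightarrow> int ^ 'd \<Rightarrow> 'd \<times> int \<Rightarrow> real" where
  "stencil_weight dx c \<alpha> x = c (fst x) \<alpha> / dx\<^sup>2 * (if snd x = 0 then -2 else 1)"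

abbreviation shift :: "int ^ 'd::finite \<Rightarrow> 'd \<times> int \<Rightarrow> int ^ 'd" where
  "shift \<alpha> x \<equiv> \<alpha> + axis (fst x) (snd x)"

lemma finite_stencil [simp]: "finite stencil"
  by (simp add: stencil_def)

lemma axis_neg: "axis j (- k) = - (axis j k :: int ^ 'd::finite)"
  by (simp add: vec_eq_iff axis_def)

lemma axis_zero_int [simp]: "axis j 0 = (0 :: int ^ 'd::finite)"
  by (simp add: vec_eq_iff axis_def)

lemma second_difference:
  "Dplus dx j (Dminus dx j f) \<alpha> = (f (\<alpha> + axis j 1) - 2 * f \<alpha> + f (\<alpha> - axis j 1)) / dx\<^sup>2"
proof (cases "dx = 0")
  case False
  then show ?thesis by (simp add: Dplus_def Dminus_def field_simps power2_eq_square)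
qed (simp add: Dplus_def)

lemma diff_op_stencil:
  "diff_op dx c F \<alpha> \<beta> = (\<Sum>x\<in>stencil. stencil_weight dx c \<alpha> x * F (shift \<alpha> x) \<beta>)"
proof -
  have "(\<Sum>x\<in>stencil. stencil_weight dx c \<alpha> x * F (shift \<alpha> x) \<beta>)
      = (\<Sum>j\<in>UNIV. \<Sum>k\<in>{-1, 0, 1}. stencil_weight dx c \<alpha> (j, k) * F (shift \<alpha> (j, k)) \<beta>)"
    unfolding stencil_def sum.cartesian_product by (rule sum.cong) auto
  also have "\<dots> = (\<Sum>j\<in>UNIV. c j \<alpha> * Dplus dx j (Dminus dx j (\<lambda>\<gamma>. F \<gamma> \<beta>)) \<alpha>)"
  proof (rule sum.cong[OF refl])
    fix j
    show "(\<Sum>k\<in>{-1, 0, 1}. stencil_weight dx c \<alpha> (j, k) * F (shift \<alpha> (j, k)) \<beta>)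
       = c j \<alpha> * Dplus dx j (Dminus dx j (\<lambda>\<gamma>. F \<gamma> \<beta>)) \<alpha>"
      unfolding second_difference
      by (simp add: stencil_weight_def axis_neg[of j 1] add_divide_distrib diff_divide_distrib algebra_simps)
  qed
  finally show ?thesis by (simp add: diff_op_def)
qed

lemma cell_one: "cell 1 n = 1 / (1 + (of_int n)\<^sup>2)"
  by (simp add: cell_def)

lemma cell_one_shift:
  assumes "\<bar>m - n\<bar> \<le> 1"
  shows "cell 1 m \<le> 3 * cell 1 n"
proof -
  define a where "a = real_of_int m"
  define e where "e = real_of_int (n - m)"
  have "\<bar>n - m\<bar> \<le> 1" using assms by linarith
  then have "\<bar>e\<bar> \<le> 1" unfolding e_def by linarith
  then have e: "e\<^sup>2 \<le> 1" by (simp add: abs_square_le_1)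
  have "(a + e)\<^sup>2 = 2 * a\<^sup>2 + 2 * e\<^sup>2 - (a - e)\<^sup>2" by (simp add: power2_eq_square algebra_simps)
  moreover have "1 + x \<le> 3 + 3 * y" if "x = 2 * y + 2 * z - w" "z \<le> 1" "0 \<le> y" "0 \<le> w" for x y z w :: real
    using that by linarith
  ultimately have "1 + (a + e)\<^sup>2 \<le> 3 + 3 * a\<^sup>2"
    using e zero_le_power2[of a] zero_le_power2[of "a - e"] by blast
  moreover have "a + e = of_int n" by (simp add: a_def e_def)
  ultimately have "1 + (of_int n)\<^sup>2 \<le> 3 * (1 + (real_of_int m)\<^sup>2)" by (simp add: a_def)
  then show ?thesis by (simp add: cell_one divide_simps add_pos_nonneg) 
qed

text \<open>
  The neighbours of a grid point see the same envelope, up to a constant, so the difference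
  operator preserves the class of kernels.
\<close>

lemma env_one_shift:
  assumes "x \<in> stencil"
  shows "env 1 (shift \<alpha> x) \<le> 3 ^ CARD('d) * env 1 (\<alpha> :: int ^ 'd::finite)"
proof -
  have "cell 1 (shift \<alpha> x $ j) \<le> 3 * cell 1 (\<alpha> $ j)" for j
    using assms by (intro cell_one_shift) (auto simp: stencil_def axis_def)
  then have "env 1 (shift \<alpha> x) \<le> (\<Prod>j\<in>UNIV. 3 * cell 1 (\<alpha> $ j))"
    unfolding env_def by (intro prod_mono) (simp add: less_imp_le[OF cell_pos])
  then show ?thesis by (simp add: env_def prod.distrib)
qed

lemma conv_stencil:
  assumes "kernel_on S F" "kernel_on S' H" "u \<in> S" "v \<in> S'"
  shows "conv dx (diff_op dx c (F u)) (H v) \<alpha> \<beta> = diff_op dx c (conv dx (F u) (H v)) \<alpha> \<beta>"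
proof -
  have "((\<lambda>\<eta>. F u \<gamma> \<eta> * H v \<eta> \<beta> * dx ^ CARD('a)) has_sum conv dx (F u) (H v) \<gamma> \<beta>) UNIV" for \<gamma>
    using kernel_on_conv_summable[OF assms] unfolding conv_def conv_summable_def
    by (intro has_sum_infsum summable_on_cmult_left) auto
  then have "((\<lambda>\<eta>. \<Sum>x\<in>stencil. stencil_weight dx c \<alpha> x * (F u (shift \<alpha> x) \<eta> * H v \<eta> \<beta> * dx ^ CARD('a))) has_sum
      (\<Sum>x\<in>stencil. stencil_weight dx c \<alpha> x * conv dx (F u) (H v) (shift \<alpha> x) \<beta>)) UNIV"
    by (intro has_sum_finite_sum has_sum_cmult_right) auto
  then have "((\<lambda>\<eta>. diff_op dx c (F u) \<alpha> \<eta> * H v \<eta> \<beta> * dx ^ CARD('a)) has_sum diff_op dx c (conv dx (F u) (H v)) \<alpha> \<beta>) UNIV"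
    unfolding diff_op_stencil by (simp add: sum_distrib_right sum_distrib_left mult.assoc)
  then show ?thesis unfolding conv_def by (rule infsumI)
qed

lemma tconv_stencil:
  assumes "kernel_on {0..T} F" "kernel_on {0..T} H" "0 \<le> dx" "t \<in> {0..T}"
  shows "tconv dx (\<lambda>t. diff_op dx c (F t)) H t \<alpha> \<beta> = diff_op dx c (tconv dx F H t) \<alpha> \<beta>"
proof -
  have "((\<lambda>s. conv dx (F (t - s)) (H s) \<gamma> \<beta>) has_integral tconv dx F H t \<gamma> \<beta>) {0..t}" for \<gamma>
    unfolding tconv_def by (intro integrable_integral tconv_integrable[OF assms])
  then have "((\<lambda>s. \<Sum>x\<in>stencil. stencil_weight dx c \<alpha> x * conv dx (F (t - s)) (H s) (shift \<alpha> x) \<beta>) has_integral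
      (\<Sum>x\<in>stencil. stencil_weight dx c \<alpha> x * tconv dx F H t (shift \<alpha> x) \<beta>)) {0..t}"
    by (intro has_integral_sum has_integral_mult_right) auto
  then have "((\<lambda>s. diff_op dx c (conv dx (F (t - s)) (H s)) \<alpha> \<beta>) has_integral diff_op dx c (tconv dx F H t) \<alpha> \<beta>) {0..t}"
    by (simp only: diff_op_stencil)
  then have "((\<lambda>s. conv dx (diff_op dx c (F (t - s))) (H s) \<alpha> \<beta>) has_integral diff_op dx c (tconv dx F H t) \<alpha> \<beta>) {0..t}"
    by (rule has_integral_eq[rotated]) (use assms in \<open>auto intro!: conv_stencil[symmetric]\<close>)
  then show ?thesis unfolding tconv_def by (rule integral_unique)
qed

lemma tconv_add_left:
  assumes "kernel_on {0..T} F" "kernel_on {0..T} J" "kernel_on {0..T} H" "0 \<le> dx" "t \<in> {0..T}"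
  shows "tconv dx (\<lambda>t \<alpha> \<beta>. F t \<alpha> \<beta> + J t \<alpha> \<beta>) H t \<alpha> \<beta> = tconv dx F H t \<alpha> \<beta> + tconv dx J H t \<alpha> \<beta>"
proof -
  have "conv dx (\<lambda>\<alpha> \<beta>. F u \<alpha> \<beta> + J u \<alpha> \<beta>) (H v) \<alpha> \<beta> = conv dx (F u) (H v) \<alpha> \<beta> + conv dx (J u) (H v) \<alpha> \<beta>"
    if "u \<in> {0..T}" "v \<in> {0..T}" for u v
    using kernel_on_conv_summable[OF assms(1,3) that] kernel_on_conv_summable[OF assms(2,3) that]
    unfolding conv_def distrib_right conv_summable_def
    by (intro infsum_add summable_on_cmult_left) auto
  then have "tconv dx (\<lambda>t \<alpha> \<beta>. F t \<alpha> \<beta> + J t \<alpha> \<beta>) H t \<alpha> \<beta> =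
      integral {0..t} (\<lambda>s. conv dx (F (t - s)) (H s) \<alpha> \<beta> + conv dx (J (t - s)) (H s) \<alpha> \<beta>)"
    unfolding tconv_def using assms by (intro integral_cong) auto
  also have "\<dots> = tconv dx F H t \<alpha> \<beta> + tconv dx J H t \<alpha> \<beta>"
    unfolding tconv_def using assms by (intro integral_add tconv_integrable) auto
  finally show ?thesis .
qed


section \<open>The parametrix\<close>

lemma frozen_walk:
  fixes \<alpha> :: "int ^ 'd::finite"
  shows "frozen dx c t \<alpha> \<beta> = (\<Prod>j\<in>UNIV. walk (\<alpha> $ j) (2 * c j \<beta> * t / dx\<^sup>2)) / dx ^ CARD('d)"
  by (simp add: frozen_def walk_def Let_def)

definition parametrix :: "real \<Rightarrow> ('d::finite \<Rightarrow> int ^ 'd \<Rightarrow> real) \<Rightarrow> real \<Rightarrow> int ^ 'd \<Rightarrow> int ^ 'd \<Rightarrow> real" where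
  "parametrix dx c t \<alpha> \<beta> = frozen dx c t (\<alpha> - \<beta>) \<beta>"

lemma parametrix_second_difference:
  fixes \<alpha> :: "int ^ 'd::finite"
  shows "Dplus dx j (Dminus dx j (\<lambda>\<gamma>. parametrix dx c t \<gamma> \<beta>)) \<alpha> =
    walk_lap ((\<alpha> - \<beta>) $ j) (2 * c j \<beta> * t / dx\<^sup>2)
     * (\<Prod>i\<in>UNIV - {j}. walk ((\<alpha> - \<beta>) $ i) (2 * c i \<beta> * t / dx\<^sup>2)) / dx ^ CARD('d) / dx\<^sup>2"
proof -
  let ?P = "\<Prod>i\<in>UNIV - {j}. walk ((\<alpha> - \<beta>) $ i) (2 * c i \<beta> * t / dx\<^sup>2)"
  have "parametrix dx c t \<gamma> \<beta> = walk (\<gamma> $ j - \<beta> $ j) (2 * c j \<beta> * t / dx\<^sup>2) * ?P / dx ^ CARD('d)"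
    if "\<And>i. i \<noteq> j \<Longrightarrow> \<gamma> $ i = \<alpha> $ i" for \<gamma>
  proof -
    have "(\<Prod>i\<in>UNIV - {j}. walk ((\<gamma> - \<beta>) $ i) (2 * c i \<beta> * t / dx\<^sup>2)) = ?P"
      using that by (intro prod.cong) auto
    then show ?thesis unfolding parametrix_def frozen_walk by (subst prod.remove[of UNIV j]) auto
  qed
  note p = this
  let ?w = "\<lambda>n. walk n (2 * c j \<beta> * t / dx\<^sup>2)"
  have p1: "parametrix dx c t (\<alpha> + axis j 1) \<beta> = ?w (\<alpha> $ j + 1 - \<beta> $ j) * ?P / dx ^ CARD('d)"
    using p[of "\<alpha> + axis j 1"] by (simp add: axis_def)
  have p2: "parametrix dx c t (\<alpha> - axis j 1) \<beta> = ?w (\<alpha> $ j - 1 - \<beta> $ j) * ?P / dx ^ CARD('d)"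
    using p[of "\<alpha> - axis j 1"] by (simp add: axis_def)
  have p3: "parametrix dx c t \<alpha> \<beta> = ?w (\<alpha> $ j - \<beta> $ j) * ?P / dx ^ CARD('d)"
    using p[of \<alpha>] by simp
  have e: "\<alpha> $ j - \<beta> $ j + 1 = \<alpha> $ j + 1 - \<beta> $ j" "\<alpha> $ j - \<beta> $ j - 1 = \<alpha> $ j - 1 - \<beta> $ j"
    by simp_all
  have "(a * P / D - 2 * (b * P / D) + d * P / D) / q = (a - 2 * b + d) * P / D / q" for a b d P D q :: real
    by (simp add: add_divide_distrib diff_divide_distrib algebra_simps)
  then show ?thesis
    unfolding second_difference walk_lap_def p1 p2 p3 vector_minus_component e .
qed

definition parametrix_deriv :: "real \<Rightarrow> ('d::finite \<Rightarrow> int ^ 'd \<Rightarrow> real) \<Rightarrow> real \<Rightarrow> int ^ 'd \<Rightarrow> int ^ 'd \<Rightarrow> real" where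
  "parametrix_deriv dx c t \<alpha> \<beta> = (\<Sum>j\<in>UNIV. c j \<beta> * Dplus dx j (Dminus dx j (\<lambda>\<gamma>. parametrix dx c t \<gamma> \<beta>)) \<alpha>)"

lemma parametrix_has_derivative:
  fixes c :: "'d::finite \<Rightarrow> int ^ 'd \<Rightarrow> real"
  shows "((\<lambda>t. parametrix dx c t \<alpha> \<beta>) has_real_derivative parametrix_deriv dx c t \<alpha> \<beta>) (at t within S)"
proof -
  let ?r = "\<lambda>j t. 2 * c j \<beta> * t / dx\<^sup>2"
  have w: "((\<lambda>t. walk n (?r j t)) has_real_derivative c j \<beta> / dx\<^sup>2 * walk_lap n (?r j t)) (at t)" for n j
    using DERIV_chain2[OF has_real_derivative_walk DERIV_cmult_Id[of "2 * c j \<beta> / dx\<^sup>2" t UNIV], of n]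
    by (simp add: mult.commute)
  have "((\<lambda>t. (\<Prod>j\<in>UNIV. walk ((\<alpha> - \<beta>) $ j) (?r j t)) / dx ^ CARD('d)) has_real_derivative
      (\<Sum>j\<in>UNIV. (c j \<beta> / dx\<^sup>2 * walk_lap ((\<alpha> - \<beta>) $ j) (?r j t)) * (\<Prod>i\<in>UNIV - {j}. walk ((\<alpha> - \<beta>) $ i) (?r i t))) / dx ^ CARD('d)) (at t)"
    by (intro DERIV_cdivide has_field_derivative_prod w)
  moreover have "(\<Sum>j\<in>UNIV. (c j \<beta> / dx\<^sup>2 * walk_lap ((\<alpha> - \<beta>) $ j) (?r j t)) * (\<Prod>i\<in>UNIV - {j}. walk ((\<alpha> - \<beta>) $ i) (?r i t))) / dx ^ CARD('d)
      = parametrix_deriv dx c t \<alpha> \<beta>"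
    unfolding parametrix_deriv_def parametrix_second_difference sum_divide_distrib
    by (intro sum.cong refl) (simp add: mult_ac)
  ultimately have "((\<lambda>t. parametrix dx c t \<alpha> \<beta>) has_real_derivative parametrix_deriv dx c t \<alpha> \<beta>) (at t)"
    by (simp add: parametrix_def frozen_walk)
  then show ?thesis by (rule has_field_derivative_at_within)
qed

text \<open>
  The parametrix solves the equation with the coefficients at \<open>\<beta>\<close> in place of those at \<open>\<alpha>\<close>; the
  difference is \<open>K\<close>.
\<close>

lemma diff_op_parametrix: "diff_op dx c (parametrix dx c t) \<alpha> \<beta> = parametrix_deriv dx c t \<alpha> \<beta> + Kker dx c t \<alpha> \<beta>"
  by (simp add: diff_op_def parametrix_deriv_def Kker_def parametrix_def left_diff_distrib sum_subtractf)

lemma parametrix_0: "parametrix dx c 0 \<alpha> \<beta> = dirac dx (\<alpha> - \<beta>)"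
proof -
  have "(\<Prod>j\<in>UNIV. walk ((\<alpha> - \<beta>) $ j) 0) = (if \<alpha> - \<beta> = 0 then 1 else 0)"
  proof (cases "\<alpha> - \<beta> = 0")
    case False
    then obtain j where "(\<alpha> - \<beta>) $ j \<noteq> 0" unfolding vec_eq_iff zero_index by blast
    then have "walk ((\<alpha> - \<beta>) $ j) 0 = 0" by (simp only: walk_0 if_False)
    then have "(\<Prod>j\<in>UNIV. walk ((\<alpha> - \<beta>) $ j) 0) = 0" by (intro prod_zero bexI[of _ j]) auto
    then show ?thesis using False by (simp only: if_False)
  qed (simp add: walk_0)
  then show ?thesis by (simp add: parametrix_def frozen_walk dirac_def)
qed

lemma conv_parametrix_0:
  assumes "dx > 0"
  shows "conv dx (parametrix dx c 0) H \<alpha> \<beta> = H \<alpha> \<beta>"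
proof -
  have "((\<lambda>\<eta>. parametrix dx c 0 \<alpha> \<eta> * H \<eta> \<beta> * dx ^ CARD('a)) has_sum H \<alpha> \<beta>) UNIV"
  proof (rule has_sum_finite_neutralI[of "{\<alpha>}"])
    fix \<eta> assume "\<eta> \<in> UNIV - {\<alpha>}"
    then have "parametrix dx c 0 \<alpha> \<eta> = 0" by (simp add: parametrix_0 dirac_def)
    then show "parametrix dx c 0 \<alpha> \<eta> * H \<eta> \<beta> * dx ^ CARD('a) = 0" by simp
  next
    have "parametrix dx c 0 \<alpha> \<alpha> * dx ^ CARD('a) = 1" using assms by (simp add: parametrix_0 dirac_def)
    then have "parametrix dx c 0 \<alpha> \<alpha> * H \<alpha> \<beta> * dx ^ CARD('a) = H \<alpha> \<beta>" by (metis mult.assoc mult.commute mult_1)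
    then show "H \<alpha> \<beta> = (\<Sum>\<eta>\<in>{\<alpha>}. parametrix dx c 0 \<alpha> \<eta> * H \<eta> \<beta> * dx ^ CARD('a))" by simp
  qed auto
  then show ?thesis unfolding conv_def by (rule infsumI)
qed

lemma parametrix_bound:
  fixes \<alpha> :: "int ^ 'd::finite"
  assumes dx: "0 < dx" and \<tau>: "0 < \<tau>" and w: "\<And>j. walk_bounded B \<tau> (2 * c j \<beta> * t / dx\<^sup>2)"
  shows "\<bar>parametrix dx c t \<alpha> \<beta>\<bar> \<le> B ^ CARD('d) / dx ^ CARD('d) * env \<tau> (\<alpha> - \<beta>)"
proof -
  have "\<bar>\<Prod>j\<in>UNIV. walk ((\<alpha> - \<beta>) $ j) (2 * c j \<beta> * t / dx\<^sup>2)\<bar> \<le> (\<Prod>j\<in>UNIV. B * cell \<tau> ((\<alpha> - \<beta>) $ j))"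
    unfolding abs_prod using w by (intro prod_mono) (auto simp: walk_bounded_def)
  also have "\<dots> = B ^ CARD('d) * env \<tau> (\<alpha> - \<beta>)" by (simp add: prod.distrib env_def)
  finally have "\<bar>\<Prod>j\<in>UNIV. walk ((\<alpha> - \<beta>) $ j) (2 * c j \<beta> * t / dx\<^sup>2)\<bar> / dx ^ CARD('d)
      \<le> B ^ CARD('d) * env \<tau> (\<alpha> - \<beta>) / dx ^ CARD('d)"
    using dx by (intro divide_right_mono) auto
  moreover have "\<bar>dx ^ CARD('d)\<bar> = dx ^ CARD('d)" using dx by simp
  ultimately show ?thesis unfolding parametrix_def frozen_walk abs_divide by (simp only: times_divide_eq_left)
qed

text \<open>
  The bound is a product over the coordinates. The factor for \<open>j\<close> carries the second difference
  and costs \<open>1 / \<tau>\<close>; the factor for \<open>i\<close> carries the weight and costs \<open>\<surd>\<tau>\<close>; the case \<open>i = j\<close> has to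
  be treated separately.
\<close>

lemma parametrix_second_difference_weighted:
  fixes \<alpha> :: "int ^ 'd::finite"
  assumes dx: "0 < dx" and \<tau>: "0 < \<tau>" and w: "\<And>j. walk_bounded B \<tau> (2 * c j \<beta> * t / dx\<^sup>2)"
  shows "\<bar>of_int ((\<alpha> - \<beta>) $ i)\<bar> * \<bar>Dplus dx j (Dminus dx j (\<lambda>\<gamma>. parametrix dx c t \<gamma> \<beta>)) \<alpha>\<bar>
    \<le> B ^ CARD('d) / (dx ^ CARD('d) * dx\<^sup>2 * sqrt \<tau>) * env \<tau> (\<alpha> - \<beta>)"
proof -
  define n where "n k = (\<alpha> - \<beta>) $ k" for k
  define r where "r k = 2 * c k \<beta> * t / dx\<^sup>2" for k
  define h where "h k = (if k = j then \<bar>walk_lap (n k) (r k)\<bar> else \<bar>walk (n k) (r k)\<bar>) * (if k = i then \<bar>of_int (n k)\<bar> else 1)" for k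
  define m where "m k = (if k = j then 1 / \<tau> else 1) * (if k = i then sqrt \<tau> else 1)" for k
  note w' = w[unfolded walk_bounded_def, rule_format, folded r_def]
  have s: "1 / \<tau> * sqrt \<tau> = 1 / sqrt \<tau>" using \<tau> by (simp add: real_div_sqrt field_simps)
  have "h k \<le> m k * (B * cell \<tau> (n k))" for k
  proof (cases "k = j \<and> k = i")
    case True
    then have "m k = 1 / sqrt \<tau>" "h k = \<bar>of_int (n k)\<bar> * \<bar>walk_lap (n k) (r k)\<bar>"
      using s by (auto simp: m_def h_def)
    then show ?thesis using w'[of "n k" k] by simp
  next
    case False
    then show ?thesis using w'[of "n k" k] by (auto simp: h_def m_def mult_ac)
  qed
  then have "(\<Prod>k\<in>UNIV. h k) \<le> (\<Prod>k\<in>UNIV. m k * (B * cell \<tau> (n k)))"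
    by (intro prod_mono) (auto simp: h_def)
  also have "\<dots> = (1 / \<tau> * sqrt \<tau>) * (B ^ CARD('d) * env \<tau> (\<alpha> - \<beta>))"
    by (simp only: prod.distrib m_def prod.delta finite UNIV_I if_True prod_constant env_def n_def)
  finally have 1: "(\<Prod>k\<in>UNIV. h k) \<le> (1 / sqrt \<tau>) * (B ^ CARD('d) * env \<tau> (\<alpha> - \<beta>))" unfolding s .
  have "(\<Prod>k\<in>UNIV. h k) = (\<Prod>k\<in>UNIV. (if k = j then \<bar>walk_lap (n k) (r k)\<bar> else \<bar>walk (n k) (r k)\<bar>)) * \<bar>of_int (n i)\<bar>"
    unfolding h_def prod.distrib by (simp add: prod.delta)
  also have "(\<Prod>k\<in>UNIV. (if k = j then \<bar>walk_lap (n k) (r k)\<bar> else \<bar>walk (n k) (r k)\<bar>)) =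
     \<bar>walk_lap (n j) (r j)\<bar> * (\<Prod>k\<in>UNIV - {j}. \<bar>walk (n k) (r k)\<bar>)"
    by (subst prod.remove[of UNIV j]) (auto intro!: prod.cong)
  finally have 2: "\<bar>of_int (n i)\<bar> * (\<bar>walk_lap (n j) (r j)\<bar> * (\<Prod>k\<in>UNIV - {j}. \<bar>walk (n k) (r k)\<bar>)) = (\<Prod>k\<in>UNIV. h k)"
    by (simp only: mult.commute)
  have "\<bar>of_int (n i)\<bar> * \<bar>Dplus dx j (Dminus dx j (\<lambda>\<gamma>. parametrix dx c t \<gamma> \<beta>)) \<alpha>\<bar> =
      (\<Prod>k\<in>UNIV. h k) / dx ^ CARD('d) / dx\<^sup>2"
    unfolding parametrix_second_difference n_def[symmetric] r_def[symmetric] 2[symmetric]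
    using dx by (simp add: abs_mult abs_prod)
  also have "\<dots> \<le> ((1 / sqrt \<tau>) * (B ^ CARD('d) * env \<tau> (\<alpha> - \<beta>))) / dx ^ CARD('d) / dx\<^sup>2"
    using dx 1 by (intro divide_right_mono) auto
  also have "\<dots> = B ^ CARD('d) / (dx ^ CARD('d) * dx\<^sup>2 * sqrt \<tau>) * env \<tau> (\<alpha> - \<beta>)" by simp
  finally show ?thesis by (simp add: n_def)
qed

lemma gridpt_diff_norm:
  fixes \<alpha> \<beta> :: "int ^ 'd::finite"
  assumes "0 \<le> dx"
  shows "norm (gridpt dx \<alpha> - gridpt dx \<beta>) \<le> dx * (\<Sum>i\<in>UNIV. \<bar>of_int ((\<alpha> - \<beta>) $ i)\<bar>)"
proof -
  have "norm (gridpt dx \<alpha> - gridpt dx \<beta>) \<le> (\<Sum>i\<in>UNIV. \<bar>(gridpt dx \<alpha> - gridpt dx \<beta>) $ i\<bar>)"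
    by (rule norm_le_l1_cart)
  also have "\<dots> = dx * (\<Sum>i\<in>UNIV. \<bar>of_int ((\<alpha> - \<beta>) $ i)\<bar>)"
  proof -
    have "(gridpt dx \<alpha> - gridpt dx \<beta>) $ i = dx * of_int ((\<alpha> - \<beta>) $ i)" for i
      by (simp add: gridpt_def algebra_simps)
    then show ?thesis using assms by (simp only: abs_mult sum_distrib_left abs_of_nonneg)
  qed
  finally show ?thesis .
qed

text \<open>
  The Lipschitz condition turns the coefficient difference into the weight \<open>dx \<bar>\<alpha> - \<beta>\<bar>\<close>, which
  improves the factor \<open>1 / \<tau>\<close> of the second difference to \<open>1 / \<surd>\<tau>\<close>.
\<close>

lemma Kker_bound:
  fixes \<alpha> :: "int ^ 'd::finite"
  assumes dx: "0 < dx" and \<tau>: "0 < \<tau>" and w: "\<And>j. walk_bounded B \<tau> (2 * c j \<beta> * t / dx\<^sup>2)"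
    and lip: "\<And>j. \<bar>c j \<alpha> - c j \<beta>\<bar> \<le> L * norm (gridpt dx \<alpha> - gridpt dx \<beta>)" and L: "0 \<le> L"
  shows "\<bar>Kker dx c t \<alpha> \<beta>\<bar> \<le> (real CARD('d))\<^sup>2 * L * B ^ CARD('d) / (dx ^ CARD('d) * (dx * sqrt \<tau>)) * env \<tau> (\<alpha> - \<beta>)"
proof -
  let ?D = "\<lambda>j. Dplus dx j (Dminus dx j (\<lambda>\<gamma>. parametrix dx c t \<gamma> \<beta>)) \<alpha>"
  let ?M = "B ^ CARD('d) / (dx ^ CARD('d) * dx\<^sup>2 * sqrt \<tau>) * env \<tau> (\<alpha> - \<beta>)"
  have "\<bar>(c j \<alpha> - c j \<beta>) * ?D j\<bar> \<le> real CARD('d) * (L * dx * ?M)" for j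
  proof -
    have "\<bar>c j \<alpha> - c j \<beta>\<bar> \<le> L * (dx * (\<Sum>i\<in>UNIV. \<bar>of_int ((\<alpha> - \<beta>) $ i)\<bar>))"
      using order_trans[OF lip mult_left_mono[OF gridpt_diff_norm L]] dx by simp
    then have "\<bar>(c j \<alpha> - c j \<beta>) * ?D j\<bar> \<le> L * (dx * (\<Sum>i\<in>UNIV. \<bar>of_int ((\<alpha> - \<beta>) $ i)\<bar>)) * \<bar>?D j\<bar>"
      unfolding abs_mult by (intro mult_right_mono) auto
    also have "\<dots> = L * dx * (\<Sum>i\<in>UNIV. \<bar>of_int ((\<alpha> - \<beta>) $ i)\<bar> * \<bar>?D j\<bar>)"
      by (simp only: mult.assoc sum_distrib_right)
    also have "\<dots> \<le> L * dx * (\<Sum>i\<in>(UNIV :: 'd set). ?M)"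
      using L dx by (intro mult_left_mono sum_mono parametrix_second_difference_weighted[where c = c, OF dx \<tau> w]) auto
    also have "\<dots> = real CARD('d) * (L * dx * ?M)" by simp
    finally show ?thesis .
  qed
  then have "(\<Sum>j\<in>UNIV. \<bar>(c j \<alpha> - c j \<beta>) * ?D j\<bar>) \<le> (\<Sum>j\<in>(UNIV :: 'd set). real CARD('d) * (L * dx * ?M))"
    by (intro sum_mono)
  also have "\<dots> = real CARD('d) * (real CARD('d) * (L * dx * ?M))" by (simp only: sum_constant)
  also have "\<dots> = (real CARD('d))\<^sup>2 * L * B ^ CARD('d) / (dx ^ CARD('d) * (dx * sqrt \<tau>)) * env \<tau> (\<alpha> - \<beta>)"
  proof -
    have "k * (k * (L * dx * (X / (D * dx\<^sup>2 * s) * e))) = k\<^sup>2 * L * X / (D * (dx * s)) * e" for k X D s e :: real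
      using dx by (simp add: power2_eq_square)
    then show ?thesis .
  qed
  finally have "(\<Sum>j\<in>UNIV. \<bar>(c j \<alpha> - c j \<beta>) * ?D j\<bar>)
      \<le> (real CARD('d))\<^sup>2 * L * B ^ CARD('d) / (dx ^ CARD('d) * (dx * sqrt \<tau>)) * env \<tau> (\<alpha> - \<beta>)" .
  moreover have "\<bar>Kker dx c t \<alpha> \<beta>\<bar> \<le> (\<Sum>j\<in>UNIV. \<bar>(c j \<alpha> - c j \<beta>) * ?D j\<bar>)"
    unfolding Kker_def parametrix_def by (rule sum_abs)
  ultimately show ?thesis by (rule order_trans[rotated])
qed

section \<open>The fundamental solution on a fixed mesh\<close>

text \<open>
  Coefficients on a given mesh. No sign is prescribed for \<open>L\<close>, so the bounds contain \<open>\<bar>L\<bar>\<close>.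
\<close>

locale coeffs =
  fixes dx lo hi L :: real and c :: "'d::finite \<Rightarrow> int ^ 'd \<Rightarrow> real"
  assumes dx: "0 < dx" and lo: "0 < lo" and coeff: "coefficients dx lo hi L c"
begin

abbreviation "\<Gamma> \<equiv> Gamma_kernel dx c"

lemma dx0: "0 \<le> dx"
  using dx by simp

lemma c_bounds: "lo \<le> c j \<alpha>" "c j \<alpha> \<le> hi" "0 < c j \<alpha>"
  using coeff lo unfolding coefficients_def by (auto intro: less_le_trans)

lemma hi_pos: "0 < hi"
  using c_bounds lo by (meson less_le_trans)

lemma c_lipschitz: "\<bar>c j \<alpha> - c j \<beta>\<bar> \<le> \<bar>L\<bar> * norm (gridpt dx \<alpha> - gridpt dx \<beta>)"
proof -
  have "\<bar>c j \<alpha> - c j \<beta>\<bar> \<le> L * norm (gridpt dx \<alpha> - gridpt dx \<beta>)"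
    using coeff unfolding coefficients_def by blast
  also have "\<dots> \<le> \<bar>L\<bar> * norm (gridpt dx \<alpha> - gridpt dx \<beta>)" by (intro mult_right_mono) auto
  finally show ?thesis .
qed

lemma walk_bounded_compact:
  obtains B where "1 \<le> B" "\<And>t j \<beta>. t \<in> {-T..T} \<Longrightarrow> walk_bounded B 1 (2 * c j \<beta> * t / dx\<^sup>2)"
proof -
  obtain B where B: "1 \<le> B" "\<And>r. \<bar>r\<bar> \<le> 2 * hi * T / dx\<^sup>2 \<Longrightarrow> walk_bounded B 1 r"
    using walk_bounded_local by blast
  show ?thesis
  proof (rule that[OF B(1)], rule B(2))
    fix t j \<beta> assume "t \<in> {-T..T}"
    then have "c j \<beta> * \<bar>t\<bar> \<le> hi * T"
      using c_bounds[of j \<beta>] hi_pos by (intro mult_mono) auto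
    then show "\<bar>2 * c j \<beta> * t / dx\<^sup>2\<bar> \<le> 2 * hi * T / dx\<^sup>2"
      using dx c_bounds(3)[of j \<beta>] by (simp add: abs_mult divide_right_mono)
  qed
qed

lemma continuous_on_parametrix: "continuous_on S (\<lambda>t. parametrix dx c t \<alpha> \<beta>)"
  using parametrix_has_derivative by (rule DERIV_continuous_on)

lemma kernel_on_parametrix: "kernel_on {-T..T} (parametrix dx c)"
proof -
  obtain B where B: "1 \<le> B" "\<And>t j \<beta>. t \<in> {-T..T} \<Longrightarrow> walk_bounded B 1 (2 * c j \<beta> * t / dx\<^sup>2)"
    using walk_bounded_compact[of T thesis] by blast
  have "\<bar>parametrix dx c t \<alpha> \<beta>\<bar> \<le> B ^ CARD('d) / dx ^ CARD('d) * env 1 (\<alpha> - \<beta>)" if "t \<in> {-T..T}" for t \<alpha> \<beta>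
    by (rule parametrix_bound[OF dx]) (auto intro!: B that)
  then show ?thesis unfolding kernel_on_def using continuous_on_parametrix by blast
qed

lemma kernel_on_Kker: "kernel_on {-T..T} (Kker dx c)"
proof -
  obtain B where B: "1 \<le> B" "\<And>t j \<beta>. t \<in> {-T..T} \<Longrightarrow> walk_bounded B 1 (2 * c j \<beta> * t / dx\<^sup>2)"
    using walk_bounded_compact[of T thesis] by blast
  have "\<bar>Kker dx c t \<alpha> \<beta>\<bar> \<le> (real CARD('d))\<^sup>2 * \<bar>L\<bar> * B ^ CARD('d) / (dx ^ CARD('d) * (dx * sqrt 1)) * env 1 (\<alpha> - \<beta>)"
    if "t \<in> {-T..T}" for t \<alpha> \<beta>
    by (rule Kker_bound[OF dx]) (auto intro!: B that c_lipschitz)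
  moreover have "continuous_on {-T..T} (\<lambda>t. Kker dx c t \<alpha> \<beta>)" for \<alpha> \<beta>
    unfolding Kker_def second_difference parametrix_def[symmetric]
    using dx by (intro continuous_intros continuous_on_parametrix) auto
  ultimately show ?thesis unfolding kernel_on_def by blast
qed

definition "op_const = real (card (stencil :: ('d \<times> int) set)) * (2 * hi / dx\<^sup>2)"

lemma op_const_pos: "0 < op_const"
proof -
  have "(stencil :: ('d \<times> int) set) \<noteq> {}" by (auto simp: stencil_def)
  then show ?thesis using hi_pos dx by (simp add: op_const_def card_gt_0_iff)
qed

lemma diff_op_le:
  assumes "\<And>x. x \<in> stencil \<Longrightarrow> \<bar>F (shift \<alpha> x) \<beta>\<bar> \<le> B"
  shows "\<bar>diff_op dx c F \<alpha> \<beta>\<bar> \<le> op_const * B"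
proof -
  have w: "\<bar>stencil_weight dx c \<alpha> x\<bar> \<le> 2 * hi / dx\<^sup>2" for x
  proof -
    have "\<bar>stencil_weight dx c \<alpha> x\<bar> \<le> c (fst x) \<alpha> / dx\<^sup>2 * 2"
      using c_bounds(3)[of "fst x" \<alpha>] dx by (auto simp: stencil_weight_def abs_mult divide_right_mono)
    also have "\<dots> \<le> 2 * hi / dx\<^sup>2" using c_bounds(2)[of "fst x" \<alpha>] dx by (simp add: divide_right_mono)
    finally show ?thesis .
  qed
  have "\<bar>diff_op dx c F \<alpha> \<beta>\<bar> \<le> (\<Sum>x\<in>stencil. \<bar>stencil_weight dx c \<alpha> x * F (shift \<alpha> x) \<beta>\<bar>)"
    unfolding diff_op_stencil by (rule sum_abs)
  also have "\<dots> \<le> (\<Sum>x\<in>(stencil :: ('d \<times> int) set). 2 * hi / dx\<^sup>2 * B)"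
    unfolding abs_mult using w assms hi_pos by (intro sum_mono mult_mono) auto
  also have "\<dots> = op_const * B" by (simp add: op_const_def)
  finally show ?thesis .
qed

lemma diff_op_diff: "diff_op dx c F \<alpha> \<beta> - diff_op dx c H \<alpha> \<beta> = diff_op dx c (\<lambda>\<alpha> \<beta>. F \<alpha> \<beta> - H \<alpha> \<beta>) \<alpha> \<beta>"
  unfolding diff_op_stencil by (simp add: right_diff_distrib sum_subtractf)

lemma diff_op_add: "diff_op dx c (\<lambda>\<alpha> \<beta>. F \<alpha> \<beta> + H \<alpha> \<beta>) \<alpha> \<beta> = diff_op dx c F \<alpha> \<beta> + diff_op dx c H \<alpha> \<beta>"
  unfolding diff_op_stencil by (simp add: distrib_left sum.distrib)

lemma kernel_on_diff_op:
  assumes "kernel_on S F"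
  shows "kernel_on S (\<lambda>t. diff_op dx c (F t))"
proof -
  obtain C where C: "0 \<le> C" "\<And>t \<alpha> \<beta>. t \<in> S \<Longrightarrow> \<bar>F t \<alpha> \<beta>\<bar> \<le> C * env 1 (\<alpha> - \<beta>)"
    using kernel_onE[OF assms] by metis
  have "\<bar>diff_op dx c (F t) \<alpha> \<beta>\<bar> \<le> op_const * (C * 3 ^ CARD('d)) * env 1 (\<alpha> - \<beta>)" if t: "t \<in> S" for t \<alpha> \<beta>
  proof -
    have "\<bar>diff_op dx c (F t) \<alpha> \<beta>\<bar> \<le> op_const * (C * (3 ^ CARD('d) * env 1 (\<alpha> - \<beta>)))"
    proof (rule diff_op_le)
      fix x :: "'d \<times> int" assume x: "x \<in> stencil"
      have "\<bar>F t (shift \<alpha> x) \<beta>\<bar> \<le> C * env 1 (shift \<alpha> x - \<beta>)" by (rule C(2)[OF t])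
      also have "shift \<alpha> x - \<beta> = shift (\<alpha> - \<beta>) x" by simp
      also have "C * env 1 (shift (\<alpha> - \<beta>) x) \<le> C * (3 ^ CARD('d) * env 1 (\<alpha> - \<beta>))"
        by (intro mult_left_mono env_one_shift x C(1))
      finally show "\<bar>F t (shift \<alpha> x) \<beta>\<bar> \<le> C * (3 ^ CARD('d) * env 1 (\<alpha> - \<beta>))" .
    qed
    then show ?thesis by (simp only: mult.assoc)
  qed
  moreover have "continuous_on S (\<lambda>t. diff_op dx c (F t) \<alpha> \<beta>)" for \<alpha> \<beta>
    unfolding diff_op_stencil by (intro continuous_intros kernel_on_continuous[OF assms])
  ultimately show ?thesis unfolding kernel_on_def by blast
qed

lemma kernel_on_parametrix_deriv: "kernel_on {-T..T} (parametrix_deriv dx c)"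
proof -
  have "parametrix_deriv dx c = (\<lambda>t \<alpha> \<beta>. diff_op dx c (parametrix dx c t) \<alpha> \<beta> + (-1) * Kker dx c t \<alpha> \<beta>)"
    by (intro ext) (simp add: diff_op_parametrix)
  then show ?thesis
    by (rule ssubst) (rule kernel_on_add[OF kernel_on_diff_op[OF kernel_on_parametrix] kernel_on_cmult[OF kernel_on_Kker]])
qed

lemma kernels_nonneg_times:
  shows "kernel_on {0..T} (parametrix dx c)" "kernel_on {0..T} (Kker dx c)" "kernel_on {0..T} (parametrix_deriv dx c)"
    "kernel_on {0..T} (Phi dx c)"
proof -
  have sub: "{0..T} \<subseteq> {-T..T}" by auto
  show "kernel_on {0..T} (parametrix dx c)" "kernel_on {0..T} (parametrix_deriv dx c)"
    using kernel_on_subset[OF _ sub] kernel_on_parametrix kernel_on_parametrix_deriv by blast+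
  show K: "kernel_on {0..T} (Kker dx c)" using kernel_on_subset[OF kernel_on_Kker sub] .
  show "kernel_on {0..T} (Phi dx c)" by (rule kernel_on_Phi[OF K dx0])
qed

lemma Gamma_eq: "\<Gamma> t \<alpha> \<beta> = parametrix dx c t \<alpha> \<beta> + tconv dx (parametrix dx c) (Phi dx c) t \<alpha> \<beta>"
  by (simp add: Gamma_kernel_def parametrix_def tconv_def conv_def)

lemma kernel_on_Gamma: "kernel_on {0..T} \<Gamma>"
proof -
  have "\<Gamma> = (\<lambda>t \<alpha> \<beta>. parametrix dx c t \<alpha> \<beta> + tconv dx (parametrix dx c) (Phi dx c) t \<alpha> \<beta>)"
    by (intro ext Gamma_eq)
  then show ?thesis
    by (rule ssubst) (rule kernel_on_add[OF kernels_nonneg_times(1) kernel_on_tconv[OF kernels_nonneg_times(1,4) dx0]])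
qed

text \<open>
  Differentiating \<open>\<Gamma> = a + a \<circledast> \<Phi>\<close> produces \<open>a' + a' \<circledast> \<Phi> + \<Phi>\<close>, the last term because \<open>a(0)\<close> is the
  unit of the convolution. Applying the operator produces \<open>(a' + K) + (a' + K) \<circledast> \<Phi>\<close>. The two agree
  by the Volterra equation.
\<close>

lemma Gamma_has_derivative:
  assumes t: "t \<in> {0..T}"
  shows "((\<lambda>t. \<Gamma> t \<alpha> \<beta>) has_real_derivative diff_op dx c (\<Gamma> t) \<alpha> \<beta>) (at t within {0..T})"
proof -
  note k = kernels_nonneg_times[where T = T]
  have "((\<lambda>t. parametrix dx c t \<alpha> \<beta> + tconv dx (parametrix dx c) (Phi dx c) t \<alpha> \<beta>) has_real_derivative
      parametrix_deriv dx c t \<alpha> \<beta> + (tconv dx (parametrix_deriv dx c) (Phi dx c) t \<alpha> \<beta> + conv dx (parametrix dx c 0) (Phi dx c t) \<alpha> \<beta>))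
      (at t within {0..T})"
    by (intro DERIV_add parametrix_has_derivative tconv_has_derivative[OF kernel_on_parametrix kernel_on_parametrix_deriv k(4) dx0 _ t])
  moreover have "parametrix_deriv dx c t \<alpha> \<beta> + (tconv dx (parametrix_deriv dx c) (Phi dx c) t \<alpha> \<beta> + conv dx (parametrix dx c 0) (Phi dx c t) \<alpha> \<beta>)
      = diff_op dx c (\<Gamma> t) \<alpha> \<beta>"
  proof -
    have "\<Gamma> t = (\<lambda>\<alpha> \<beta>. parametrix dx c t \<alpha> \<beta> + tconv dx (parametrix dx c) (Phi dx c) t \<alpha> \<beta>)"
      by (intro ext Gamma_eq)
    then have "diff_op dx c (\<Gamma> t) \<alpha> \<beta> = diff_op dx c (parametrix dx c t) \<alpha> \<beta> + diff_op dx c (tconv dx (parametrix dx c) (Phi dx c) t) \<alpha> \<beta>"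
      by (simp only: diff_op_add)
    also have "diff_op dx c (tconv dx (parametrix dx c) (Phi dx c) t) \<alpha> \<beta> = tconv dx (\<lambda>t. diff_op dx c (parametrix dx c t)) (Phi dx c) t \<alpha> \<beta>"
      by (rule tconv_stencil[OF k(1,4) dx0 t, symmetric])
    also have "(\<lambda>t. diff_op dx c (parametrix dx c t)) = (\<lambda>t \<alpha> \<beta>. parametrix_deriv dx c t \<alpha> \<beta> + Kker dx c t \<alpha> \<beta>)"
      by (intro ext diff_op_parametrix)
    also have "tconv dx (\<lambda>t \<alpha> \<beta>. parametrix_deriv dx c t \<alpha> \<beta> + Kker dx c t \<alpha> \<beta>) (Phi dx c) t \<alpha> \<beta> =
        tconv dx (parametrix_deriv dx c) (Phi dx c) t \<alpha> \<beta> + tconv dx (Kker dx c) (Phi dx c) t \<alpha> \<beta>"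
      by (rule tconv_add_left[OF k(3,2,4) dx0 t])
    finally have 1: "diff_op dx c (\<Gamma> t) \<alpha> \<beta> = parametrix_deriv dx c t \<alpha> \<beta> + Kker dx c t \<alpha> \<beta> +
        (tconv dx (parametrix_deriv dx c) (Phi dx c) t \<alpha> \<beta> + tconv dx (Kker dx c) (Phi dx c) t \<alpha> \<beta>)" .
    show ?thesis
      unfolding 1 conv_parametrix_0[OF dx] Phi_Volterra[OF k(2) dx0 t, of \<alpha> \<beta>] by simp
  qed
  ultimately show ?thesis unfolding Gamma_eq by simp
qed

lemma Gamma_0: "\<Gamma> 0 = parametrix dx c 0"
  by (intro ext) (simp add: Gamma_eq tconv_def)

lemma Gamma_bounded:
  obtains M where "0 \<le> M" "\<And>t \<alpha> \<beta>. t \<in> {0..T} \<Longrightarrow> \<bar>\<Gamma> t \<alpha> \<beta>\<bar> \<le> M"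
proof -
  obtain C where C: "0 \<le> C" "\<And>t \<alpha> \<beta>. t \<in> {0..T} \<Longrightarrow> \<bar>\<Gamma> t \<alpha> \<beta>\<bar> \<le> C * env 1 (\<alpha> - \<beta>)"
    using kernel_onE[OF kernel_on_Gamma] by metis
  show ?thesis
  proof (rule that[OF C(1)])
    fix t \<alpha> \<beta> assume "t \<in> {0..T}"
    then have "\<bar>\<Gamma> t \<alpha> \<beta>\<bar> \<le> C * env 1 (\<alpha> - \<beta>)" by (rule C)
    also have "\<dots> \<le> C * 1" using C(1) by (intro mult_left_mono env_le_1) auto
    finally show "\<bar>\<Gamma> t \<alpha> \<beta>\<bar> \<le> C" by simp
  qed
qed

text \<open>
  The operator is bounded by \<open>op_const\<close>, so \<open>\<Gamma>\<close> and then also \<open>\<Gamma>' = A \<Gamma>\<close> are Lipschitz in time,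
  uniformly in the indices.
\<close>

lemma Gamma_fundamental_solution: "fundamental_solution dx c \<Gamma>"
  unfolding fundamental_solution_def
proof (intro conjI allI impI)
  fix T :: real assume T: "0 < T"
  obtain M where M: "0 \<le> M" "\<And>t \<alpha> \<beta>. t \<in> {0..T} \<Longrightarrow> \<bar>\<Gamma> t \<alpha> \<beta>\<bar> \<le> M"
    using Gamma_bounded[of T thesis] by blast
  have D: "\<bar>diff_op dx c (\<Gamma> t) \<alpha> \<beta>\<bar> \<le> op_const * M" if "t \<in> {0..T}" for t \<alpha> \<beta>
    by (rule diff_op_le) (rule M(2)[OF that])
  have lip: "\<bar>\<Gamma> t \<alpha> \<beta> - \<Gamma> s \<alpha> \<beta>\<bar> \<le> (op_const * M) * \<bar>t - s\<bar>" if "t \<in> {0..T}" "s \<in> {0..T}" for t s \<alpha> \<beta>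
    using field_differentiable_bound[of "{0..T}" "\<lambda>t. \<Gamma> t \<alpha> \<beta>" "\<lambda>t. diff_op dx c (\<Gamma> t) \<alpha> \<beta>" "op_const * M" t s,
        OF convex_real_interval(5) Gamma_has_derivative _ that] D
    unfolding real_norm_def by blast
  have lipD: "\<bar>diff_op dx c (\<Gamma> t) \<alpha> \<beta> - diff_op dx c (\<Gamma> s) \<alpha> \<beta>\<bar> \<le> (op_const * (op_const * M) + 1) * \<bar>t - s\<bar>"
    if ts: "t \<in> {0..T}" "s \<in> {0..T}" for t s \<alpha> \<beta>
  proof -
    have "\<bar>diff_op dx c (\<Gamma> t) \<alpha> \<beta> - diff_op dx c (\<Gamma> s) \<alpha> \<beta>\<bar> \<le> op_const * (op_const * M * \<bar>t - s\<bar>)"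
      unfolding diff_op_diff by (rule diff_op_le) (rule lip[OF ts])
    also have "\<dots> \<le> (op_const * (op_const * M) + 1) * \<bar>t - s\<bar>" by (simp add: distrib_right mult.assoc)
    finally show ?thesis .
  qed
  have "0 < op_const * (op_const * M) + 1" using op_const_pos M(1) by (simp add: add_nonneg_pos)
  then show "C1_Linfty T \<Gamma>"
    using M(2) D lipD Gamma_has_derivative
    by (intro C1_LinftyI[of T \<Gamma> "\<lambda>t. diff_op dx c (\<Gamma> t)" "max M (op_const * M)"])
       (simp_all only: le_max_iff_disj simp_thms)
next
  fix \<alpha> \<beta> and t :: real assume t: "0 < t"
  have "((\<lambda>t. \<Gamma> t \<alpha> \<beta>) has_real_derivative diff_op dx c (\<Gamma> t) \<alpha> \<beta>) (at t within {0..t + 1})"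
    using t by (intro Gamma_has_derivative) auto
  moreover have "at t within {0..t + 1} = at t" using t by (intro at_within_interior) auto
  ultimately show "((\<lambda>\<tau>. \<Gamma> \<tau> \<alpha> \<beta>) has_real_derivative
      (\<Sum>j\<in>UNIV. c j \<alpha> * Dplus dx j (Dminus dx j (\<lambda>\<gamma>. \<Gamma> t \<gamma> \<beta>)) \<alpha>)) (at t)"
    by (simp add: diff_op_def)
next
  fix \<alpha> \<beta> show "\<Gamma> 0 \<alpha> \<beta> = dirac dx (\<alpha> - \<beta>)" by (simp add: Gamma_0 parametrix_0)
qed

text \<open>
  As functions of \<open>t\<close>, both sides are bounded solutions of the same linear equation with the same
  initial value \<open>\<Gamma>(\<tau>)\<close>.
\<close>

lemma Gamma_semigroup_aux:
  assumes "0 \<le> \<tau>" and t: "t \<in> {0..T}"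
  shows "conv dx (\<Gamma> t) (\<Gamma> \<tau>) \<alpha> \<beta> = \<Gamma> (t + \<tau>) \<alpha> \<beta>"
proof -
  define u where "u t \<gamma> = conv dx (\<Gamma> t) (\<Gamma> \<tau>) \<gamma> \<beta> - \<Gamma> (t + \<tau>) \<gamma> \<beta>" for t \<gamma>
  have \<tau>: "\<tau> \<in> {0..\<tau>}" using assms by simp
  obtain M where M: "0 \<le> M" "\<And>t \<alpha> \<beta>. t \<in> {0..T + \<tau>} \<Longrightarrow> \<bar>\<Gamma> t \<alpha> \<beta>\<bar> \<le> M"
    using Gamma_bounded[of "T + \<tau>" thesis] by blast
  obtain C where C: "0 \<le> C" "\<And>t \<alpha> \<beta>. t \<in> {0..T + \<tau>} \<Longrightarrow> \<bar>\<Gamma> t \<alpha> \<beta>\<bar> \<le> C * env 1 (\<alpha> - \<beta>)"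
    using kernel_onE[OF kernel_on_Gamma] by metis
  have "u t \<alpha> = 0"
  proof (rule bounded_linear_ode_unique[where u = u and D = "\<lambda>t \<gamma>. diff_op dx c (\<lambda>\<gamma> _. u t \<gamma>) \<gamma> \<beta>"
        and M = "(dx * (32 * (1 + pi))) ^ CARD('d) * C * C * 1 + M" and \<Lambda> = op_const, OF _ _ _ _ t])
    fix t \<gamma> assume t: "t \<in> {0..T}"
    have "((\<lambda>t. conv dx (\<Gamma> t) (\<Gamma> \<tau>) \<gamma> \<beta>) has_real_derivative conv dx (diff_op dx c (\<Gamma> t)) (\<Gamma> \<tau>) \<gamma> \<beta>) (at t within {0..T})"
      by (rule conv_has_derivative[OF kernel_on_Gamma kernel_on_diff_op[OF kernel_on_Gamma] kernel_on_Gamma dx0 Gamma_has_derivative t \<tau>])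
    then have 1: "((\<lambda>t. conv dx (\<Gamma> t) (\<Gamma> \<tau>) \<gamma> \<beta>) has_real_derivative diff_op dx c (conv dx (\<Gamma> t) (\<Gamma> \<tau>)) \<gamma> \<beta>) (at t within {0..T})"
      by (simp only: conv_stencil[OF kernel_on_Gamma kernel_on_Gamma t \<tau>])
    have "((\<lambda>t. \<Gamma> t \<gamma> \<beta>) has_real_derivative diff_op dx c (\<Gamma> (t + \<tau>)) \<gamma> \<beta>) (at (t + \<tau>) within (\<lambda>t. t + \<tau>) ` {0..T})"
      using t assms by (intro DERIV_subset[OF Gamma_has_derivative[of "t + \<tau>" "T + \<tau>"]]) auto
    moreover have "((\<lambda>t. t + \<tau>) has_real_derivative 1) (at t within {0..T})" by (auto intro!: derivative_eq_intros)
    ultimately have 2: "((\<lambda>t. \<Gamma> (t + \<tau>) \<gamma> \<beta>) has_real_derivative diff_op dx c (\<Gamma> (t + \<tau>)) \<gamma> \<beta>) (at t within {0..T})"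
      using DERIV_image_chain[of "\<lambda>t. \<Gamma> t \<gamma> \<beta>" _ "\<lambda>t. t + \<tau>"] unfolding o_def by fastforce
    have "diff_op dx c (conv dx (\<Gamma> t) (\<Gamma> \<tau>)) \<gamma> \<beta> - diff_op dx c (\<Gamma> (t + \<tau>)) \<gamma> \<beta> = diff_op dx c (\<lambda>\<gamma> _. u t \<gamma>) \<gamma> \<beta>"
      unfolding diff_op_diff unfolding diff_op_stencil u_def ..
    then show "((\<lambda>t. u t \<gamma>) has_real_derivative diff_op dx c (\<lambda>\<gamma> _. u t \<gamma>) \<gamma> \<beta>) (at t within {0..T})"
      using DERIV_diff[OF 1 2] by (simp add: u_def)
  next
    fix t \<gamma> assume t: "t \<in> {0..T}"
    have "\<bar>conv dx (\<Gamma> t) (\<Gamma> \<tau>) \<gamma> \<beta>\<bar> \<le> (dx * (32 * (1 + pi))) ^ CARD('d) * C * C * env 1 (\<gamma> - \<beta>)"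
      using t assms C dx0 by (intro kernel_on_conv_bound) auto
    also have "\<dots> \<le> (dx * (32 * (1 + pi))) ^ CARD('d) * C * C * 1"
      using C dx0 by (intro mult_left_mono env_le_1) auto
    finally show "\<bar>u t \<gamma>\<bar> \<le> (dx * (32 * (1 + pi))) ^ CARD('d) * C * C * 1 + M"
      using M(2)[of "t + \<tau>" \<gamma> \<beta>] t assms unfolding u_def by auto
  next
    fix t B and \<gamma> :: "int ^ 'd" assume "\<And>\<gamma>. \<bar>u t \<gamma>\<bar> \<le> B"
    then show "\<bar>diff_op dx c (\<lambda>\<gamma> _. u t \<gamma>) \<gamma> \<beta>\<bar> \<le> op_const * B" by (intro diff_op_le)
  next
    show "u 0 = (\<lambda>\<gamma>. 0)" by (intro ext) (simp add: u_def Gamma_0 conv_parametrix_0[OF dx])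
  qed
  then show ?thesis by (simp add: u_def)
qed

lemma Gamma_semigroup:
  assumes "s \<in> {0..t}"
  shows "conv_summable (\<Gamma> s) (\<Gamma> (t - s))" "\<Gamma> t \<alpha> \<beta> = conv dx (\<Gamma> s) (\<Gamma> (t - s)) \<alpha> \<beta>"
proof -
  show "conv_summable (\<Gamma> s) (\<Gamma> (t - s))"
    using assms by (intro kernel_on_conv_summable[OF kernel_on_Gamma kernel_on_Gamma, of _ t _ t]) auto
  show "\<Gamma> t \<alpha> \<beta> = conv dx (\<Gamma> s) (\<Gamma> (t - s)) \<alpha> \<beta>"
    using assms Gamma_semigroup_aux[of "t - s" s t \<alpha> \<beta>] by simp
qed

lemma all_kernels_well_defined: "kernels_well_defined dx c"
  unfolding kernels_well_defined_def
proof (intro allI impI conjI ballI)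
  fix t :: real assume t: "0 \<le> t"
  note k = kernels_nonneg_times[where T = t]
  have tt: "t \<in> {0..t}" using t by simp
  {
    fix m :: nat assume "1 \<le> m"
    then obtain m' where m: "m = Suc m'" by (cases m) auto
    have km: "kernel_on {0..t} (Kiter dx c m)" unfolding m by (rule kernel_on_Kiter[OF k(2) dx0])
    fix s assume "s \<in> {0..t}"
    then show "conv_summable (Kker dx c (t - s)) (Kiter dx c m s)"
      by (intro kernel_on_conv_summable[OF k(2) km]) auto
  next
    fix m :: nat and \<alpha> \<beta> assume "1 \<le> m"
    then obtain m' where m: "m = Suc m'" by (cases m) auto
    have km: "kernel_on {0..t} (Kiter dx c m)" unfolding m by (rule kernel_on_Kiter[OF k(2) dx0])
    show "(\<lambda>s. conv dx (Kker dx c (t - s)) (Kiter dx c m s) \<alpha> \<beta>) integrable_on {0..t}"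
      by (rule tconv_integrable[OF k(2) km dx0 tt])
  next
    fix \<alpha> \<beta> show "summable (\<lambda>m. Kiter dx c (Suc m) t \<alpha> \<beta>)" by (rule Phi_summable[OF k(2) dx0 tt])
  next
    fix s assume "s \<in> {0..t}"
    then have "conv_summable (parametrix dx c (t - s)) (Phi dx c s)"
      by (intro kernel_on_conv_summable[OF k(1,4)]) auto
    then show "conv_summable (\<lambda>\<alpha> \<eta>. frozen dx c (t - s) (\<alpha> - \<eta>) \<eta>) (Phi dx c s)"
      by (simp add: conv_summable_def parametrix_def)
  next
    fix \<alpha> \<beta>
    show "(\<lambda>s. \<Sum>\<^sub>\<infinity>\<eta>. frozen dx c (t - s) (\<alpha> - \<eta>) \<eta> * Phi dx c s \<eta> \<beta> * dx ^ CARD('d)) integrable_on {0..t}"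
      using tconv_integrable[OF k(1,4) dx0 tt, of \<alpha> \<beta>] by (simp only: conv_def parametrix_def)
  }
qed

end

section \<open>Bounds uniform in the mesh size\<close>

lemma has_integral_inverse_sqrt:
  assumes "0 < t"
  shows "((\<lambda>s. 1 / sqrt s) has_integral 2 * sqrt t) {0..t}"
    and "((\<lambda>s. 1 / sqrt (t - s)) has_integral 2 * sqrt t) {0..t}"
proof -
  have "((\<lambda>s. 1 / sqrt s) has_integral (2 * sqrt t - 2 * sqrt 0)) {0..t}"
  proof (rule fundamental_theorem_of_calculus_interior[where f = "\<lambda>s. 2 * sqrt s"])
    fix s assume "s \<in> {0<..<t}"
    then have "((\<lambda>s. 2 * sqrt s) has_real_derivative 1 / sqrt s) (at s)"
      using DERIV_cmult[OF DERIV_real_sqrt, of s 2] by (simp add: inverse_eq_divide)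
    then show "((\<lambda>s. 2 * sqrt s) has_vector_derivative 1 / sqrt s) (at s)"
      by (simp add: has_real_derivative_iff_has_vector_derivative)
  qed (use assms in \<open>auto intro!: continuous_intros\<close>)
  then show "((\<lambda>s. 1 / sqrt s) has_integral 2 * sqrt t) {0..t}" by simp
  have "((\<lambda>s. 1 / sqrt (t - s)) has_integral (- 2 * sqrt (t - t) - (- 2 * sqrt (t - 0)))) {0..t}"
  proof (rule fundamental_theorem_of_calculus_interior[where f = "\<lambda>s. - 2 * sqrt (t - s)"])
    fix s assume "s \<in> {0<..<t}"
    then have "((\<lambda>s. - 2 * sqrt (t - s)) has_real_derivative 1 / sqrt (t - s)) (at s)"
    proof -
      have "((\<lambda>s. t - s) has_real_derivative - 1) (at s)" by (auto intro!: derivative_eq_intros)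
      moreover have "0 < t - s" using \<open>s \<in> {0<..<t}\<close> by simp
      ultimately show ?thesis
        using DERIV_cmult[OF DERIV_chain2[OF DERIV_real_sqrt, of "\<lambda>s. t - s" s "- 1" UNIV], of "- 2"]
        by (simp add: inverse_eq_divide)
    qed
    then show "((\<lambda>s. - 2 * sqrt (t - s)) has_vector_derivative 1 / sqrt (t - s)) (at s)"
      by (simp add: has_real_derivative_iff_has_vector_derivative)
  qed (use assms in \<open>auto intro!: continuous_intros\<close>)
  then show "((\<lambda>s. 1 / sqrt (t - s)) has_integral 2 * sqrt t) {0..t}" by simp
qed

text \<open>
  A substitute for the Beta integral: the two singularities are separated because \<open>\<surd>t \<le> \<surd>s + \<surd>(t -
  s)\<close>.
\<close>

lemma inverse_sqrt_product_le:
  assumes "0 < s" "s < t"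
  shows "1 / sqrt (t - s) * (1 / sqrt s) \<le> 1 / sqrt t * (1 / sqrt s + 1 / sqrt (t - s))"
proof -
  define a b where "a = sqrt (t - s)" and "b = sqrt s"
  have ab: "0 < a" "0 < b" using assms by (auto simp: a_def b_def)
  have t: "0 < sqrt t" using assms by simp
  have "sqrt t \<le> a + b"
  proof (rule real_le_lsqrt)
    have "t = a\<^sup>2 + b\<^sup>2" using assms by (simp add: a_def b_def)
    also have "\<dots> \<le> (a + b)\<^sup>2" using ab by (simp add: power2_sum)
    finally show "t \<le> (a + b)\<^sup>2" .
  qed (use ab in simp)
  then have "1 \<le> (a + b) / sqrt t" using t by simp
  then have "1 / (a * b) * 1 \<le> 1 / (a * b) * ((a + b) / sqrt t)" using ab by (intro mult_left_mono) auto
  also have "\<dots> = 1 / sqrt t * (1 / b + 1 / a)" using ab t by (simp add: field_simps)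
  finally show ?thesis by (simp add: a_def b_def)
qed

text \<open>
  This integral bounds that of \<open>e\<^sup>-\<^sup>l\<^sup>u / \<surd>u\<close>, since \<open>e\<^sup>l\<^sup>u \<ge> 1 + l u\<close>. It is at most \<open>\<pi> / \<surd>l\<close>,
  which is small for \<open>l\<close> large.
\<close>

lemma has_integral_arctan_kernel:
  assumes "0 < t" "0 < l"
  shows "((\<lambda>s. 1 / (sqrt (t - s) * (1 + l * (t - s)))) has_integral 2 / sqrt l * arctan (sqrt l * sqrt t)) {0..t}"
proof -
  have "((\<lambda>s. 1 / (sqrt (t - s) * (1 + l * (t - s)))) has_integral
     (- (2 / sqrt l) * arctan (sqrt l * sqrt (t - t)) - (- (2 / sqrt l) * arctan (sqrt l * sqrt (t - 0))))) {0..t}"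
  proof (rule fundamental_theorem_of_calculus_interior[where f = "\<lambda>s. - (2 / sqrt l) * arctan (sqrt l * sqrt (t - s))"])
    fix s assume s: "s \<in> {0<..<t}"
    define a where "a = sqrt (t - s)"
    have a: "0 < a" "a\<^sup>2 = t - s" using s by (auto simp: a_def)
    have "((\<lambda>s. sqrt l * sqrt (t - s)) has_real_derivative sqrt l * (- (inverse a / 2))) (at s)"
      using s unfolding a_def by (auto intro!: derivative_eq_intros)
    from DERIV_cmult[OF DERIV_chain2[OF DERIV_arctan this], of "- (2 / sqrt l)"]
    have "((\<lambda>s. - (2 / sqrt l) * arctan (sqrt l * sqrt (t - s))) has_real_derivative
        - (2 / sqrt l) * (inverse (1 + (sqrt l * a)\<^sup>2) * (sqrt l * (- (inverse a / 2))))) (at s)" by (simp add: a_def)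
    moreover have "- (2 / sqrt l) * (inverse (1 + (sqrt l * a)\<^sup>2) * (sqrt l * (- (inverse a / 2)))) = 1 / (a * (1 + l * (t - s)))"
    proof -
      have 1: "(sqrt l * a)\<^sup>2 = l * (t - s)" using assms a by (simp add: power_mult_distrib)
      have 2: "- (2 / r) * (X * (r * (- (y / 2)))) = X * y" if "r \<noteq> 0" for r X y :: real
        using that by simp
      have "sqrt l \<noteq> 0" using assms by simp
      from 2[OF this] show ?thesis unfolding 1 by (simp only: divide_inverse inverse_mult_distrib mult_1_left mult.commute)
    qed
    ultimately show "((\<lambda>s. - (2 / sqrt l) * arctan (sqrt l * sqrt (t - s))) has_vector_derivative 1 / (sqrt (t - s) * (1 + l * (t - s)))) (at s)"
      by (simp add: has_real_derivative_iff_has_vector_derivative a_def)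
  qed (use assms in \<open>auto intro!: continuous_intros\<close>)
  then show ?thesis by simp
qed

context coeffs
begin

text \<open>
  The envelope at time \<open>t\<close> in physical units: its mass with respect to \<open>dx ^ CARD('d)\<close> is bounded,
  and so is its supremum multiplied by \<open>t\<^sup>d\<^sup>/\<^sup>2\<close>.
\<close>

definition scaled :: "real \<Rightarrow> int ^ 'd \<Rightarrow> int ^ 'd \<Rightarrow> real" where
  "scaled t \<alpha> \<beta> = env (t / dx\<^sup>2) (\<alpha> - \<beta>) / dx ^ CARD('d)"

lemma scaled_nonneg: "0 < t \<Longrightarrow> 0 \<le> scaled t \<alpha> \<beta>"
  using dx by (simp add: scaled_def env_nonneg)

text \<open>
  The envelopes combine by \<open>conv_env_bound\<close>, so only a scalar convolution in time is left to
  estimate. Its integrand may be singular at both ends.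
\<close>

lemma tconv_scaled_bound:
  assumes kF: "kernel_on {0..T} F" and kH: "kernel_on {0..T} H" and t: "0 < t" "t \<le> T"
    and F: "\<And>u \<alpha> \<beta>. 0 < u \<Longrightarrow> u \<le> T \<Longrightarrow> \<bar>F u \<alpha> \<beta>\<bar> \<le> \<phi> u * scaled u \<alpha> \<beta>"
    and H: "\<And>u \<alpha> \<beta>. 0 < u \<Longrightarrow> u \<le> T \<Longrightarrow> \<bar>H u \<alpha> \<beta>\<bar> \<le> \<omega> u * scaled u \<alpha> \<beta>"
    and \<psi>: "\<And>s. 0 < s \<Longrightarrow> s < t \<Longrightarrow> \<phi> (t - s) * \<omega> s \<le> \<psi> s" and J: "(\<psi> has_integral J) {0..t}"
  shows "\<bar>tconv dx F H t \<alpha> \<beta>\<bar> \<le> (16 * (1 + pi)) ^ CARD('d) * J * scaled t \<alpha> \<beta>"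
proof -
  define Q where "Q = (16 * (1 + pi)) ^ CARD('d)"
  have Q: "0 \<le> Q" by (simp add: Q_def)
  note e = scaled_nonneg[OF t(1), of \<alpha> \<beta>]
  have i1: "(\<lambda>s. conv dx (F (t - s)) (H s) \<alpha> \<beta>) integrable_on {0..t}"
    using t by (intro tconv_integrable[OF kF kH dx0]) auto
  have i2: "((\<lambda>s. (Q * scaled t \<alpha> \<beta>) * \<psi> s) has_integral (Q * scaled t \<alpha> \<beta>) * J) {0..t}"
    by (intro has_integral_mult_right J)
  have "norm (integral {0<..<t} (\<lambda>s. conv dx (F (t - s)) (H s) \<alpha> \<beta>)) \<le> integral {0<..<t} (\<lambda>s. (Q * scaled t \<alpha> \<beta>) * \<psi> s)"
  proof (rule integral_norm_bound_integral)
    show "(\<lambda>s. conv dx (F (t - s)) (H s) \<alpha> \<beta>) integrable_on {0<..<t}"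
      using i1 by (simp add: integrable_on_open_interval_real)
    show "(\<lambda>s. (Q * scaled t \<alpha> \<beta>) * \<psi> s) integrable_on {0<..<t}"
      using i2 by (simp add: integrable_on_open_interval_real has_integral_integrable)
    fix s assume s: "s \<in> {0<..<t}"
    have D: "0 < dx ^ CARD('d)" using dx by simp
    have "\<bar>conv dx (F (t - s)) (H s) \<alpha> \<beta>\<bar> \<le> dx ^ CARD('d) * (16 * (1 + pi)) ^ CARD('d) * (\<phi> (t - s) / dx ^ CARD('d))
        * (\<omega> s / dx ^ CARD('d)) * env ((t - s) / dx\<^sup>2 + s / dx\<^sup>2) (\<alpha> - \<beta>)"
    proof (rule conv_env_bound(2))
      fix \<eta>
      show "\<bar>F (t - s) \<alpha> \<eta>\<bar> \<le> \<phi> (t - s) / dx ^ CARD('d) * env ((t - s) / dx\<^sup>2) (\<alpha> - \<eta>)"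
        using F[of "t - s" \<alpha> \<eta>] s t by (simp add: scaled_def)
      show "\<bar>H s \<eta> \<beta>\<bar> \<le> \<omega> s / dx ^ CARD('d) * env (s / dx\<^sup>2) (\<eta> - \<beta>)"
        using H[of s \<eta> \<beta>] s t by (simp add: scaled_def)
    qed (use s dx in auto)
    also have "(t - s) / dx\<^sup>2 + s / dx\<^sup>2 = t / dx\<^sup>2" by (simp add: diff_divide_distrib)
    also have "dx ^ CARD('d) * (16 * (1 + pi)) ^ CARD('d) * (\<phi> (t - s) / dx ^ CARD('d)) * (\<omega> s / dx ^ CARD('d)) * env (t / dx\<^sup>2) (\<alpha> - \<beta>)
        = (Q * scaled t \<alpha> \<beta>) * (\<phi> (t - s) * \<omega> s)"
      using D unfolding Q_def[symmetric] scaled_def by simp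
    also have "\<dots> \<le> (Q * scaled t \<alpha> \<beta>) * \<psi> s"
      using s Q e by (intro mult_left_mono \<psi> mult_nonneg_nonneg) auto
    finally show "norm (conv dx (F (t - s)) (H s) \<alpha> \<beta>) \<le> (Q * scaled t \<alpha> \<beta>) * \<psi> s" by simp
  qed
  moreover have "integral {0<..<t} f = integral {0..t} f" for f :: "real \<Rightarrow> real"
    by (simp add: integral_open_interval_real)
  ultimately have "\<bar>tconv dx F H t \<alpha> \<beta>\<bar> \<le> (Q * scaled t \<alpha> \<beta>) * J"
    unfolding tconv_def integral_unique[OF i2, symmetric] by (simp only: real_norm_def)
  also have "\<dots> = Q * J * scaled t \<alpha> \<beta>" by simp
  finally show ?thesis unfolding Q_def .
qed

text \<open>
  The uniform bounds, in terms of the constant \<open>B\<close> of \<open>walk_bounded_uniform\<close>. That constant is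
  chosen before the mesh and the coefficients.
\<close>

context
  fixes B :: real
  assumes B1: "1 \<le> B"
    and B: "\<And>\<kappa> \<tau>. 2 * lo \<le> \<kappa> \<Longrightarrow> \<kappa> \<le> 2 * hi \<Longrightarrow> 0 < \<tau> \<Longrightarrow> walk_bounded B \<tau> (\<kappa> * \<tau>)"
begin

lemma walk_bounded_scaled:
  assumes "0 < t" shows "walk_bounded B (t / dx\<^sup>2) (2 * c j \<beta> * t / dx\<^sup>2)"
  using B[of "2 * c j \<beta>" "t / dx\<^sup>2"] c_bounds[of j \<beta>] assms dx by simp

lemma parametrix_scaled_bound:
  assumes "0 < t" shows "\<bar>parametrix dx c t \<alpha> \<beta>\<bar> \<le> B ^ CARD('d) * scaled t \<alpha> \<beta>"
proof -
  have "0 < t / dx\<^sup>2" using assms dx by simp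
  from parametrix_bound[where c = c, OF dx this walk_bounded_scaled[OF assms]] show ?thesis by (simp add: scaled_def)
qed

lemma Kker_scaled_bound:
  assumes "0 < t"
  shows "\<bar>Kker dx c t \<alpha> \<beta>\<bar> \<le> (real CARD('d))\<^sup>2 * \<bar>L\<bar> * B ^ CARD('d) * (1 / sqrt t) * scaled t \<alpha> \<beta>"
proof -
  have p: "0 < t / dx\<^sup>2" using assms dx by simp
  have s: "dx * sqrt (t / dx\<^sup>2) = sqrt t" using dx by (simp add: real_sqrt_divide)
  from Kker_bound[where c = c and L = "\<bar>L\<bar>", OF dx p walk_bounded_scaled[OF assms] c_lipschitz abs_ge_zero]
  show ?thesis unfolding s by (simp add: scaled_def mult_ac)
qed

text \<open>
  One convolution removes the singularity \<open>1 / \<surd>t\<close> of \<open>K\<close>. From \<open>K\<^sup>(\<^sup>2\<^sup>)\<close> on, the weight \<open>e\<^sup>l\<^sup>t\<close>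
  with the given \<open>l\<close> makes each further convolution a contraction with factor one half.
\<close>

lemma Kiter_scaled_bound:
  assumes A: "0 \<le> A" "\<And>t \<alpha> \<beta>. 0 < t \<Longrightarrow> \<bar>Kker dx c t \<alpha> \<beta>\<bar> \<le> A * (1 / sqrt t) * scaled t \<alpha> \<beta>"
    and Q: "Q = (16 * (1 + pi)) ^ CARD('d)" and l: "l = (2 * Q * A * pi + 1)\<^sup>2" and "0 < t"
  shows "\<bar>Kiter dx c (Suc (Suc m)) t \<alpha> \<beta>\<bar> \<le> 4 * Q * A\<^sup>2 * (1/2) ^ m * exp (l * t) * scaled t \<alpha> \<beta>"
  using \<open>0 < t\<close>
proof (induction m arbitrary: t \<alpha> \<beta>)
  have Qp: "0 < Q" unfolding Q using pi_gt_zero by (intro zero_less_power mult_pos_pos add_pos_pos) auto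
  then have Q0: "0 \<le> Q" by simp
  have q: "0 \<le> 2 * Q * A * pi" using Q0 A by simp
  have l1: "1 \<le> l" unfolding l using q by (intro one_le_power) simp
  {
    case (0 t \<alpha> \<beta>)
    have "((\<lambda>s. A\<^sup>2 * (1 / sqrt t * (1 / sqrt s + 1 / sqrt (t - s)))) has_integral A\<^sup>2 * (1 / sqrt t * (2 * sqrt t + 2 * sqrt t))) {0..t}"
      using has_integral_inverse_sqrt[OF 0] by (intro has_integral_mult_right has_integral_add)
    from tconv_scaled_bound[OF kernels_nonneg_times(2) kernels_nonneg_times(2) 0 order_refl A(2) A(2) _ this, of \<alpha> \<beta>]
    have "\<bar>tconv dx (Kker dx c) (Kker dx c) t \<alpha> \<beta>\<bar> \<le> Q * (A\<^sup>2 * (1 / sqrt t * (2 * sqrt t + 2 * sqrt t))) * scaled t \<alpha> \<beta>"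
      unfolding Q[symmetric]
      using mult_left_mono[OF inverse_sqrt_product_le, of _ t "A\<^sup>2"] by (simp add: power2_eq_square mult_ac)
    also have "\<dots> = 4 * Q * A\<^sup>2 * 1 * scaled t \<alpha> \<beta>" using 0 by simp
    also have "\<dots> \<le> 4 * Q * A\<^sup>2 * exp (l * t) * scaled t \<alpha> \<beta>"
      using 0 Q0 l1 scaled_nonneg[OF 0] by (intro mult_right_mono mult_left_mono) auto
    finally show ?case unfolding Kiter_Suc_Suc Kiter.simps(2) by simp
  next
    case (Suc m t \<alpha> \<beta>)
    define b where "b = 4 * Q * A\<^sup>2 * (1/2) ^ m"
    have b: "0 \<le> b" using Q0 by (simp add: b_def)
    have l0: "0 < l" using l1 by simp
    define J where "J = A * b * exp (l * t) * (2 / sqrt l * arctan (sqrt l * sqrt t))"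
    have J: "((\<lambda>s. A * b * exp (l * t) * (1 / (sqrt (t - s) * (1 + l * (t - s))))) has_integral J) {0..t}"
      unfolding J_def by (intro has_integral_mult_right has_integral_arctan_kernel Suc.prems l0)
    have "\<bar>tconv dx (Kker dx c) (Kiter dx c (Suc (Suc m))) t \<alpha> \<beta>\<bar> \<le> (16 * (1 + pi)) ^ CARD('d) * J * scaled t \<alpha> \<beta>"
    proof (rule tconv_scaled_bound[OF kernels_nonneg_times(2) kernel_on_Kiter[OF kernels_nonneg_times(2) dx0] Suc.prems order_refl A(2) _ _ J])
      fix u :: real and \<alpha> \<beta> :: "int ^ 'd" assume "0 < u"
      then show "\<bar>Kiter dx c (Suc (Suc m)) u \<alpha> \<beta>\<bar> \<le> (b * exp (l * u)) * scaled u \<alpha> \<beta>"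
        unfolding b_def by (rule Suc.IH)
    next
      fix s assume s: "0 < s" "s < t"
      have x: "0 \<le> l * (t - s)" using s l0 by simp
      have "exp (l * s) * (1 + l * (t - s)) \<le> exp (l * s) * exp (l * (t - s))"
        by (intro mult_left_mono exp_ge_add_one_self) simp
      also have "\<dots> = exp (l * t)" by (simp add: exp_add[symmetric] algebra_simps)
      finally have "exp (l * s) \<le> exp (l * t) / (1 + l * (t - s))" using x by (simp add: le_divide_eq add_pos_nonneg)
      then have "(A * b / sqrt (t - s)) * exp (l * s) \<le> (A * b / sqrt (t - s)) * (exp (l * t) / (1 + l * (t - s)))"
        using A b s by (intro mult_left_mono) auto
      then show "A * (1 / sqrt (t - s)) * (b * exp (l * s)) \<le> A * b * exp (l * t) * (1 / (sqrt (t - s) * (1 + l * (t - s))))"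
        by (simp add: mult_ac)
    qed
    also have "\<dots> \<le> Q * ((1/2) * (b * exp (l * t)) / Q) * scaled t \<alpha> \<beta>"
    proof -
      have sl: "sqrt l = 2 * Q * A * pi + 1" unfolding l using q by (simp only: real_sqrt_abs)
      have "2 / sqrt l * arctan (sqrt l * sqrt t) \<le> 2 / sqrt l * (pi / 2)"
        using l0 arctan_ubound[of "sqrt l * sqrt t"] by (intro mult_left_mono) auto
      then have "J \<le> A * b * exp (l * t) * (2 / sqrt l * (pi / 2))"
        unfolding J_def by (rule mult_left_mono) (use A(1) b in simp)
      also have "\<dots> = (A * pi / sqrt l) * (b * exp (l * t))" by simp
      also have "\<dots> \<le> (1 / (2 * Q)) * (b * exp (l * t))"
      proof (intro mult_right_mono)
        show "A * pi / sqrt l \<le> 1 / (2 * Q)" proof -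
          have "0 < sqrt l" using l0 by simp
          moreover have "A * pi * (2 * Q) \<le> sqrt l" unfolding sl by (simp add: mult_ac)
          ultimately show ?thesis using Qp by (simp add: divide_le_eq le_divide_eq mult_ac)
        qed
      qed (use b in simp)
      also have "\<dots> = (1/2) * (b * exp (l * t)) / Q" by simp
      finally show ?thesis unfolding Q[symmetric] using Qp scaled_nonneg[OF Suc.prems]
        by (intro mult_right_mono mult_left_mono) auto
    qed
    also have "\<dots> = 4 * Q * A\<^sup>2 * (1/2) ^ Suc m * exp (l * t) * scaled t \<alpha> \<beta>"
    proof -
      have "Q * (x / Q) = x" for x using Qp by simp
      then show ?thesis by (simp only: b_def power_Suc mult_ac)
    qed
    finally show ?case unfolding Kiter_Suc_Suc[of dx c "Suc m"] .
  }
qed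

text \<open>
  The first term of the series is singular at \<open>t = 0\<close>. The others are bounded there, and \<open>\<surd>T / \<surd>t
  \<ge> 1\<close> lets them share its form.
\<close>

lemma Phi_scaled_bound:
  fixes A Q l :: real
  defines "A \<equiv> (real CARD('d))\<^sup>2 * \<bar>L\<bar> * B ^ CARD('d)" and "Q \<equiv> (16 * (1 + pi)) ^ CARD('d)"
  defines "l \<equiv> (2 * Q * A * pi + 1)\<^sup>2"
  assumes t: "0 < t" "t \<le> T"
  shows "\<bar>Phi dx c t \<alpha> \<beta>\<bar> \<le> 2 * (A + 8 * Q * A\<^sup>2 * exp (l * T) * sqrt T) * (1 / sqrt t) * scaled t \<alpha> \<beta>"
proof -
  have A0: "0 \<le> A" using B1 by (simp add: A_def)
  have Q0: "0 \<le> Q" by (simp add: Q_def)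
  have l0: "0 \<le> l" by (simp add: l_def)
  let ?e = "scaled t \<alpha> \<beta>"
  have e: "0 \<le> ?e" by (rule scaled_nonneg[OF t(1)])
  have s: "0 < sqrt t" "sqrt t \<le> sqrt T" using t by auto
  define C where "C = (A + 8 * Q * A\<^sup>2 * exp (l * T) * sqrt T) * (1 / sqrt t)"
  have C: "C = A * (1 / sqrt t) + 8 * Q * A\<^sup>2 * exp (l * T) * (sqrt T / sqrt t)"
    by (simp add: C_def distrib_right add_divide_distrib)
  have st: "1 \<le> sqrt T / sqrt t" using s by simp
  have CA: "A * (1 / sqrt t) \<le> C" unfolding C using A0 Q0 s by simp
  have CB: "8 * Q * A\<^sup>2 * exp (l * t) \<le> C"
  proof -
    have "8 * Q * A\<^sup>2 * exp (l * t) * 1 \<le> 8 * Q * A\<^sup>2 * exp (l * T) * (sqrt T / sqrt t)"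
      using Q0 A0 st t l0 by (intro mult_mono) (auto intro!: mult_left_mono)
    moreover have "0 \<le> A * (1 / sqrt t)" using A0 s by simp
    ultimately show ?thesis unfolding C by linarith
  qed
  have "\<bar>Kiter dx c (Suc m) t \<alpha> \<beta>\<bar> \<le> C * (1/2) ^ m * ?e" for m
  proof (cases m)
    case 0
    have "\<bar>Kker dx c t \<alpha> \<beta>\<bar> \<le> A * (1 / sqrt t) * ?e" unfolding A_def by (rule Kker_scaled_bound[OF t(1)])
    also have "\<dots> \<le> C * ?e" using CA e by (intro mult_right_mono)
    finally show ?thesis using 0 by simp
  next
    case (Suc k)
    have "\<bar>Kiter dx c (Suc (Suc k)) t \<alpha> \<beta>\<bar> \<le> 4 * Q * A\<^sup>2 * (1/2) ^ k * exp (l * t) * ?e"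
    proof (rule Kiter_scaled_bound[OF A0])
      show "\<bar>Kker dx c t \<alpha> \<beta>\<bar> \<le> A * (1 / sqrt t) * scaled t \<alpha> \<beta>" if "0 < t" for t \<alpha> \<beta>
        unfolding A_def by (rule Kker_scaled_bound[OF that])
    qed (simp_all only: Q_def l_def t)
    also have "\<dots> = 8 * Q * A\<^sup>2 * exp (l * t) * ((1/2) ^ Suc k * ?e)" by simp
    also have "\<dots> \<le> C * ((1/2) ^ Suc k * ?e)" using CB e by (intro mult_right_mono) auto
    finally show ?thesis by (simp only: Suc mult.assoc)
  qed
  from Phi_tail(2)[where M = 0, OF this] show ?thesis by (simp add: C_def)
qed

lemma Gamma_scaled_bound:
  fixes A Q l :: real
  defines "A \<equiv> (real CARD('d))\<^sup>2 * \<bar>L\<bar> * B ^ CARD('d)" and "Q \<equiv> (16 * (1 + pi)) ^ CARD('d)"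
  defines "l \<equiv> (2 * Q * A * pi + 1)\<^sup>2"
  assumes t: "0 < t" "t \<le> T"
  shows "\<bar>\<Gamma> t \<alpha> \<beta>\<bar> \<le> (B ^ CARD('d) + Q * (B ^ CARD('d) * (2 * (A + 8 * Q * A\<^sup>2 * exp (l * T) * sqrt T)) * (2 * sqrt T))) * scaled t \<alpha> \<beta>"
proof -
  define A' where "A' = 2 * (A + 8 * Q * A\<^sup>2 * exp (l * T) * sqrt T)"
  have A0: "0 \<le> A" using B1 by (simp add: A_def)
  have Q0: "0 \<le> Q" by (simp add: Q_def)
  have A'0: "0 \<le> A'" using A0 Q0 t by (simp add: A'_def)
  let ?e = "scaled t \<alpha> \<beta>" and ?P = "B ^ CARD('d)"
  have e: "0 \<le> ?e" by (rule scaled_nonneg[OF t(1)])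
  have Phi: "\<bar>Phi dx c u \<alpha> \<beta>\<bar> \<le> A' * (1 / sqrt u) * scaled u \<alpha> \<beta>" if "0 < u" "u \<le> T" for u \<alpha> \<beta>
    using Phi_scaled_bound[OF that, of \<alpha> \<beta>] unfolding A'_def A_def Q_def l_def .
  have J: "((\<lambda>s. ?P * A' * (1 / sqrt s)) has_integral ?P * A' * (2 * sqrt t)) {0..t}"
    by (intro has_integral_mult_right has_integral_inverse_sqrt t)
  have "\<bar>tconv dx (parametrix dx c) (Phi dx c) t \<alpha> \<beta>\<bar> \<le> (16 * (1 + pi)) ^ CARD('d) * (?P * A' * (2 * sqrt t)) * ?e"
    by (rule tconv_scaled_bound[OF kernels_nonneg_times(1,4) t parametrix_scaled_bound Phi _ J]) simp_all
  also have "\<dots> \<le> Q * (?P * A' * (2 * sqrt T)) * ?e"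
    unfolding Q_def[symmetric] using A'0 B1 Q0 e t by (intro mult_right_mono mult_left_mono) auto
  finally have "\<bar>tconv dx (parametrix dx c) (Phi dx c) t \<alpha> \<beta>\<bar> \<le> Q * (?P * A' * (2 * sqrt T)) * ?e" .
  then have "\<bar>\<Gamma> t \<alpha> \<beta>\<bar> \<le> ?P * ?e + Q * (?P * A' * (2 * sqrt T)) * ?e"
    unfolding Gamma_eq using parametrix_scaled_bound[OF t(1), of \<alpha> \<beta>] by linarith
  then show ?thesis unfolding A'_def[symmetric] by (simp add: distrib_right)
qed

end

end

text \<open>
  The constant is obtained before the mesh size and the coefficients, hence depends only on \<open>lo\<close>,
  \<open>hi\<close>, \<open>L\<close>, \<open>T\<close> and the dimension.
\<close>

theorem Gamma_uniform_bound:
  fixes lo hi L T :: real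
  assumes "0 < lo" "0 < T"
  obtains C where "0 < C"
    "\<And>dx (c :: 'd::finite \<Rightarrow> int ^ 'd \<Rightarrow> real) t \<alpha> \<beta>. 0 < dx \<Longrightarrow> coefficients dx lo hi L c \<Longrightarrow> 0 < t \<Longrightarrow> t \<le> T \<Longrightarrow>
       \<bar>Gamma_kernel dx c t \<alpha> \<beta>\<bar> \<le> C * (env (t / dx\<^sup>2) (\<alpha> - \<beta>) / dx ^ CARD('d))"
proof -
  have "0 < 2 * lo" using assms by simp
  then obtain B where B: "1 \<le> B" "\<And>\<kappa> \<tau>. 2 * lo \<le> \<kappa> \<Longrightarrow> \<kappa> \<le> 2 * hi \<Longrightarrow> 0 < \<tau> \<Longrightarrow> walk_bounded B \<tau> (\<kappa> * \<tau>)"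
    using walk_bounded_uniform[of "2 * lo" "2 * hi" thesis] by blast
  define A where "A = (real CARD('d))\<^sup>2 * \<bar>L\<bar> * B ^ CARD('d)"
  define Q where "Q = (16 * (1 + pi)) ^ CARD('d)"
  define C where "C = B ^ CARD('d) + Q * (B ^ CARD('d) * (2 * (A + 8 * Q * A\<^sup>2 * exp ((2 * Q * A * pi + 1)\<^sup>2 * T) * sqrt T)) * (2 * sqrt T))"
  show ?thesis
  proof (rule that)
    have "0 \<le> A" "0 \<le> Q" using B(1) by (simp_all add: A_def Q_def)
    then show "0 < C" unfolding C_def using B(1) assms(2)
      by (intro add_pos_nonneg mult_nonneg_nonneg add_nonneg_nonneg zero_less_power zero_le_power) simp_all
    fix dx t :: real and c :: "'d \<Rightarrow> int ^ 'd \<Rightarrow> real" and \<alpha> \<beta>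
    assume a: "0 < dx" "coefficients dx lo hi L c" "0 < t" "t \<le> T"
    interpret coeffs dx lo hi L c by unfold_locales (use a assms in auto)
    show "\<bar>Gamma_kernel dx c t \<alpha> \<beta>\<bar> \<le> C * (env (t / dx\<^sup>2) (\<alpha> - \<beta>) / dx ^ CARD('d))"
      using Gamma_scaled_bound[OF B a(3,4), of \<alpha> \<beta>] unfolding C_def A_def Q_def scaled_def .
  qed
qed

section \<open>Comparison with the claimed profile\<close>

lemma cbar_bounds:
  assumes "coefficients dx lo hi L (c :: 'd::finite \<Rightarrow> int ^ 'd \<Rightarrow> real)"
  shows "lo \<le> cbar c" "cbar c \<le> hi"
proof -
  have b: "lo \<le> c j \<alpha>" "c j \<alpha> \<le> hi" for j \<alpha> using assms by (auto simp: coefficients_def)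
  show "cbar c \<le> hi" unfolding cbar_def by (rule cSUP_least) (auto simp: b)
  have "c undefined 0 \<le> cbar c"
  proof -
    have "bdd_above ((\<lambda>(j, \<alpha>). c j \<alpha>) ` UNIV)" using b by (intro bdd_aboveI[of _ hi]) auto
    from cSUP_upper[OF UNIV_I this, of "(undefined, 0)"] show ?thesis by (simp add: cbar_def)
  qed
  then show "lo \<le> cbar c" using b(1)[of undefined 0] by simp
qed

text \<open>
  With \<open>k\<close> for the supremum of the coefficients, the claimed factor and the cell differ only by
  constants depending on the bounds for \<open>k\<close>. The minimum \<open>1 / \<surd>(2 k) \<and> \<surd>t / dx\<close>, divided by \<open>\<surd>t\<close>,
  is comparable to \<open>min (1 / \<surd>t) (1 / dx)\<close>.
\<close>

lemma cell_le_profile: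
  assumes "0 < dx" "0 < t" "0 < lo" "lo \<le> k" "k \<le> hi"
  shows "cell (t / dx\<^sup>2) n / dx \<le> (1 + sqrt (2 * hi) + 1 / (2 * lo)) *
    ((if n = 0 then min (1 / sqrt (2 * k)) (sqrt t / dx) else 1) * (1 / sqrt t) * inverse (1 + (of_int n * dx)\<^sup>2 / (2 * k * t)))"
proof -
  define M where "M = 1 + sqrt (2 * hi) + 1 / (2 * lo)"
  have k: "0 < k" using assms by simp
  have sh: "0 \<le> sqrt (2 * hi)" using assms by simp
  have il: "0 < 1 / (2 * lo)" using assms by simp
  have M1: "1 \<le> M" using sh il by (simp add: M_def)
  have st: "0 < sqrt t" using assms by simp
  show ?thesis unfolding M_def[symmetric]
  proof (cases "n = 0")
    case True
    have r: "1 / sqrt (t / dx\<^sup>2) = dx / sqrt t" using assms by (simp add: real_sqrt_divide)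
    have "cell (t / dx\<^sup>2) n / dx = min 1 (dx / sqrt t) / dx" using True r by (simp add: cell_def)
    also have "\<dots> \<le> M * (min (1 / sqrt (2 * k)) (sqrt t / dx) * (1 / sqrt t))"
    proof (cases "1 / sqrt (2 * k) \<le> sqrt t / dx")
      case True
      have "sqrt (2 * k) \<le> M" using real_sqrt_le_mono[of "2 * k" "2 * hi"] assms il unfolding M_def by linarith
      then have "1 \<le> M * (1 / sqrt (2 * k))" using k by simp
      then have "1 * (1 / sqrt t) \<le> M * (1 / sqrt (2 * k)) * (1 / sqrt t)" using st by (intro mult_right_mono) auto
      moreover have "min 1 (dx / sqrt t) / dx \<le> (dx / sqrt t) / dx" using assms by (intro divide_right_mono) auto
      moreover have "(dx / sqrt t) / dx = 1 * (1 / sqrt t)" using assms by simp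
      ultimately show ?thesis using True by (simp add: min_absorb1)
    next
      case False
      have "min 1 (dx / sqrt t) / dx \<le> 1 / dx" using assms by (intro divide_right_mono) auto
      also have "\<dots> = 1 * (sqrt t / dx * (1 / sqrt t))" using st by simp
      also have "\<dots> \<le> M * (sqrt t / dx * (1 / sqrt t))" using M1 assms by (intro mult_right_mono) auto
      finally show ?thesis using False by (simp add: min_absorb2)
    qed
    finally show "cell (t / dx\<^sup>2) n / dx \<le> M * ((if n = 0 then min (1 / sqrt (2 * k)) (sqrt t / dx) else 1)
        * (1 / sqrt t) * inverse (1 + (of_int n * dx)\<^sup>2 / (2 * k * t)))" using True by simp
  next
    case False
    define y where "y = (of_int n * dx)\<^sup>2"
    have y: "0 \<le> y" by (simp add: y_def)
    have sq: "sqrt t * sqrt t = t" using assms by simp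
    have "cell (t / dx\<^sup>2) n / dx = sqrt (t / dx\<^sup>2) / (t / dx\<^sup>2 + (of_int n)\<^sup>2) / dx" using False by (simp add: cell_def)
    also have "sqrt (t / dx\<^sup>2) = sqrt t / dx" using assms by (simp add: real_sqrt_divide)
    also have "t / dx\<^sup>2 + (of_int n)\<^sup>2 = (t + y) / dx\<^sup>2" using assms by (simp add: y_def field_simps)
    also have "sqrt t / dx / ((t + y) / dx\<^sup>2) / dx = sqrt t / (t + y)" using assms by (simp add: power2_eq_square)
    also have "\<dots> \<le> M * (2 * k * sqrt t / (2 * k * t + y))"
    proof -
      have "1 = (1 / (2 * lo)) * (2 * lo)" using assms by simp
      also have "\<dots> \<le> M * (2 * k)" using assms sh il by (intro mult_mono) (auto simp: M_def)
      finally have "1 * y \<le> M * (2 * k) * y" using y by (intro mult_right_mono)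
      moreover have "1 * (2 * k * t) \<le> M * (2 * k * t)" using M1 k assms by (intro mult_right_mono) auto
      ultimately have "2 * k * t + y \<le> M * (2 * k) * (t + y)" by (simp add: algebra_simps)
      then have "1 / (t + y) \<le> M * (2 * k) / (2 * k * t + y)"
        using k assms y by (simp add: divide_le_eq le_divide_eq add_pos_nonneg mult_ac)
      then have "sqrt t * (1 / (t + y)) \<le> sqrt t * (M * (2 * k) / (2 * k * t + y))" using st by (intro mult_left_mono) auto
      then show ?thesis by (simp add: mult_ac)
    qed
    also have "2 * k * sqrt t / (2 * k * t + y) = 1 / sqrt t * inverse (1 + y / (2 * k * t))"
    proof -
      have "1 + y / (2 * k * t) = (2 * k * t + y) / (2 * k * t)" using k assms by (simp add: add_divide_distrib)
      then have "1 / sqrt t * inverse (1 + y / (2 * k * t)) = (2 * k * (t / sqrt t)) / (2 * k * t + y)" by simp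
      also have "t / sqrt t = sqrt t" using assms by (intro real_div_sqrt) simp
      finally show ?thesis by simp
    qed
    finally show "cell (t / dx\<^sup>2) n / dx \<le> M * ((if n = 0 then min (1 / sqrt (2 * k)) (sqrt t / dx) else 1)
        * (1 / sqrt t) * inverse (1 + (of_int n * dx)\<^sup>2 / (2 * k * t)))" using False by (simp add: y_def)
  qed
qed

lemma env_le_profile:
  fixes \<alpha> \<beta> :: "int ^ 'd::finite"
  assumes "0 < dx" "0 < t" "0 < lo" "lo \<le> k" "k \<le> hi"
  shows "env (t / dx\<^sup>2) (\<alpha> - \<beta>) / dx ^ CARD('d) \<le> (1 + sqrt (2 * hi) + 1 / (2 * lo)) ^ CARD('d) *
     (min (1 / sqrt (2 * k)) (sqrt t / dx) ^ num_zeros (\<alpha> - \<beta>) * t powr (- real CARD('d) / 2)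
       * (\<Prod>j\<in>UNIV. inverse (1 + \<bar>gridpt dx \<alpha> $ j - gridpt dx \<beta> $ j\<bar>\<^sup>2 / (2 * k * t))))"
proof -
  let ?m = "min (1 / sqrt (2 * k)) (sqrt t / dx)" and ?n = "\<lambda>j. (\<alpha> - \<beta>) $ j" and ?M = "1 + sqrt (2 * hi) + 1 / (2 * lo)"
  have "env (t / dx\<^sup>2) (\<alpha> - \<beta>) / dx ^ CARD('d) = (\<Prod>j\<in>UNIV. cell (t / dx\<^sup>2) (?n j) / dx)"
    by (simp add: env_def prod_dividef)
  also have "\<dots> \<le> (\<Prod>j\<in>UNIV. ?M * ((if ?n j = 0 then ?m else 1) * (1 / sqrt t) * inverse (1 + (of_int (?n j) * dx)\<^sup>2 / (2 * k * t))))"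
  proof (rule prod_mono)
    fix j
    have "0 < t / dx\<^sup>2" using assms by simp
    then have "0 \<le> cell (t / dx\<^sup>2) (?n j) / dx" using cell_pos[of "t / dx\<^sup>2"] assms by (simp add: less_imp_le)
    then show "0 \<le> cell (t / dx\<^sup>2) (?n j) / dx \<and> cell (t / dx\<^sup>2) (?n j) / dx \<le>
        ?M * ((if ?n j = 0 then ?m else 1) * (1 / sqrt t) * inverse (1 + (of_int (?n j) * dx)\<^sup>2 / (2 * k * t)))"
      using cell_le_profile[OF assms] by blast
  qed
  also have "\<dots> = ?M ^ CARD('d) * ((\<Prod>j\<in>UNIV. if ?n j = 0 then ?m else 1) * (1 / sqrt t) ^ CARD('d)
      * (\<Prod>j\<in>UNIV. inverse (1 + (of_int (?n j) * dx)\<^sup>2 / (2 * k * t))))"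
    by (simp only: prod.distrib prod_constant)
  also have "(\<Prod>j\<in>UNIV. if ?n j = 0 then ?m else 1) = ?m ^ num_zeros (\<alpha> - \<beta>)"
    unfolding num_zeros_def by (subst prod.inter_filter[symmetric]) simp_all
  also have "(1 / sqrt t) ^ CARD('d) = t powr (- real CARD('d) / 2)"
  proof -
    have "1 / sqrt t = t powr (- (1 / 2))" using assms by (simp add: powr_minus_divide powr_half_sqrt)
    then show ?thesis using assms by (simp add: powr_powr[symmetric] powr_realpow[symmetric] powr_powr)
  qed
  also have "(\<lambda>j. inverse (1 + (of_int (?n j) * dx)\<^sup>2 / (2 * k * t))) =
      (\<lambda>j. inverse (1 + \<bar>gridpt dx \<alpha> $ j - gridpt dx \<beta> $ j\<bar>\<^sup>2 / (2 * k * t)))"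
    by (simp add: gridpt_def left_diff_distrib)
  finally show ?thesis .
qed

lemma env_le_powr:
  fixes \<alpha> :: "int ^ 'd::finite"
  assumes "0 < dx" "0 < t"
  shows "env (t / dx\<^sup>2) \<alpha> / dx ^ CARD('d) \<le> t powr (- (real CARD('d) / 2))"
proof -
  have p: "0 < t / dx\<^sup>2" using assms by simp
  have "env (t / dx\<^sup>2) \<alpha> \<le> (\<Prod>j\<in>(UNIV :: 'd set). 1 / sqrt (t / dx\<^sup>2))"
    unfolding env_def using cell_le_inverse_sqrt[OF p] cell_pos[OF p] by (intro prod_mono) (auto intro: less_imp_le)
  also have "\<dots> = (dx / sqrt t) ^ CARD('d)" using assms by (simp add: real_sqrt_divide)
  finally have "env (t / dx\<^sup>2) \<alpha> / dx ^ CARD('d) \<le> (dx / sqrt t) ^ CARD('d) / dx ^ CARD('d)"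
    using assms by (intro divide_right_mono) auto
  also have "\<dots> = (1 / sqrt t) ^ CARD('d)" using assms by (simp add: power_divide)
  also have "1 / sqrt t = t powr (- (1 / 2))" using assms by (simp add: powr_minus_divide powr_half_sqrt)
  also have "(t powr (- (1 / 2))) ^ CARD('d) = t powr (- (real CARD('d) / 2))"
    using assms by (simp add: powr_realpow[symmetric] powr_powr)
  finally show ?thesis .
qed


section \<open>Lebesgue norms\<close>

text \<open>
  \<open>\<bar>f\<bar>\<^sup>q \<le> (sup \<bar>f\<bar>)\<^sup>q\<^sup>-\<^sup>1 \<bar>f\<bar>\<close>, summed over the grid.
\<close>

lemma Lp_interpolation:
  fixes f e :: "int ^ 'd::finite \<Rightarrow> real"
  assumes dx: "0 < dx" and C: "0 < C" and S: "0 < S" and P: "1 \<le> P"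
    and sup: "\<And>\<gamma>. \<bar>f \<gamma>\<bar> \<le> C * S" and l1: "\<And>\<gamma>. \<bar>f \<gamma>\<bar> * dx ^ CARD('d) \<le> C * e \<gamma>"
    and e: "e summable_on UNIV" "infsum e UNIV \<le> P"
  shows "in_Lp dx \<infinity> f \<and> Lp_norm dx \<infinity> f \<le> C * P * S"
    and "1 \<le> q \<Longrightarrow> in_Lp dx (ereal q) f \<and> Lp_norm dx (ereal q) f \<le> C * P * S powr (1 - 1 / q)"
proof -
  have bdd: "bounded (range f)" using sup by (auto intro!: boundedI[of _ "C * S"])
  have "(SUP \<gamma>. \<bar>f \<gamma>\<bar>) \<le> C * S" by (rule cSUP_least) (auto simp: sup)
  also have "\<dots> \<le> C * P * S" using C S P by simp
  finally show "in_Lp dx \<infinity> f \<and> Lp_norm dx \<infinity> f \<le> C * P * S" using bdd by (simp add: in_Lp_def Lp_norm_def)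
  assume q: "1 \<le> q"
  define K where "K = (C * S) powr (q - 1) * C"
  have K: "0 \<le> K" using C by (simp add: K_def)
  let ?g = "\<lambda>\<gamma>. \<bar>f \<gamma>\<bar> powr q * dx ^ CARD('d)"
  have le: "?g \<gamma> \<le> K * e \<gamma>" for \<gamma>
  proof -
    have "\<bar>f \<gamma>\<bar> powr q = \<bar>f \<gamma>\<bar> powr (q - 1) * \<bar>f \<gamma>\<bar>"
      using powr_add[of "\<bar>f \<gamma>\<bar>" "q - 1" 1] by (cases "f \<gamma> = 0") auto
    then have "?g \<gamma> = \<bar>f \<gamma>\<bar> powr (q - 1) * (\<bar>f \<gamma>\<bar> * dx ^ CARD('d))" by (simp add: mult.assoc)
    also have "\<dots> \<le> (C * S) powr (q - 1) * (C * e \<gamma>)"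
    proof (rule mult_mono)
      show "\<bar>f \<gamma>\<bar> powr (q - 1) \<le> (C * S) powr (q - 1)" using sup[of \<gamma>] q by (intro powr_mono2) auto
    qed (use l1[of \<gamma>] dx in auto)
    finally show ?thesis by (simp add: K_def mult.assoc)
  qed
  have nn: "0 \<le> ?g \<gamma>" for \<gamma> using dx by simp
  have Ke: "(\<lambda>\<gamma>. K * e \<gamma>) summable_on UNIV" by (intro summable_on_cmult_right e)
  have s: "?g summable_on UNIV" by (rule summable_on_comparison_test[OF Ke]) (auto simp: le nn)
  have "infsum ?g UNIV \<le> (\<Sum>\<^sub>\<infinity>\<gamma>. K * e \<gamma>)" by (rule infsum_mono[OF s Ke]) (rule le)
  also have "\<dots> = K * infsum e UNIV" by (rule infsum_cmult_right) (use e in auto)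
  also have "\<dots> \<le> K * P" using K e by (intro mult_left_mono)
  finally have I: "infsum ?g UNIV \<le> K * P" .
  have I0: "0 \<le> infsum ?g UNIV" by (rule infsum_nonneg) (rule nn)
  have "infsum ?g UNIV powr (1 / q) \<le> (K * P) powr (1 / q)" using I I0 q by (intro powr_mono2) auto
  also have "\<dots> = (C powr q * S powr (q - 1) * P) powr (1 / q)"
  proof -
    have "C powr q = C powr (q - 1) * C" using powr_add[of C "q - 1" 1] C by simp
    then have "K = C powr q * S powr (q - 1)" using C S by (simp add: K_def powr_mult mult_ac)
    then show ?thesis by simp
  qed
  also have "\<dots> = C * S powr (1 - 1 / q) * P powr (1 / q)"
  proof -
    have "(q - 1) * (1 / q) = 1 - 1 / q" using q by (simp add: field_simps)
    then show ?thesis using C S P q by (simp add: powr_mult powr_powr)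
  qed
  also have "\<dots> \<le> C * S powr (1 - 1 / q) * P powr 1" using C S P q by (intro mult_left_mono powr_mono) auto
  also have "\<dots> = C * P * S powr (1 - 1 / q)" using P by simp
  finally have "infsum ?g UNIV powr (1 / q) \<le> C * P * S powr (1 - 1 / q)" .
  then show "in_Lp dx (ereal q) f \<and> Lp_norm dx (ereal q) f \<le> C * P * S powr (1 - 1 / q)"
    using bdd s by (simp add: in_Lp_def Lp_norm_def)
qed

text \<open>
  For the dual exponent \<open>q\<close> of \<open>p\<close> the power \<open>1 - 1 / q\<close> of the supremum is \<open>1 / p\<close>.
\<close>

lemma Lp_dual_interpolation:
  fixes f e :: "int ^ 'd::finite \<Rightarrow> real" and p :: ereal
  assumes dx: "0 < dx" and C: "0 < C" and t: "0 < t" and P: "1 \<le> P" and p: "1 \<le> p"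
    and sup: "\<And>\<gamma>. \<bar>f \<gamma>\<bar> \<le> C * t powr (- (real CARD('d) / 2))"
    and l1: "\<And>\<gamma>. \<bar>f \<gamma>\<bar> * dx ^ CARD('d) \<le> C * e \<gamma>"
    and e: "e summable_on UNIV" "infsum e UNIV \<le> P"
  shows "in_Lp dx (dual_exponent p) f \<and>
    Lp_norm dx (dual_exponent p) f \<le> C * P * t powr (- (real CARD('d) / 2) * real_of_ereal (1 / p))"
proof -
  let ?S = "t powr (- (real CARD('d) / 2))"
  have S: "0 < ?S" using t by simp
  note I = Lp_interpolation[OF dx C S P sup l1 e]
  show ?thesis
  proof (cases p)
    case PInf
    then have "dual_exponent p = ereal 1" "real_of_ereal (1 / p) = 0" by (simp_all add: dual_exponent_def one_ereal_def)
    then show ?thesis using I(2)[of 1] t by simp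
  next
    case (real r)
    have r: "1 \<le> r" using p real by simp
    have rp: "real_of_ereal (1 / p) = 1 / r" using real r by (simp add: one_ereal_def)
    show ?thesis
    proof (cases "r = 1")
      case True
      then have "dual_exponent p = \<infinity>" using real by (simp add: dual_exponent_def one_ereal_def[symmetric] zero_ereal_def[symmetric])
      then show ?thesis using I(1) rp True by simp
    next
      case False
      then have d: "dual_exponent p = ereal (r / (r - 1))" using real r by (simp add: dual_exponent_def one_ereal_def)
      have q: "1 \<le> r / (r - 1)" using r False by simp
      have "1 - 1 / (r / (r - 1)) = 1 / r" using r False by (simp add: field_simps)
      then have "?S powr (1 - 1 / (r / (r - 1))) = t powr (- (real CARD('d) / 2) * (1 / r))" by (simp only: powr_powr)
      then show ?thesis using I(2)[OF q] unfolding d rp by simp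
    qed
  next
    case MInf
    then show ?thesis using p by simp
  qed
qed


section \<open>Existence and properties of the fundamental solution\<close>

theorem theorem4p4:
  fixes lo hi L :: real
  assumes "0 < lo"
  shows
    "(\<forall>dx > 0. \<forall>c :: 'd::finite \<Rightarrow> int ^ 'd \<Rightarrow> real. coefficients dx lo hi L c \<longrightarrow>
        kernels_well_defined dx c \<and>
        fundamental_solution dx c (Gamma_kernel dx c) \<and>
        (\<forall>t \<ge> 0. \<forall>s \<in> {0..t}.
           conv_summable (Gamma_kernel dx c s) (Gamma_kernel dx c (t - s)) \<and>
           (\<forall>\<alpha> \<beta>. Gamma_kernel dx c t \<alpha> \<beta> =
              conv dx (Gamma_kernel dx c s) (Gamma_kernel dx c (t - s)) \<alpha> \<beta>))) \<and>
     (\<forall>T > 0. \<exists>C. \<forall>dx > 0. \<forall>c :: 'd \<Rightarrow> int ^ 'd \<Rightarrow> real. coefficients dx lo hi L c \<longrightarrow>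
        (\<forall>\<alpha> \<beta>. \<forall>t \<in> {0<..T}.
           \<bar>Gamma_kernel dx c t \<alpha> \<beta>\<bar> \<le>
             C * min (1 / sqrt (2 * cbar c)) (sqrt t / dx) ^ num_zeros (\<alpha> - \<beta>)
               * t powr (- real CARD('d) / 2)
               * (\<Prod>j\<in>UNIV. inverse (1 + \<bar>gridpt dx \<alpha> $ j - gridpt dx \<beta> $ j\<bar>\<^sup>2 / (2 * cbar c * t))))) \<and>
     (\<forall>T > 0. \<forall>p \<ge> (1 :: ereal). \<exists>C. \<forall>dx > 0. \<forall>c :: 'd \<Rightarrow> int ^ 'd \<Rightarrow> real.
        coefficients dx lo hi L c \<longrightarrow>
        (\<forall>t \<in> {0<..T}. \<forall>\<alpha> \<beta>.
           in_Lp dx (dual_exponent p) (\<lambda>\<gamma>. Gamma_kernel dx c t \<gamma> \<beta>) \<and>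
           in_Lp dx (dual_exponent p) (\<lambda>\<gamma>. Gamma_kernel dx c t \<alpha> \<gamma>) \<and>
           Lp_norm dx (dual_exponent p) (\<lambda>\<gamma>. Gamma_kernel dx c t \<gamma> \<beta>) +
           Lp_norm dx (dual_exponent p) (\<lambda>\<gamma>. Gamma_kernel dx c t \<alpha> \<gamma>) \<le>
             C * t powr (- (real CARD('d) / 2) * real_of_ereal (1 / p))))"
proof (intro conjI allI impI)
  fix dx :: real and c :: "'d \<Rightarrow> int ^ 'd \<Rightarrow> real"
  assume a: "0 < dx" "coefficients dx lo hi L c"
  interpret coeffs dx lo hi L c by unfold_locales (use a assms in auto)
  show "kernels_well_defined dx c" by (rule all_kernels_well_defined)
  show "fundamental_solution dx c (Gamma_kernel dx c)" by (rule Gamma_fundamental_solution)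
  show "\<forall>s\<in>{0..t}. conv_summable (Gamma_kernel dx c s) (Gamma_kernel dx c (t - s)) \<and>
      (\<forall>\<alpha> \<beta>. Gamma_kernel dx c t \<alpha> \<beta> = conv dx (Gamma_kernel dx c s) (Gamma_kernel dx c (t - s)) \<alpha> \<beta>)" for t
    using Gamma_semigroup by blast
next
  fix T :: real assume T: "0 < T"
  obtain C where C: "0 < C" and bound: "\<And>dx (c :: 'd \<Rightarrow> int ^ 'd \<Rightarrow> real) t \<alpha> \<beta>. 0 < dx \<Longrightarrow> coefficients dx lo hi L c \<Longrightarrow> 0 < t \<Longrightarrow> t \<le> T \<Longrightarrow>
       \<bar>Gamma_kernel dx c t \<alpha> \<beta>\<bar> \<le> C * (env (t / dx\<^sup>2) (\<alpha> - \<beta>) / dx ^ CARD('d))"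
    by (rule Gamma_uniform_bound[OF assms T, where L = L and hi = hi]) (rule that)
  let ?M = "(1 + sqrt (2 * hi) + 1 / (2 * lo)) ^ CARD('d)"
  show "\<exists>C. \<forall>dx > 0. \<forall>c :: 'd \<Rightarrow> int ^ 'd \<Rightarrow> real. coefficients dx lo hi L c \<longrightarrow>
        (\<forall>\<alpha> \<beta>. \<forall>t \<in> {0<..T}.
           \<bar>Gamma_kernel dx c t \<alpha> \<beta>\<bar> \<le>
             C * min (1 / sqrt (2 * cbar c)) (sqrt t / dx) ^ num_zeros (\<alpha> - \<beta>)
               * t powr (- real CARD('d) / 2)
               * (\<Prod>j\<in>UNIV. inverse (1 + \<bar>gridpt dx \<alpha> $ j - gridpt dx \<beta> $ j\<bar>\<^sup>2 / (2 * cbar c * t))))"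
  proof (intro exI[of _ "C * ?M"] allI impI ballI)
    fix dx t :: real and c :: "'d \<Rightarrow> int ^ 'd \<Rightarrow> real" and \<alpha> \<beta> :: "int ^ 'd"
    assume a: "0 < dx" "coefficients dx lo hi L c" "t \<in> {0<..T}"
    let ?R = "min (1 / sqrt (2 * cbar c)) (sqrt t / dx) ^ num_zeros (\<alpha> - \<beta>) * t powr (- real CARD('d) / 2)
       * (\<Prod>j\<in>UNIV. inverse (1 + \<bar>gridpt dx \<alpha> $ j - gridpt dx \<beta> $ j\<bar>\<^sup>2 / (2 * cbar c * t)))"
    have t: "0 < t" "t \<le> T" using a by auto
    have "\<bar>Gamma_kernel dx c t \<alpha> \<beta>\<bar> \<le> C * (env (t / dx\<^sup>2) (\<alpha> - \<beta>) / dx ^ CARD('d))" by (rule bound[OF a(1,2) t])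
    also have "\<dots> \<le> C * (?M * ?R)"
      using C by (intro mult_left_mono env_le_profile[OF a(1) t(1) assms cbar_bounds[OF a(2)]]) simp
    finally show "\<bar>Gamma_kernel dx c t \<alpha> \<beta>\<bar> \<le> C * ?M * min (1 / sqrt (2 * cbar c)) (sqrt t / dx) ^ num_zeros (\<alpha> - \<beta>)
               * t powr (- real CARD('d) / 2)
               * (\<Prod>j\<in>UNIV. inverse (1 + \<bar>gridpt dx \<alpha> $ j - gridpt dx \<beta> $ j\<bar>\<^sup>2 / (2 * cbar c * t)))"
      by (simp only: mult.assoc)
  qed
  fix p :: ereal assume p: "1 \<le> p"
  let ?P = "(1 + pi) ^ CARD('d)"
  have P: "1 \<le> ?P" by (intro one_le_power) simp
  show "\<exists>C. \<forall>dx > 0. \<forall>c :: 'd \<Rightarrow> int ^ 'd \<Rightarrow> real.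
        coefficients dx lo hi L c \<longrightarrow>
        (\<forall>t \<in> {0<..T}. \<forall>\<alpha> \<beta>.
           in_Lp dx (dual_exponent p) (\<lambda>\<gamma>. Gamma_kernel dx c t \<gamma> \<beta>) \<and>
           in_Lp dx (dual_exponent p) (\<lambda>\<gamma>. Gamma_kernel dx c t \<alpha> \<gamma>) \<and>
           Lp_norm dx (dual_exponent p) (\<lambda>\<gamma>. Gamma_kernel dx c t \<gamma> \<beta>) +
           Lp_norm dx (dual_exponent p) (\<lambda>\<gamma>. Gamma_kernel dx c t \<alpha> \<gamma>) \<le>
             C * t powr (- (real CARD('d) / 2) * real_of_ereal (1 / p)))"
  proof (intro exI[of _ "2 * (C * ?P)"] allI impI ballI conjI)
    fix dx t :: real and c :: "'d \<Rightarrow> int ^ 'd \<Rightarrow> real" and \<alpha> \<beta> :: "int ^ 'd"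
    assume a: "0 < dx" "coefficients dx lo hi L c" "t \<in> {0<..T}"
    have t: "0 < t" "t \<le> T" using a by auto
    have \<tau>: "0 < t / dx\<^sup>2" using t a by simp
    have D: "0 < dx ^ CARD('d)" using a by simp
    note b = bound[OF a(1,2) t]
    have sup: "\<bar>Gamma_kernel dx c t \<alpha> \<beta>\<bar> \<le> C * t powr (- (real CARD('d) / 2))" for \<alpha> \<beta>
      using C by (intro order_trans[OF b] mult_left_mono env_le_powr[OF a(1) t(1)]) simp
    have l1: "\<bar>Gamma_kernel dx c t \<alpha> \<beta>\<bar> * dx ^ CARD('d) \<le> C * env (t / dx\<^sup>2) (\<alpha> - \<beta>)" for \<alpha> \<beta>
      using b[of \<alpha> \<beta>] D by (simp add: pos_le_divide_eq)
    let ?p = "t powr (- (real CARD('d) / 2) * real_of_ereal (1 / p))"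
    have 1: "in_Lp dx (dual_exponent p) (\<lambda>\<gamma>. Gamma_kernel dx c t \<gamma> \<beta>) \<and>
        Lp_norm dx (dual_exponent p) (\<lambda>\<gamma>. Gamma_kernel dx c t \<gamma> \<beta>) \<le> C * ?P * ?p"
      by (rule Lp_dual_interpolation[OF a(1) C t(1) P p sup l1 env_summable(3,4)[OF \<tau>]])
    have 2: "in_Lp dx (dual_exponent p) (\<lambda>\<gamma>. Gamma_kernel dx c t \<alpha> \<gamma>) \<and>
        Lp_norm dx (dual_exponent p) (\<lambda>\<gamma>. Gamma_kernel dx c t \<alpha> \<gamma>) \<le> C * ?P * ?p"
      by (rule Lp_dual_interpolation[OF a(1) C t(1) P p sup l1 env_summable(1,2)[OF \<tau>]])
    from 1 2 show "in_Lp dx (dual_exponent p) (\<lambda>\<gamma>. Gamma_kernel dx c t \<gamma> \<beta>)"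
      "in_Lp dx (dual_exponent p) (\<lambda>\<gamma>. Gamma_kernel dx c t \<alpha> \<gamma>)" by blast+
    have "Lp_norm dx (dual_exponent p) (\<lambda>\<gamma>. Gamma_kernel dx c t \<gamma> \<beta>) +
           Lp_norm dx (dual_exponent p) (\<lambda>\<gamma>. Gamma_kernel dx c t \<alpha> \<gamma>) \<le> C * ?P * ?p + C * ?P * ?p"
      using 1 2 by (intro add_mono) blast+
    also have "\<dots> = 2 * (C * ?P) * ?p" by simp
    finally show "Lp_norm dx (dual_exponent p) (\<lambda>\<gamma>. Gamma_kernel dx c t \<gamma> \<beta>) +
           Lp_norm dx (dual_exponent p) (\<lambda>\<gamma>. Gamma_kernel dx c t \<alpha> \<gamma>) \<le> 2 * (C * ?P) * ?p" .
  qed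
qed

end
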